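(* Let $0\le\underline\sigma\le\overline\sigma$, and let $S$ be the $G$-expectation semigroup on $\mathrm{BUC}(\mathbb{R})$, \[\big(S(t)f\big)(x):=\sup_{\sigma\in\Sigma}\mathbb{E}\Big[f\Big(x+\int_0^t\sigma_s\,dW_s\Big)\Big]\quad\text{for }f\in\mathrm{BUC}(\mathbb{R}),\ x\in\mathbb{R},\ t\ge0.\] Then its symmetric Lipschitz set is given by $D_L^s=W^{2,\infty}$.
   Context: $\mathrm{BUC}(\mathbb{R})$ is the space of bounded uniformly continuous functions $\mathbb{R}\to\mathbb{R}$ with the supremum norm $\|\cdot\|_\infty$. $W$ is a Brownian motion on a filtered probability space $(\Omega,\mathcal{F},(\mathcal{F}_t),\mathbb{P})$, and $\Sigma$ denotes the set of all progressively measurable processes with values in $[\underline\sigma,\overline\sigma]$. The family $S=(S(t))_{t\ge0}$ is a translation invariant sublinear monotone strongly continuous semigroup on $\mathrm{BUC}(\mathbb{R})$. The Lipschitz set is $D_L:=\{f\in\mathrm{BUC}(\mathbb{R})\colon\sup_{h\in(0,h_0]}\|\frac{S(h)f-f}{h}\|_\infty<\infty\text{ for some }h_0>0\}$, and the symmetric Lipschitz set is $D_L^s:=\{f\in\mathrm{BUC}(\mathbb{R})\colon f,-f\in D_L\}$. $W^{2,\infty}=W^{2,\infty}(\mathbb{R})$ is the space of functions $f\in L^\infty(\mathbb{R})$ with weak derivatives $f',f''\in L^\infty(\mathbb{R})$, identified with their continuously differentiable representatives.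
   Formalization: The formal statement additionally assumes $\overline\sigma>0$: if $\underline\sigma=\overline\sigma=0$, then $S(t)f=f$ and $D_L^s=\mathrm{BUC}(\mathbb{R})\ne W^{2,\infty}$ (e.g. $f(x)=\max(0,1-|x|)$), so the claim fails in exactly that case. *)

theory Defs
  imports "HOL-Probability.Probability"
begin

section \<open>Bounded uniformly continuous functions and Lipschitz sets\<close>

definition BUC :: "(real \<Rightarrow> real) set" where
  "BUC = {f. bounded (range f) \<and> uniformly_continuous_on UNIV f}"

text \<open>The supremum norm takes values in \<^typ>\<open>ennreal\<close>, so that it is \<open>\<infinity>\<close> on unbounded functions.\<close>

definition sup_norm :: "(real \<Rightarrow> real) \<Rightarrow> ennreal" where
  "sup_norm f = (SUP x. ennreal \<bar>f x\<bar>)"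

definition lipschitz_set :: "(real \<Rightarrow> (real \<Rightarrow> real) \<Rightarrow> (real \<Rightarrow> real)) \<Rightarrow> (real \<Rightarrow> real) set" where
  "lipschitz_set S =
     {f \<in> BUC. \<exists>h0>0. (SUP h\<in>{0<..h0}. sup_norm (\<lambda>x. (S h f x - f x) / h)) < \<infinity>}"

definition sym_lipschitz_set :: "(real \<Rightarrow> (real \<Rightarrow> real) \<Rightarrow> (real \<Rightarrow> real)) \<Rightarrow> (real \<Rightarrow> real) set" where
  "sym_lipschitz_set S = {f \<in> BUC. f \<in> lipschitz_set S \<and> (\<lambda>x. - f x) \<in> lipschitz_set S}"


section \<open>The Sobolev space \<open>W\<^sup>2\<^sup>,\<^sup>\<infinity>\<close> on the real line\<close>

definition Linfty :: "(real \<Rightarrow> real) set" where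
  "Linfty = {f \<in> borel_measurable lborel. esssup lborel (\<lambda>x. ereal \<bar>f x\<bar>) < \<infinity>}"

definition test_function :: "(real \<Rightarrow> real) \<Rightarrow> bool" where
  "test_function \<phi> \<longleftrightarrow>
     (\<forall>n x. ((deriv ^^ n) \<phi>) differentiable (at x)) \<and> compact (closure {x. \<phi> x \<noteq> 0})"

definition weak_derivative :: "(real \<Rightarrow> real) \<Rightarrow> (real \<Rightarrow> real) \<Rightarrow> bool" where
  "weak_derivative f g \<longleftrightarrow>
     (\<forall>a b. set_integrable lborel {a..b} f \<and> set_integrable lborel {a..b} g) \<and>
     (\<forall>\<phi>. test_function \<phi> \<longrightarrow>
        (LINT x|lborel. f x * deriv \<phi> x) = - (LINT x|lborel. g x * \<phi> x))"

text \<open>Elements are functions rather than classes modulo null sets; each class is represented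
  by its unique continuously differentiable member.\<close>

definition W2infty :: "(real \<Rightarrow> real) set" where
  "W2infty = {f. f C1_differentiable_on UNIV \<and> f \<in> Linfty \<and>
     (\<exists>f'\<in>Linfty. \<exists>f''\<in>Linfty. weak_derivative f f' \<and> weak_derivative f' f'')}"


section \<open>Brownian motion on a filtered probability space\<close>

text \<open>Time is indexed by \<^typ>\<open>real\<close>, but only times \<open>t \<ge> 0\<close> matter: a filtration
  \<open>(F\<^sub>t)\<^sub>t\<^sub>\<ge>\<^sub>0\<close> is extended by \<open>F\<^sub>t = F\<^sub>0\<close> for \<open>t < 0\<close>.
  The usual conditions are not required.\<close>

definition filtered_prob_space :: "'a measure \<Rightarrow> (real \<Rightarrow> 'a measure) \<Rightarrow> bool" where
  "filtered_prob_space M F \<longleftrightarrow>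
     prob_space M \<and> filtration (space M) F \<and> (\<forall>t. subalgebra M (F t))"

definition brownian_motion ::
    "'a measure \<Rightarrow> (real \<Rightarrow> 'a measure) \<Rightarrow> (real \<Rightarrow> 'a \<Rightarrow> real) \<Rightarrow> bool" where
  "brownian_motion M F W \<longleftrightarrow>
     (AE \<omega> in M. W 0 \<omega> = 0) \<and>
     (AE \<omega> in M. continuous_on {0..} (\<lambda>t. W t \<omega>)) \<and>
     (\<forall>t\<ge>0. W t \<in> borel_measurable (F t)) \<and>
     (\<forall>s t. 0 \<le> s \<and> s < t \<longrightarrow>
        distributed M lborel (\<lambda>\<omega>. W t \<omega> - W s \<omega>) (normal_density 0 (sqrt (t - s))) \<and>
        prob_space.indep_set M (sets (F s))
          {(\<lambda>\<omega>. W t \<omega> - W s \<omega>) -` A \<inter> space M |A. A \<in> sets borel})"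

definition progressively_measurable :: "(real \<Rightarrow> 'a measure) \<Rightarrow> (real \<Rightarrow> 'a \<Rightarrow> real) \<Rightarrow> bool" where
  "progressively_measurable F \<sigma> \<longleftrightarrow>
     (\<forall>T\<ge>0. (\<lambda>(s, \<omega>). \<sigma> s \<omega>) \<in> borel_measurable (restrict_space borel {0..T} \<Otimes>\<^sub>M F T))"

definition admissible_controls ::
    "'a measure \<Rightarrow> (real \<Rightarrow> 'a measure) \<Rightarrow> real \<Rightarrow> real \<Rightarrow> (real \<Rightarrow> 'a \<Rightarrow> real) set" where
  "admissible_controls M F \<sigma>l \<sigma>u =
     {\<sigma>. progressively_measurable F \<sigma> \<and> (\<forall>s\<ge>0. \<forall>\<omega>\<in>space M. \<sigma> s \<omega> \<in> {\<sigma>l..\<sigma>u})}"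


section \<open>The Ito integral\<close>

text \<open>A list of triples \<open>(a, b, \<xi>)\<close> represents the simple process that is the sum of the
  terms \<open>\<xi> 1\<^bsub>(a,b]\<^esub>\<close>. The intervals may overlap.\<close>

type_synonym 'a simple_process = "(real \<times> real \<times> ('a \<Rightarrow> real)) list"

definition simple_process :: "'a measure \<Rightarrow> (real \<Rightarrow> 'a measure) \<Rightarrow> 'a simple_process \<Rightarrow> bool" where
  "simple_process M F H \<longleftrightarrow>
     (\<forall>(a, b, \<xi>)\<in>set H. 0 \<le> a \<and> a \<le> b \<and> \<xi> \<in> borel_measurable (F a) \<and> bounded (\<xi> ` space M))"

definition simple_value :: "'a simple_process \<Rightarrow> real \<Rightarrow> 'a \<Rightarrow> real" where
  "simple_value H s \<omega> = (\<Sum>(a, b, \<xi>)\<leftarrow>H. \<xi> \<omega> * indicator {a<..b} s)"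

definition simple_integral ::
    "(real \<Rightarrow> 'a \<Rightarrow> real) \<Rightarrow> 'a simple_process \<Rightarrow> real \<Rightarrow> 'a \<Rightarrow> real" where
  "simple_integral W H t \<omega> = (\<Sum>(a, b, \<xi>)\<leftarrow>H. \<xi> \<omega> * (W (min b t) \<omega> - W (min a t) \<omega>))"

text \<open>The Ito integral up to time \<open>t\<close> is the \<open>L\<^sup>2(M)\<close>-limit of the integrals of simple processes
  that approximate the integrand in \<open>L\<^sup>2([0,t] \<times> M)\<close>. This determines it up to almost sure
  equality, and \<open>ito_integral\<close> chooses a version.\<close>

definition is_ito_integral ::
    "'a measure \<Rightarrow> (real \<Rightarrow> 'a measure) \<Rightarrow> (real \<Rightarrow> 'a \<Rightarrow> real) \<Rightarrow> (real \<Rightarrow> 'a \<Rightarrow> real) \<Rightarrow> real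
      \<Rightarrow> ('a \<Rightarrow> real) \<Rightarrow> bool" where
  "is_ito_integral M F W \<sigma> t X \<longleftrightarrow> X \<in> borel_measurable M \<and>
     (\<exists>H. (\<forall>n. simple_process M F (H n)) \<and>
        (\<lambda>n. \<integral>\<^sup>+\<omega>. (\<integral>\<^sup>+s\<in>{0..t}. ennreal ((simple_value (H n) s \<omega> - \<sigma> s \<omega>)\<^sup>2) \<partial>lborel) \<partial>M)
          \<longlonglongrightarrow> 0 \<and>
        (\<lambda>n. \<integral>\<^sup>+\<omega>. ennreal ((simple_integral W (H n) t \<omega> - X \<omega>)\<^sup>2) \<partial>M) \<longlonglongrightarrow> 0)"

definition ito_integral ::
    "'a measure \<Rightarrow> (real \<Rightarrow> 'a measure) \<Rightarrow> (real \<Rightarrow> 'a \<Rightarrow> real) \<Rightarrow> (real \<Rightarrow> 'a \<Rightarrow> real) \<Rightarrow> real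
      \<Rightarrow> 'a \<Rightarrow> real" where
  "ito_integral M F W \<sigma> t = (SOME X. is_ito_integral M F W \<sigma> t X)"


section \<open>The \<open>G\<close>-expectation semigroup\<close>

definition G_semigroup ::
    "'a measure \<Rightarrow> (real \<Rightarrow> 'a measure) \<Rightarrow> (real \<Rightarrow> 'a \<Rightarrow> real) \<Rightarrow> real \<Rightarrow> real
      \<Rightarrow> real \<Rightarrow> (real \<Rightarrow> real) \<Rightarrow> (real \<Rightarrow> real)" where
  "G_semigroup M F W \<sigma>l \<sigma>u t f x =
     (SUP \<sigma>\<in>admissible_controls M F \<sigma>l \<sigma>u. LINT \<omega>|M. f (x + ito_integral M F W \<sigma> t \<omega>))"

end

theory Submission
  imports Defs
begin

text \<open>
  If \<open>f'\<close> is Lipschitz, then \<open>f (x + X) = f x + f' x * X + O(X\<^sup>2)\<close>, and every admissible Ito integral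
  \<open>X\<close> up to time \<open>h\<close> satisfies \<open>E X = 0\<close> and \<open>E X\<^sup>2 = O(h)\<close>; so both \<open>f\<close> and \<open>- f\<close> lie in the Lipschitz
  set. Conversely, the Lipschitz bounds for \<open>f\<close> and \<open>- f\<close> together with the constant control
  \<open>\<sigma>u\<close> give \<open>\<bar>E f (x + \<sigma>u * W\<^sub>h) - f x\<bar> \<le> C * h\<close>. If \<open>f + K x\<^sup>2 / 2\<close> with \<open>K > 2 C / \<sigma>u\<^sup>2\<close> were not convex, then
  \<open>f\<close> would be touched from above at some point by \<open>p y - K y\<^sup>2 / 2 + A y\<^sup>4\<close>, and taking expectations would
  contradict this bound as \<open>h\<close> tends to 0. Hence \<open>f\<close> is both semiconvex and semiconcave, so that
  \<open>f'\<close> exists and is Lipschitz.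
\<close>

section \<open>Functions with Lipschitz derivative\<close>

text \<open>In the harder inclusion the supremum over controls enters through one inequality: S(h) f
  and S(h)(-f) dominate the expectations of f and -f along \<sigma>u W. Upper bounds on both
  therefore confine the linear heat flow of f from two sides, which is where the symmetry of the set
  is used. For \<open>\<sigma>u = 0\<close> the semigroup would be the identity and its symmetric
  Lipschitz set all of \<open>BUC\<close>; hence \<open>nondegenerate\<close>.

  A failure of convexity yields a touching that is only local, while the heat flow sees the whole
  line. As f is bounded, a quartic term makes the inequality global, and it costs only O(h^2)
  because the fourth moment of W_h is 3 h^2.

  \<open>ito_integral\<close> is a choice, so nothing can be said about it until an integral is
  known to exist for each admissible control. That is the bulk of the stochastic part: isometry,
  completeness of L^2, density of adapted simple processes.

  Weak derivatives and semigroup estimates meet in the Taylor bound \<open>C11\<close>. Testing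
  against shifted bumps gives it from a bounded weak f''; in the other direction f'' is a
  Radon-Nikodym density.\<close>

text \<open>Where the chord inequality fails, g minus the chord is positive, while it vanishes at
  both endpoints. Its maximum is therefore interior, and the chord moved up to that point lies above
  g nearby.\<close>

lemma not_convex_touching:
  fixes g :: "real \<Rightarrow> real"
  assumes cont: "continuous_on UNIV g" and nc: "\<not> convex_on UNIV g"
  obtains x0 p \<delta> where "\<delta> > 0" "\<And>x. \<bar>x - x0\<bar> < \<delta> \<Longrightarrow> g x \<le> g x0 + p * (x - x0)"
proof -
  obtain t a b where t: "0 < t" "t < 1" and ab: "a < b"
    and gt: "g ((1 - t) * a + t * b) > (1 - t) * g a + t * g b"
  proof -
    have "\<exists>t a b. 0 < t \<and> t < 1 \<and> a < b \<and> \<not> g ((1 - t) * a + t * b) \<le> (1 - t) * g a + t * g b"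
    proof (rule ccontr)
      assume "\<not> ?thesis"
      then have "convex_on UNIV g"
        by (intro convex_on_linorderI) auto
      with nc show False ..
    qed
    then show ?thesis using that by (auto simp: not_le)
  qed
  define p where "p = (g b - g a) / (b - a)"
  define u where "u = (\<lambda>x. g x - g a - p * (x - a))"
  have pb: "p * (b - a) = g b - g a"
    using ab by (simp add: p_def)
  define m where "m = (1 - t) * a + t * b"
  have m: "a < m" "m < b"
  proof -
    have "t * a < t * b" "(1 - t) * a < (1 - t) * b" using t ab by auto
    then show "a < m" "m < b" by (auto simp: m_def algebra_simps)
  qed
  have "p * (m - a) = t * (p * (b - a))" by (simp add: m_def algebra_simps)
  then have um: "u m > 0"
    using gt unfolding u_def m_def[symmetric] pb by (simp add: algebra_simps)
  have cu: "continuous_on {a..b} u"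
    unfolding u_def by (intro continuous_intros continuous_on_subset[OF cont]) auto
  obtain x0 where x0: "x0 \<in> {a..b}" and max: "\<And>y. y \<in> {a..b} \<Longrightarrow> u y \<le> u x0"
    using continuous_attains_sup[OF compact_Icc _ cu] ab by auto
  have "u x0 > 0" using max[of m] m um by auto
  moreover have "u a = 0" "u b = 0" using pb by (auto simp: u_def)
  ultimately have "x0 \<noteq> a" "x0 \<noteq> b" by auto
  then have x0': "a < x0" "x0 < b" using x0 by auto
  show ?thesis
  proof (rule that[of "min (x0 - a) (b - x0)" x0 p])
    show "min (x0 - a) (b - x0) > 0" using x0' by auto
    fix x assume "\<bar>x - x0\<bar> < min (x0 - a) (b - x0)"
    then have "u x \<le> u x0" by (intro max) auto
    then show "g x \<le> g x0 + p * (x - x0)" by (simp add: u_def algebra_simps)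
  qed
qed

text \<open>Within distance \<delta> of the touching point the parabola alone suffices. Further away
  the boundedness of f lets a multiple of y^4 dominate everything else, so that the inequality holds
  for all y and expectations can be taken.\<close>

lemma not_semiconvex_touching:
  fixes f :: "real \<Rightarrow> real"
  assumes cont: "continuous_on UNIV f" and bd: "\<And>x. \<bar>f x\<bar> \<le> B" and K: "0 \<le> K"
    and nc: "\<not> convex_on UNIV (\<lambda>x. f x + K / 2 * x\<^sup>2)"
  obtains x0 p A where "0 \<le> A"
    "\<And>y. f (x0 + y) \<le> f x0 + p * y - K / 2 * y\<^sup>2 + A * y ^ 4"
proof -
  have "continuous_on UNIV (\<lambda>x. f x + K / 2 * x\<^sup>2)"
    by (intro continuous_intros cont)
  then obtain x0 q \<delta> where \<delta>: "\<delta> > 0" and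
    touch: "\<And>x. \<bar>x - x0\<bar> < \<delta> \<Longrightarrow> f x + K / 2 * x\<^sup>2 \<le> f x0 + K / 2 * x0\<^sup>2 + q * (x - x0)"
    using not_convex_touching[OF _ nc] by metis
  \<comment> \<open>The slope at \<open>x0\<close> of the touching function q x - K x^2 / 2.\<close>
  define p where "p = q - K * x0"
  \<comment> \<open>For \<bar>y\<bar> \<ge> \<delta> the three summands absorb in turn the
    oscillation 2 B of f, the linear term and the quadratic term; each is divided by the power of
    \<delta> that it lacks to reach y^4.\<close>
  define A where "A = 2 * B / \<delta> ^ 4 + \<bar>p\<bar> / \<delta> ^ 3 + K / 2 / \<delta> ^ 2"
  have B: "B \<ge> 0" using bd[of 0] by linarith
  have A0: "A \<ge> 0" using B K \<delta> by (simp add: A_def)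
  show ?thesis
  proof (rule that[OF A0, of x0 p])
    fix y
    show "f (x0 + y) \<le> f x0 + p * y - K / 2 * y\<^sup>2 + A * y ^ 4"
    proof (cases "\<bar>y\<bar> < \<delta>")
      case True
      have "f (x0 + y) \<le> f x0 + p * y - K / 2 * y\<^sup>2"
        using touch[of "x0 + y"] True by (simp add: p_def power2_eq_square algebra_simps)
      also have "\<dots> \<le> \<dots> + A * y ^ 4" using A0 by simp
      finally show ?thesis .
    next
      case False
      then have y: "\<bar>y\<bar> \<ge> \<delta>" by simp
      have y4: "y ^ 4 = \<bar>y\<bar> ^ 4" by (simp add: power_even_abs)
      have "2 * B = 2 * B / \<delta> ^ 4 * \<delta> ^ 4" using \<delta> by simp
      also have "\<dots> \<le> 2 * B / \<delta> ^ 4 * \<bar>y\<bar> ^ 4"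
        using y \<delta> B by (intro mult_left_mono power_mono) auto
      finally have 1: "2 * B \<le> 2 * B / \<delta> ^ 4 * y ^ 4" unfolding y4 .
      have "\<bar>p\<bar> * \<bar>y\<bar> = \<bar>p\<bar> / \<delta> ^ 3 * (\<delta> ^ 3 * \<bar>y\<bar>)" using \<delta> by simp
      also have "\<dots> \<le> \<bar>p\<bar> / \<delta> ^ 3 * (\<bar>y\<bar> ^ 3 * \<bar>y\<bar>)"
        using y \<delta> by (intro mult_left_mono mult_right_mono power_mono) auto
      also have "\<bar>y\<bar> ^ 3 * \<bar>y\<bar> = y ^ 4" unfolding y4 by (simp add: eval_nat_numeral)
      finally have 2: "- (p * y) \<le> \<bar>p\<bar> / \<delta> ^ 3 * y ^ 4"
        using abs_ge_minus_self[of "p * y"] by (simp add: abs_mult)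
      have "K / 2 * y\<^sup>2 = K / 2 / \<delta> ^ 2 * (\<delta>\<^sup>2 * \<bar>y\<bar> ^ 2)" using \<delta> by simp
      also have "\<dots> \<le> K / 2 / \<delta> ^ 2 * (\<bar>y\<bar>\<^sup>2 * \<bar>y\<bar>\<^sup>2)"
        using y \<delta> K by (intro mult_left_mono mult_right_mono power_mono) auto
      also have "\<bar>y\<bar>\<^sup>2 * \<bar>y\<bar>\<^sup>2 = y ^ 4" unfolding y4 by (simp add: eval_nat_numeral)
      finally have 3: "K / 2 * y\<^sup>2 \<le> K / 2 / \<delta> ^ 2 * y ^ 4" .
      have "A * y ^ 4 = 2 * B / \<delta> ^ 4 * y ^ 4 + \<bar>p\<bar> / \<delta> ^ 3 * y ^ 4 + K / 2 / \<delta> ^ 2 * y ^ 4"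
        by (simp add: A_def algebra_simps)
      then show ?thesis using 1 2 3 bd[of "x0 + y"] bd[of x0] by linarith
    qed
  qed
qed

section \<open>Semiconvexity and first-order Taylor bounds\<close>

lemma convex_on_UNIV_subgradient:
  fixes g :: "real \<Rightarrow> real"
  assumes "convex_on UNIV g"
  shows "\<exists>p. \<forall>y. g y \<ge> g x + p * (y - x)"
  using convex_le_Inf_differential[OF assms, of x] by auto

lemma semiconvex_below_parabola:
  fixes f :: "real \<Rightarrow> real"
  assumes "convex_on UNIV (\<lambda>x. f x + K / 2 * x\<^sup>2)"
  shows "\<exists>p. \<forall>y. f y \<ge> f x + p * (y - x) - K / 2 * (y - x)\<^sup>2"
proof -
  obtain q where q: "\<And>y. f y + K / 2 * y\<^sup>2 \<ge> f x + K / 2 * x\<^sup>2 + q * (y - x)"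
    using convex_on_UNIV_subgradient[OF assms, of x] by blast
  have "f y \<ge> f x + (q - K * x) * (y - x) - K / 2 * (y - x)\<^sup>2" for y
    using q[of y] by (simp add: power2_eq_square algebra_simps)
  then show ?thesis by blast
qed

lemma linear_le_quadratic_imp_zero:
  fixes a :: real
  assumes "\<And>y. a * y \<le> K * y\<^sup>2"
  shows "a = 0"
proof (rule ccontr)
  assume "a \<noteq> 0"
  \<comment> \<open>\<open>K\<close> itself may be zero or negative. A positive \<open>k\<close>
    above it makes a / k a legitimate test point, and there k y^2 equals a y.\<close>
  define k where "k = \<bar>K\<bar> + 1"
  have k: "k > 0" "K < k" by (auto simp: k_def)
  have "a * (a / k) \<le> K * (a / k)\<^sup>2" by (rule assms)
  also have "\<dots> < k * (a / k)\<^sup>2"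
    using k \<open>a \<noteq> 0\<close> by (intro mult_strict_right_mono) auto
  also have "\<dots> = a * (a / k)" using k by (simp add: power2_eq_square)
  finally show False by simp
qed

text \<open>The Taylor bound of a C^{1,1} function, in a form that makes sense before D is known to
  be the derivative. Up to a factor 2 in the constant it expresses that D is the derivative of f and
  Lipschitz.\<close>

definition C11 :: "real \<Rightarrow> (real \<Rightarrow> real) \<Rightarrow> (real \<Rightarrow> real) \<Rightarrow> bool" where
  "C11 K f D \<longleftrightarrow> (\<forall>x y. \<bar>f y - f x - D x * (y - x)\<bar> \<le> K * (y - x)\<^sup>2)"

text \<open>At each x there is a supporting parabola from below with slope p and one from above with
  slope -q. Adding the two inequalities bounds a linear function of slope p + q by a quadratic one,
  so the slopes agree.\<close>

lemma semiconvex_semiconcave_imp_C11: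
  assumes "convex_on UNIV (\<lambda>x. f x + K / 2 * x\<^sup>2)"
    and "convex_on UNIV (\<lambda>x. - f x + K / 2 * x\<^sup>2)"
  shows "\<exists>D. C11 (K / 2) f D"
proof -
  have "\<exists>p. \<forall>y. \<bar>f y - f x - p * (y - x)\<bar> \<le> K / 2 * (y - x)\<^sup>2" for x
  proof -
    obtain p where p: "\<And>y. f y \<ge> f x + p * (y - x) - K / 2 * (y - x)\<^sup>2"
      using semiconvex_below_parabola[OF assms(1)] by blast
    obtain q where q: "\<And>y. - f y \<ge> - f x + q * (y - x) - K / 2 * (y - x)\<^sup>2"
      using semiconvex_below_parabola[OF assms(2)] by blast
    have "(p + q) * y \<le> K * y\<^sup>2" for y
      using p[of "x + y"] q[of "x + y"] by (simp add: algebra_simps)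
    then have "p + q = 0" by (rule linear_le_quadratic_imp_zero)
    then have "q = - p" by simp
    then have "\<bar>f y - f x - p * (y - x)\<bar> \<le> K / 2 * (y - x)\<^sup>2" for y
      using p[of y] q[of y] unfolding \<open>q = - p\<close> by linarith
    then show ?thesis by blast
  qed
  then show ?thesis unfolding C11_def by metis
qed

lemma C11_nonneg: "C11 K f D \<Longrightarrow> K \<ge> 0"
  unfolding C11_def by (drule spec[of _ 0], drule spec[of _ 1]) auto

lemma C11_has_derivative:
  assumes "C11 K f D"
  shows "(f has_real_derivative D x) (at x)"
proof -
  have lim: "((\<lambda>y. K * \<bar>y - x\<bar>) \<longlongrightarrow> 0) (at x)"
    by (auto intro!: tendsto_eq_intros)
  have "\<forall>\<^sub>F y in at x. norm ((f y - f x) / (y - x) - D x) \<le> K * \<bar>y - x\<bar>"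
  proof (rule eventually_mono[OF eventually_neq_at_within[of x]])
    fix y assume "y \<noteq> x"
    then have "\<bar>(f y - f x) / (y - x) - D x\<bar> = \<bar>f y - f x - D x * (y - x)\<bar> / \<bar>y - x\<bar>"
      unfolding abs_divide[symmetric] by (simp add: diff_divide_distrib)
    also have "\<dots> \<le> K * (y - x)\<^sup>2 / \<bar>y - x\<bar>"
      using assms by (intro divide_right_mono) (auto simp: C11_def)
    also have "\<dots> = K * \<bar>y - x\<bar>"
    proof -
      have "(y - x)\<^sup>2 / \<bar>y - x\<bar> = \<bar>y - x\<bar>"
        using \<open>y \<noteq> x\<close> by (cases "x < y") (auto simp: power2_eq_square field_simps)
      then show ?thesis by (metis times_divide_eq_right)
    qed
    finally show "norm ((f y - f x) / (y - x) - D x) \<le> K * \<bar>y - x\<bar>" by simp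
  qed
  then have "((\<lambda>y. (f y - f x) / (y - x) - D x) \<longlongrightarrow> 0) (at x)"
    by (rule Lim_null_comparison[OF _ lim])
  then show ?thesis
    unfolding has_field_derivative_iff by (rule LIM_zero_cancel)
qed

text \<open>In the sum of the expansions at x and at y the values of f cancel, and (D y - D x) (y -
  x) remains.\<close>

lemma C11_derivative_Lipschitz:
  assumes "C11 K f D"
  shows "\<bar>D y - D x\<bar> \<le> 2 * K * \<bar>y - x\<bar>"
proof (cases "y = x")
  case False
  have 1: "\<bar>f y - f x - D x * (y - x)\<bar> \<le> K * (y - x)\<^sup>2"
    and 2: "\<bar>f x - f y - D y * (x - y)\<bar> \<le> K * (x - y)\<^sup>2"
    using assms by (auto simp: C11_def)
  have "\<bar>D y - D x\<bar> * \<bar>y - x\<bar> = \<bar>(f y - f x - D x * (y - x)) + (f x - f y - D y * (x - y))\<bar>"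
    unfolding abs_mult[symmetric] by (simp add: algebra_simps)
  also have "\<dots> \<le> K * (y - x)\<^sup>2 + K * (x - y)\<^sup>2"
    by (rule order_trans[OF abs_triangle_ineq add_mono[OF 1 2]])
  also have "\<dots> = 2 * K * \<bar>y - x\<bar> * \<bar>y - x\<bar>"
  proof -
    have "(y - x)\<^sup>2 = \<bar>y - x\<bar> * \<bar>y - x\<bar>" "(x - y)\<^sup>2 = \<bar>y - x\<bar> * \<bar>y - x\<bar>"
      by (simp_all add: power2_eq_square algebra_simps)
    then show ?thesis by simp
  qed
  finally show ?thesis using False by simp
qed simp

text \<open>The expansion over the unit step from x to x + 1 expresses D x by two values of f and an
  error of at most K.\<close>

lemma C11_derivative_bounded:
  assumes "C11 K f D" "\<And>x. \<bar>f x\<bar> \<le> B"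
  shows "\<bar>D x\<bar> \<le> 2 * B + K"
proof -
  have "\<bar>f (x + 1) - f x - D x\<bar> \<le> K"
    using assms(1)[unfolded C11_def, rule_format, where x = x and y = "x + 1"] by simp
  then show ?thesis using assms(2)[of x] assms(2)[of "x + 1"] by linarith
qed

lemma Lipschitz_derivative_imp_C11:
  assumes D: "\<And>x. (f has_real_derivative D x) (at x)"
    and L: "\<And>x y. \<bar>D y - D x\<bar> \<le> K * \<bar>y - x\<bar>"
  shows "C11 K f D"
  unfolding C11_def
proof (intro allI)
  fix x y :: real
  have K: "K \<ge> 0" using L[of 1 0] by simp
  have "\<bar>f y - f x - D x * (y - x)\<bar> \<le> K * \<bar>y - x\<bar> * \<bar>y - x\<bar>"
  proof (cases "y = x")
    case False
    obtain z where z: "f y - f x = (y - x) * D z" "\<bar>z - x\<bar> \<le> \<bar>y - x\<bar>"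
    proof (cases "x < y")
      case True
      obtain z where "z > x" "z < y" "f y - f x = (y - x) * D z"
        using MVT2[OF True, of f D] D by auto
      then show ?thesis by (intro that[of z]) auto
    next
      case False
      then have "y < x" using \<open>y \<noteq> x\<close> by simp
      then obtain z where "z > y" "z < x" "f x - f y = (x - y) * D z"
        using MVT2[of y x f D] D by auto
      then show ?thesis by (intro that[of z]) (auto simp: algebra_simps)
    qed
    have "\<bar>f y - f x - D x * (y - x)\<bar> = \<bar>D z - D x\<bar> * \<bar>y - x\<bar>"
      unfolding abs_mult[symmetric] z by (simp add: algebra_simps)
    also have "\<dots> \<le> K * \<bar>z - x\<bar> * \<bar>y - x\<bar>"
      by (intro mult_right_mono L) auto
    also have "\<dots> \<le> K * \<bar>y - x\<bar> * \<bar>y - x\<bar>"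
      using K z by (intro mult_right_mono mult_left_mono) auto
    finally show ?thesis .
  qed simp
  then show "\<bar>f y - f x - D x * (y - x)\<bar> \<le> K * (y - x)\<^sup>2"
    by (simp add: power2_eq_square mult.assoc)
qed

lemma bounded_C11_imp_BUC:
  assumes "C11 K f D" "\<And>x. \<bar>f x\<bar> \<le> B"
  shows "f \<in> BUC"
  unfolding BUC_def
proof (intro CollectI conjI)
  show "bounded (range f)"
    using assms(2) by (auto simp: bounded_iff)
  have "(2 * B + K)-lipschitz_on UNIV f"
  proof (rule bounded_derivative_imp_lipschitz[where f' = "\<lambda>x h. D x * h"])
    show "(f has_derivative (\<lambda>h. D x * h)) (at x within UNIV)" for x
      using C11_has_derivative[OF assms(1), of x] by (simp add: has_field_derivative_def)
    show "onorm (\<lambda>h. D x * h) \<le> 2 * B + K" for x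
    proof -
      have "\<bar>D x\<bar> * \<bar>h\<bar> \<le> (2 * B + K) * \<bar>h\<bar>" for h
        by (rule mult_right_mono[OF C11_derivative_bounded[OF assms]]) simp
      then show ?thesis by (intro onorm_le) (simp add: abs_mult)
    qed
    show "0 \<le> 2 * B + K"
      using assms(2)[of 0] C11_nonneg[OF assms(1)] by linarith
  qed auto
  then show "uniformly_continuous_on UNIV f"
    by (rule lipschitz_on_uniformly_continuous)
qed

section \<open>Smooth bump functions\<close>

text \<open>With a constant polynomial this is the classical smooth function exp(-1/x) extended by
  zero. The polynomial in 1/x records what its derivatives produce.\<close>

definition bump_tail :: "real poly \<Rightarrow> real \<Rightarrow> real" where
  "bump_tail p x = (if x \<le> 0 then 0 else poly p (1 / x) * exp (- (1 / x)))"

text \<open>The extra power of u carries the induction: passing from p to a + u p raises it by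
  one.\<close>

lemma poly_times_exp_minus_tendsto_0: "((\<lambda>u. u ^ k * (poly p u * exp (- u))) \<longlongrightarrow> (0::real)) at_top"
proof (induction p arbitrary: k)
  case (pCons a p)
  have "((\<lambda>u::real. u ^ k * exp (- u)) \<longlongrightarrow> 0) at_top"
    using tendsto_power_div_exp_0[of k] by (simp add: exp_minus divide_inverse)
  then have "((\<lambda>u. a * (u ^ k * exp (- u)) + u ^ Suc k * (poly p u * exp (- u))) \<longlongrightarrow> a * 0 + 0) at_top"
    by (intro tendsto_intros pCons)
  then show ?case by (simp add: algebra_simps)
qed simp

text \<open>With u = 1 / x one has du/dx = - u^2, which gives the factor \<open>monom 1 2\<close>
  and the difference p - p'. At 0 the right difference quotient is u p(u) exp(-u) with u tending to
  infinity.\<close>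

lemma bump_tail_has_derivative:
  "(bump_tail p has_real_derivative bump_tail (monom 1 2 * (p - pderiv p)) x) (at x)"
proof -
  consider "x < 0" | "x = 0" | "x > 0" by linarith
  then show ?thesis
  proof cases
    case 1
    show ?thesis
    proof (rule has_field_derivative_transform_within[of "\<lambda>_. 0" _ _ _ "- x"])
      show "((\<lambda>_. 0) has_real_derivative bump_tail (monom 1 2 * (p - pderiv p)) x) (at x)"
        using 1 by (simp add: bump_tail_def)
      fix y assume "dist y x < - x"
      then show "0 = bump_tail p y" by (auto simp: bump_tail_def dist_real_def)
    qed (use 1 in auto)
  next
    case 2
    have "((\<lambda>u. u ^ 1 * (poly p u * exp (- u))) \<longlongrightarrow> 0) at_top"
      by (rule poly_times_exp_minus_tendsto_0)
    then have "((\<lambda>h. inverse h ^ 1 * (poly p (inverse h) * exp (- inverse h))) \<longlongrightarrow> 0) (at_right 0)"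
      by (rule filterlim_compose[OF _ filterlim_inverse_at_top_right])
    then have "((\<lambda>h. bump_tail p h / h) \<longlongrightarrow> 0) (at_right 0)"
      by (rule Lim_transform_eventually)
        (auto simp: eventually_at_right_less bump_tail_def inverse_eq_divide intro!: eventually_mono[OF eventually_at_right_less[of 0]])
    moreover have "((\<lambda>h. bump_tail p h / h) \<longlongrightarrow> 0) (at_left 0)"
      by (rule Lim_transform_eventually[OF tendsto_const])
        (auto simp: bump_tail_def eventually_at_left_field intro: exI[of _ "-1"])
    ultimately have "((\<lambda>h. bump_tail p h / h) \<longlongrightarrow> 0) (at 0)"
      by (simp add: filterlim_at_split)
    then show ?thesis using 2 by (simp add: has_field_derivative_iff bump_tail_def)
  next
    case 3
    have "((\<lambda>x. poly p (1 / x) * exp (- (1 / x))) has_real_derivative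
        bump_tail (monom 1 2 * (p - pderiv p)) x) (at x)"
      using 3 by (auto intro!: derivative_eq_intros poly_DERIV[THEN DERIV_chain2]
          simp: bump_tail_def poly_monom field_simps power2_eq_square)
    then show ?thesis
    proof (rule has_field_derivative_transform_within[of _ _ _ _ x])
      fix y assume "dist y x < x"
      then show "poly p (1 / y) * exp (- (1 / y)) = bump_tail p y"
        by (auto simp: bump_tail_def dist_real_def)
    qed (use 3 in auto)
  qed
qed

text \<open>A class of functions that is closed under differentiation, so that its members are smooth.\<close>

inductive_set bump_class :: "(real \<Rightarrow> real) set" where
  prod: "(\<lambda>x. bump_tail p (c * (x - a)) * bump_tail q (c * (b - x))) \<in> bump_class"
| add: "\<phi> \<in> bump_class \<Longrightarrow> \<psi> \<in> bump_class \<Longrightarrow> (\<lambda>x. \<phi> x + \<psi> x) \<in> bump_class"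

lemma bump_tail_smult: "bump_tail (smult c p) x = c * bump_tail p x"
  by (simp add: bump_tail_def)

lemma bump_class_derivative:
  "\<phi> \<in> bump_class \<Longrightarrow> \<exists>\<psi>\<in>bump_class. \<forall>x. (\<phi> has_real_derivative \<psi> x) (at x)"
proof (induction rule: bump_class.induct)
  case (prod p c a q b)
  let ?D = "\<lambda>p. monom 1 2 * (p - pderiv p)"
  show ?case
  proof (intro bexI allI)
    show "(\<lambda>x. bump_tail (smult c (?D p)) (c * (x - a)) * bump_tail q (c * (b - x)) +
        bump_tail p (c * (x - a)) * bump_tail (smult (- c) (?D q)) (c * (b - x))) \<in> bump_class"
      by (intro bump_class.intros)
    show "((\<lambda>x. bump_tail p (c * (x - a)) * bump_tail q (c * (b - x))) has_real_derivative
        bump_tail (smult c (?D p)) (c * (x - a)) * bump_tail q (c * (b - x)) +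
        bump_tail p (c * (x - a)) * bump_tail (smult (- c) (?D q)) (c * (b - x))) (at x)" for x
      by (rule derivative_eq_intros DERIV_chain2[OF bump_tail_has_derivative] refl)+
        (simp add: bump_tail_smult mult_ac del: smult_minus_left)
  qed
next
  case (add \<phi> \<psi>)
  then obtain \<phi>' \<psi>' where "\<phi>' \<in> bump_class" "\<psi>' \<in> bump_class"
    "\<And>x. (\<phi> has_real_derivative \<phi>' x) (at x)" "\<And>x. (\<psi> has_real_derivative \<psi>' x) (at x)"
    by blast
  then show ?case
    by (intro bexI[of _ "\<lambda>x. \<phi>' x + \<psi>' x"] allI DERIV_add bump_class.add)
qed

lemma bump_class_deriv: "\<phi> \<in> bump_class \<Longrightarrow> deriv \<phi> \<in> bump_class"
  using bump_class_derivative[of \<phi>] DERIV_imp_deriv[of \<phi>] by (metis ext)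

lemma bump_class_has_derivative:
  "\<phi> \<in> bump_class \<Longrightarrow> (\<phi> has_real_derivative deriv \<phi> x) (at x)"
  using bump_class_derivative[of \<phi>] DERIV_imp_deriv[of \<phi>] by metis

lemma bump_class_higher_deriv: "\<phi> \<in> bump_class \<Longrightarrow> (deriv ^^ n) \<phi> \<in> bump_class"
  by (induction n) (auto intro: bump_class_deriv)

lemma bump_class_smooth: "\<phi> \<in> bump_class \<Longrightarrow> (deriv ^^ n) \<phi> differentiable at x"
  using bump_class_has_derivative[OF bump_class_higher_deriv[of \<phi> n], of x]
  by (auto simp: real_differentiable_def)

lemma bump_class_continuous: "\<phi> \<in> bump_class \<Longrightarrow> continuous_on A \<phi>"
  using bump_class_has_derivative[of \<phi>]
  by (meson DERIV_continuous_on DERIV_subset top_greatest)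

lemma compact_support_Icc:
  fixes \<phi> :: "real \<Rightarrow> real"
  assumes "\<And>x. x \<notin> {a..b} \<Longrightarrow> \<phi> x = 0"
  shows "compact (closure {x. \<phi> x \<noteq> 0})"
proof -
  have "{x. \<phi> x \<noteq> 0} \<subseteq> {a..b}" using assms by blast
  then show ?thesis
    by (meson bounded_closed_interval bounded_subset compact_closure)
qed

text \<open>Membership in the class is asked of the derivative only, so that the criterion also
  covers primitives of bumps.\<close>

lemma test_functionI_bump_class:
  assumes "\<And>x. (\<phi> has_real_derivative \<phi>' x) (at x)" "\<phi>' \<in> bump_class"
    and "\<And>x. x \<notin> {a..b} \<Longrightarrow> \<phi> x = 0"
  shows "test_function \<phi>"
  unfolding test_function_def
proof (intro conjI allI)
  have d: "deriv \<phi> = \<phi>'" using assms(1) by (auto intro: DERIV_imp_deriv)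
  show "(deriv ^^ n) \<phi> differentiable at x" for n x
  proof (cases n)
    case 0
    then show ?thesis using assms(1) by (auto simp: real_differentiable_def)
  next
    case (Suc m)
    then show ?thesis using bump_class_smooth[OF assms(2)] by (simp del: funpow.simps add: funpow_Suc_right d)
  qed
  show "compact (closure {x. \<phi> x \<noteq> 0})" by (rule compact_support_Icc[OF assms(3)])
qed

text \<open>Test functions increasing towards the indicator of (a, b): for y > 0, exp(-1 / ((n + 1)
  y)) tends to 1.\<close>

definition bump :: "real \<Rightarrow> real \<Rightarrow> nat \<Rightarrow> real \<Rightarrow> real" where
  "bump a b n x = bump_tail 1 (real (Suc n) * (x - a)) * bump_tail 1 (real (Suc n) * (b - x))"

lemma bump_in_class: "bump a b n \<in> bump_class"
  unfolding bump_def[abs_def] by (rule bump_class.prod)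

lemma bump_shift_in_class: "(\<lambda>x. bump a b n x - bump a b n (x - s)) \<in> bump_class"
proof -
  \<comment> \<open>The class offers sums but no differences, so the minus sign goes into the
    polynomial factor and the shift by \<open>s\<close> into the endpoints.\<close>
  have "(\<lambda>x. bump_tail 1 (real (Suc n) * (x - a)) * bump_tail 1 (real (Suc n) * (b - x)) +
     bump_tail (smult (- 1) 1) (real (Suc n) * (x - (a + s))) * bump_tail 1 (real (Suc n) * (b + s - x))) \<in> bump_class"
    by (intro bump_class.intros)
  moreover have "x - (a + s) = x - s - a" "b + s - x = b - (x - s)" for x by simp_all
  ultimately show ?thesis unfolding bump_def bump_tail_smult by simp
qed

lemma bump_bounds: "0 \<le> bump a b n x" "bump a b n x \<le> 1"
proof -
  have "0 \<le> bump_tail 1 y" "bump_tail 1 y \<le> 1" for y by (auto simp: bump_tail_def)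
  then show "0 \<le> bump a b n x" "bump a b n x \<le> 1" by (auto simp: bump_def intro!: mult_le_one)
qed

lemma bump_outside: "x \<notin> {a<..<b} \<Longrightarrow> bump a b n x = 0"
  by (auto simp: bump_def bump_tail_def mult_le_0_iff not_less)

lemma bump_tail_1_tendsto:
  fixes y :: real
  shows "(\<lambda>n. bump_tail 1 (real (Suc n) * y)) \<longlonglongrightarrow> indicator {0<..} y"
proof (cases "y > 0")
  case True
  have "(\<lambda>n. exp (- (1 / (real (Suc n) * y)))) \<longlonglongrightarrow> exp (- (0 * (1 / y)))"
    unfolding divide_divide_eq_left[symmetric] 
    by (intro tendsto_intros) (use tendsto_mult_left[OF lim_1_over_n[THEN LIMSEQ_Suc], of "1/y"] in \<open>simp add: field_simps\<close>)
  moreover have "bump_tail 1 (real (Suc n) * y) = exp (- (1 / (real (Suc n) * y)))" for n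
    using True by (simp add: bump_tail_def mult_le_0_iff del: of_nat_Suc)
  ultimately show ?thesis using True by simp
next
  case False
  then have "real (Suc n) * y \<le> 0" for n by (intro mult_nonneg_nonpos) auto
  then show ?thesis using False by (simp add: bump_tail_def)
qed

lemma bump_tendsto:
  fixes x :: real
  shows "(\<lambda>n. bump a b n x) \<longlonglongrightarrow> indicator {a<..<b} x"
proof -
  have "(\<lambda>n. bump a b n x) \<longlonglongrightarrow> indicator {0<..} (x - a) * indicator {0<..} (b - x)"
    unfolding bump_def by (intro tendsto_mult bump_tail_1_tendsto)
  also have "indicator {0<..} (x - a) * indicator {0<..} (b - x) = (indicator {a<..<b} x :: real)"
    by (auto simp: indicator_def)
  finally show ?thesis .
qed

section \<open>Weak derivatives\<close>

lemma set_lebesgue_integral_Icc_FTC: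
  fixes F f :: "real \<Rightarrow> real"
  assumes "a \<le> b" "\<And>x. (F has_real_derivative f x) (at x)" "continuous_on UNIV f"
  shows "(LINT x:{a..b}|lborel. f x) = F b - F a"
  using integral_FTC_Icc_real[OF assms(1), of F f] assms(2,3)
  by (simp add: set_lebesgue_integral_def mult.commute continuous_on_eq_continuous_at)

lemma test_function_has_derivative:
  assumes "test_function \<phi>"
  shows "(\<phi> has_real_derivative deriv \<phi> x) (at x)"
proof -
  have "((deriv ^^ 0) \<phi>) differentiable (at x)"
    using assms unfolding test_function_def by blast
  then show ?thesis by (simp add: DERIV_deriv_iff_real_differentiable)
qed

lemma test_function_deriv_continuous:
  assumes "test_function \<phi>"
  shows "continuous_on A (deriv \<phi>)"
proof -
  have "((deriv ^^ 1) \<phi>) differentiable (at x)" for x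
    using assms unfolding test_function_def by blast
  then show ?thesis by (auto intro!: continuous_at_imp_continuous_on differentiable_imp_continuous_within)
qed

lemma test_function_continuous:
  "test_function \<phi> \<Longrightarrow> continuous_on A \<phi>"
  by (meson DERIV_continuous_on has_field_derivative_at_within test_function_has_derivative)

lemma test_function_support:
  assumes "test_function \<phi>"
  obtains a b where "a < b" "\<And>x. x \<notin> {a<..<b} \<Longrightarrow> \<phi> x = 0" "\<And>x. x \<notin> {a<..<b} \<Longrightarrow> deriv \<phi> x = 0"
proof -
  have "bounded (closure {x. \<phi> x \<noteq> 0})"
    using assms unfolding test_function_def by (auto intro: compact_imp_bounded)
  then have "bounded {x. \<phi> x \<noteq> 0}" by (meson bounded_subset closure_subset)
  then obtain B where B: "\<And>x. \<phi> x \<noteq> 0 \<Longrightarrow> \<bar>x\<bar> \<le> B" by (auto simp: bounded_iff)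
  define C where "C = \<bar>B\<bar> + 1"
  have 0: "\<phi> x = 0" if "\<bar>x\<bar> > \<bar>B\<bar>" for x using B[of x] that by force
  have d0: "deriv \<phi> x = 0" if "\<bar>x\<bar> > \<bar>B\<bar>" for x
  proof -
    have "(\<phi> has_real_derivative 0) (at x)"
    proof (rule has_field_derivative_transform_within[of "\<lambda>_. 0" _ _ _ "\<bar>x\<bar> - \<bar>B\<bar>"])
      fix y assume "dist y x < \<bar>x\<bar> - \<bar>B\<bar>"
      then have "\<bar>y\<bar> > \<bar>B\<bar>" by (auto simp: dist_real_def)
      then show "0 = \<phi> y" using 0 by simp
    qed (use that in auto)
    then show ?thesis by (rule DERIV_imp_deriv)
  qed
  show ?thesis
    by (rule that[of "- C" C]) (auto simp: C_def intro!: 0 d0)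
qed

text \<open>Integration by parts through Fubini's theorem on the triangle \<open>y \<le> x\<close>.\<close>

lemma primitive_imp_weak_derivative:
  fixes F g :: "real \<Rightarrow> real"
  assumes int: "\<And>a b. set_integrable lborel {a..b} g"
    and F: "\<And>a b. a \<le> b \<Longrightarrow> F b - F a = (LINT y:{a..b}|lborel. g y)"
    and cont: "continuous_on UNIV F"
  shows "weak_derivative F g"
  unfolding weak_derivative_def
proof (intro conjI allI impI)
  show "set_integrable lborel {a..b} F" for a b
    by (intro borel_integrable_atLeastAtMost' continuous_on_subset[OF cont]) auto
  show "set_integrable lborel {a..b} g" for a b by (rule int)
  fix \<phi> assume \<phi>: "test_function \<phi>"
  obtain a b where ab: "a < b" and supp: "\<And>x. x \<notin> {a<..<b} \<Longrightarrow> \<phi> x = 0" "\<And>x. x \<notin> {a<..<b} \<Longrightarrow> deriv \<phi> x = 0"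
    using test_function_support[OF \<phi>] by blast
  let ?I = "indicator {a..b} :: real \<Rightarrow> real"
  let ?g = "\<lambda>y. ?I y * g y" and ?d = "\<lambda>x. ?I x * deriv \<phi> x"
  have FTC: "(LINT x:{c..b}|lborel. deriv \<phi> x) = - \<phi> c" if "c \<le> b" for c
    using set_lebesgue_integral_Icc_FTC[OF that test_function_has_derivative[OF \<phi>]
        test_function_deriv_continuous[OF \<phi>]] supp(1)[of b] by simp
  have ig: "integrable lborel ?g"
    using int[of a b] by (simp add: set_integrable_def)
  have id: "integrable lborel ?d"
    using borel_integrable_atLeastAtMost'[OF test_function_deriv_continuous[OF \<phi>], of a b]
    by (simp add: set_integrable_def)
  have [measurable]: "?g \<in> borel_measurable borel" "?d \<in> borel_measurable borel"
    using borel_measurable_integrable[OF ig] borel_measurable_integrable[OF id] by auto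
  define h where "h = (\<lambda>(x, y). ?d x * ?g y * indicator {..x} y)"
  have [measurable]: "h \<in> borel_measurable (lborel \<Otimes>\<^sub>M lborel)"
  proof -
    have "(\<lambda>p::real\<times>real. indicator {p. snd p \<le> fst p} p :: real) \<in> borel_measurable (lborel \<Otimes>\<^sub>M lborel)"
      by measurable
    moreover have "h = (\<lambda>p. ?d (fst p) * ?g (snd p) * indicator {p. snd p \<le> fst p} p)"
      by (auto simp: h_def indicator_def)
    ultimately show ?thesis by simp
  qed
  have ih: "integrable (lborel \<Otimes>\<^sub>M lborel) h"
  proof (rule lborel_pair.Fubini_integrable)
    have iy: "integrable lborel (\<lambda>y. h (x, y))" for x
    proof -
      have "integrable lborel (\<lambda>y. indicator {..x} y *\<^sub>R ?g y)"
        by (rule integrable_mult_indicator[OF _ ig]) simp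
      then have "integrable lborel (\<lambda>y. ?d x * (indicator {..x} y *\<^sub>R ?g y))"
        by (rule integrable_mult_right)
      then show ?thesis by (simp add: h_def mult_ac)
    qed
    show "AE x in lborel. integrable lborel (\<lambda>y. h (x, y))" using iy by simp
    show "integrable lborel (\<lambda>x. LBINT y. norm (h (x, y)))"
    proof (rule Bochner_Integration.integrable_bound)
      show "integrable lborel (\<lambda>x. ?d x * (LBINT y. norm (?g y)))"
        by (intro integrable_mult_left id)
      show "(\<lambda>x. LBINT y. norm (h (x, y))) \<in> borel_measurable lborel" by measurable
      have "(LBINT y. norm (h (x, y))) \<le> (LBINT y. \<bar>?d x\<bar> * norm (?g y))" for x
        by (intro integral_mono integrable_norm iy integrable_mult_right ig) (auto simp: h_def indicator_def abs_mult)
      then show "AE x in lborel. norm (LBINT y. norm (h (x, y))) \<le> norm (?d x * (LBINT y. norm (?g y)))"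
        by (simp add: abs_mult)
    qed
  qed measurable
  have inner1: "(LBINT y. h (x, y)) = ?d x * (F x - F a)" for x
  proof (cases "x \<in> {a..b}")
    case True
    have "(LBINT y. h (x, y)) = (LBINT y. ?d x * (indicator {a..x} y * g y))"
      using True by (intro Bochner_Integration.integral_cong) (auto simp: h_def indicator_def)
    then show ?thesis using F[of a x] True by (simp add: set_lebesgue_integral_def)
  qed (simp add: h_def)
  have inner2: "(LBINT x. h (x, y)) = - (?g y * \<phi> y)" for y
  proof (cases "y \<in> {a..b}")
    case True
    have "(LBINT x. h (x, y)) = (LBINT x. ?g y * (indicator {y..b} x * deriv \<phi> x))"
      using True by (intro Bochner_Integration.integral_cong) (auto simp: h_def indicator_def)
    then show ?thesis using FTC[of y] True by (simp add: set_lebesgue_integral_def)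
  qed (simp add: h_def)
  have "continuous_on {a..b} (\<lambda>x. deriv \<phi> x * F x)"
    by (intro continuous_on_mult test_function_deriv_continuous[OF \<phi>] continuous_on_subset[OF cont]) auto
  then have "integrable lborel (\<lambda>x. ?I x * (deriv \<phi> x * F x))"
    using borel_integrable_atLeastAtMost'[of a b "\<lambda>x. deriv \<phi> x * F x"] 
    unfolding set_integrable_def by simp
  then have idF: "integrable lborel (\<lambda>x. ?d x * F x)"
    by (simp only: mult.assoc)
  have d0: "(LBINT x. ?d x) = 0"
    using FTC[of a] ab supp(1)[of a] by (simp add: set_lebesgue_integral_def)
  have "(LBINT x. F x * deriv \<phi> x) = (LBINT x. ?d x * F x)"
  proof -
    have "F x * deriv \<phi> x = ?d x * F x" for x
      using supp(2)[of x] by (cases "x \<in> {a..b}") auto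
    then show ?thesis by (simp only:)
  qed
  \<comment> \<open>Subtracting the constant \<open>F a\<close> is free because the derivative of a
    test function integrates to zero; it turns F into the integral of g from a.\<close>
  also have "\<dots> = (LBINT x. ?d x * F x - ?d x * F a)"
    using Bochner_Integration.integral_diff[OF idF integrable_mult_left[OF id, of "F a"]]
    by (simp only: integral_mult_left_zero d0)
  also have "\<dots> = (LBINT x. LBINT y. h (x, y))" by (simp only: inner1 right_diff_distrib)
  also have "\<dots> = (LBINT y. LBINT x. h (x, y))"
    using lborel_pair.Fubini_integral[of "\<lambda>x y. h (x, y)"] ih by simp
  also have "\<dots> = - (LBINT y. g y * \<phi> y)"
    unfolding inner2 integral_minus
  proof -
    have "?g y * \<phi> y = g y * \<phi> y" for y
      using supp(1)[of y] by (cases "y \<in> {a..b}") auto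
    then show "- (LBINT y. ?g y * \<phi> y) = - (LBINT y. g y * \<phi> y)" by (simp only:)
  qed
  finally show "(LBINT x. F x * deriv \<phi> x) = - (LBINT x. g x * \<phi> x)" .
qed

lemma C1_imp_weak_derivative:
  fixes F f :: "real \<Rightarrow> real"
  assumes "\<And>x. (F has_real_derivative f x) (at x)" "continuous_on UNIV f"
  shows "weak_derivative F f"
proof (rule primitive_imp_weak_derivative)
  show "set_integrable lborel {a..b} f" for a b
    by (intro borel_integrable_atLeastAtMost' continuous_on_subset[OF assms(2)]) auto
  show "continuous_on UNIV F"
    using assms(1) by (meson DERIV_continuous_on has_field_derivative_at_within)
qed (use set_lebesgue_integral_Icc_FTC[OF _ assms] in auto)

section \<open>From bounded weak second derivatives to Lipschitz first derivatives\<close>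

lemma LinftyE:
  assumes "g \<in> Linfty"
  obtains K where "0 \<le> K" "AE x in lborel. \<bar>g x\<bar> \<le> K" "g \<in> borel_measurable borel"
proof -
  have g: "g \<in> borel_measurable lborel" "esssup lborel (\<lambda>x. ereal \<bar>g x\<bar>) < \<infinity>"
    using assms by (auto simp: Linfty_def)
  obtain K where K: "esssup lborel (\<lambda>x. ereal \<bar>g x\<bar>) < ereal K"
    using g(2) less_PInf_Ex_of_nat by auto
  have "AE x in lborel. ereal \<bar>g x\<bar> \<le> esssup lborel (\<lambda>x. ereal \<bar>g x\<bar>)" by (rule esssup_AE)
  then have "AE x in lborel. \<bar>g x\<bar> \<le> \<bar>K\<bar>"
  proof eventually_elim
    case (elim x)
    then have "ereal \<bar>g x\<bar> < ereal K" using K by (rule le_less_trans)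
    then show ?case by simp
  qed
  then show ?thesis using that[of "\<bar>K\<bar>"] g(1) by auto
qed

lemma LinftyI:
  assumes "g \<in> borel_measurable borel" "AE x in lborel. \<bar>g x\<bar> \<le> K"
  shows "g \<in> Linfty"
proof -
  have "esssup lborel (\<lambda>x. ereal \<bar>g x\<bar>) \<le> esssup (lborel :: real measure) (\<lambda>x. ereal K)"
    using assms by (intro esssup_AE_mono) auto
  also have "esssup (lborel :: real measure) (\<lambda>x. ereal K) = ereal K" by (intro esssup_const) simp
  finally show ?thesis using assms(1) by (auto simp: Linfty_def)
qed

text \<open>The set where an almost everywhere bound holds is closed by continuity and has full
  measure, hence is the whole line.\<close>

lemma continuous_Linfty_bounded:
  assumes "continuous_on UNIV f" "f \<in> Linfty"
  obtains B where "\<And>x. \<bar>f x\<bar> \<le> B"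
proof -
  obtain K where K: "AE x in lborel. \<bar>f x\<bar> \<le> K" by (rule LinftyE[OF assms(2)])
  have "closed {x. \<bar>f x\<bar> \<le> K}"
    using assms(1) by (intro closed_Collect_le continuous_intros)
  then have "x \<in> {x. \<bar>f x\<bar> \<le> K}" for x
    by (rule mem_closed_if_AE_lebesgue) (use K in \<open>simp add: AE_completion\<close>)
  then show ?thesis using that[of K] by simp
qed

lemma continuous_imp_antiderivative:
  fixes \<phi> :: "real \<Rightarrow> real"
  assumes "continuous_on UNIV \<phi>"
  obtains \<Phi> where "\<And>x. (\<Phi> has_real_derivative \<phi> x) (at x)"
proof -
  have "\<exists>F. \<forall>x. (- \<infinity>::ereal) < ereal x \<longrightarrow> ereal x < \<infinity> \<longrightarrow> (F has_vector_derivative \<phi> x) (at x)"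
    using assms by (intro einterval_antiderivative) (auto simp: continuous_on_eq_continuous_at)
  then show ?thesis using that by (auto simp: has_real_derivative_iff_has_vector_derivative)
qed

text \<open>A primitive of a single bump stays constant, but nonzero, to the right of the interval.
  The bump minus its shift has total mass zero, so its primitive \<Phi>(x) - \<Phi>(x - s) has
  compact support. It is nonnegative as \<Phi> increases, and bounded by the mass of the bump, which
  is at most b - a.\<close>

lemma bump_primitive:
  assumes ab: "a < b" and s: "0 < s"
  obtains \<Psi> where "\<And>x. (\<Psi> has_real_derivative bump a b n x - bump a b n (x - s)) (at x)"
    "\<And>x. 0 \<le> \<Psi> x" "\<And>x. \<Psi> x \<le> b - a" "\<And>x. x \<notin> {a..b + s} \<Longrightarrow> \<Psi> x = 0"
proof -
  let ?\<phi> = "bump a b n"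
  obtain \<Phi> where \<Phi>: "\<And>x. (\<Phi> has_real_derivative ?\<phi> x) (at x)"
    by (rule continuous_imp_antiderivative[OF bump_class_continuous[OF bump_in_class]]) blast
  have mvt: "\<exists>z. x < z \<and> z < y \<and> \<Phi> y - \<Phi> x = (y - x) * ?\<phi> z" if "x < y" for x y
    using MVT2[OF that, of \<Phi> ?\<phi>] \<Phi> by blast
  have mono: "\<Phi> x \<le> \<Phi> y" if xy: "x \<le> y" for x y
  proof (cases "x = y")
    case False
    then have "x < y" using xy by simp
    then obtain z where "\<Phi> y - \<Phi> x = (y - x) * ?\<phi> z" using mvt by blast
    moreover have "0 \<le> (y - x) * ?\<phi> z" using xy bump_bounds(1) by simp
    ultimately show ?thesis by linarith
  qed simp
  have const: "\<Phi> x = \<Phi> y" if "x \<le> y" "y \<le> a \<or> b \<le> x" for x y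
  proof (cases "x = y")
    case False
    then have "x < y" using that by simp
    then obtain z where z: "x < z" "z < y" "\<Phi> y - \<Phi> x = (y - x) * ?\<phi> z" using mvt by blast
    have "?\<phi> z = 0" using z that(2) by (intro bump_outside) auto
    then show ?thesis using z(3) by simp
  qed simp
  obtain z where z: "\<Phi> b - \<Phi> a = (b - a) * ?\<phi> z" using mvt[OF ab] by blast
  have total: "\<Phi> b - \<Phi> a \<le> b - a"
    unfolding z using mult_left_mono[OF bump_bounds(2), of "b - a"] ab by simp
  have hi: "\<Phi> x \<le> \<Phi> b" for x
  proof (cases "x \<le> b")
    case False
    then show ?thesis using const[of b x] by simp
  qed (rule mono)
  have lo: "\<Phi> a \<le> \<Phi> x" for x
  proof (cases "a \<le> x")
    case False
    then show ?thesis using const[of x a] by simp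
  qed (rule mono)
  show ?thesis
  proof (rule that[of "\<lambda>x. \<Phi> x - \<Phi> (x - s)"])
    fix x
    have "((\<lambda>x. \<Phi> (x - s)) has_real_derivative ?\<phi> (x - s) * 1) (at x)"
      by (rule DERIV_chain2[OF \<Phi>]) (auto intro!: derivative_eq_intros)
    then show "((\<lambda>x. \<Phi> x - \<Phi> (x - s)) has_real_derivative ?\<phi> x - ?\<phi> (x - s)) (at x)"
      using DERIV_diff[OF \<Phi>[of x]] by simp
    show "0 \<le> \<Phi> x - \<Phi> (x - s)" using mono[of "x - s" x] s by simp
    show "\<Phi> x - \<Phi> (x - s) \<le> b - a" using hi[of x] lo[of "x - s"] total by linarith
    show "\<Phi> x - \<Phi> (x - s) = 0" if "x \<notin> {a..b + s}"
      using const[of "x - s" x] that s by auto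
  qed
qed

lemma integral_Ioo_FTC:
  fixes F f :: "real \<Rightarrow> real"
  assumes "a \<le> b" "\<And>x. (F has_real_derivative f x) (at x)" "continuous_on UNIV f"
  shows "(LBINT x. indicator {a<..<b} x * f x) = F b - F a"
proof -
  have [measurable]: "f \<in> borel_measurable borel"
    using assms(3) by (rule borel_measurable_continuous_onI)
  have "AE x in lborel. x \<noteq> a" "AE x in lborel. x \<noteq> b"
    by (rule AE_lborel_singleton)+
  then have "AE x in lborel. indicator {a<..<b} x * f x = indicator {a..b} x * f x"
    by eventually_elim (auto simp: indicator_def)
  then have "(LBINT x. indicator {a<..<b} x * f x) = (LBINT x. indicator {a..b} x * f x)"
    by (intro integral_cong_AE) auto
  then show ?thesis
    using set_lebesgue_integral_Icc_FTC[OF assms] by (simp add: set_lebesgue_integral_def)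
qed

text \<open>The test function \<Psi> has derivative \<theta>, a bump over (a, b) minus its shift by
  s. Integration by parts turns the integral of D \<theta> into that of f'' \<Psi>, bounded by K
  times the height b - a times the length b + s - a of the support. As the bumps approach
  indicators, the integral of D \<theta> becomes a second difference of f. The length exceeds s only
  by b - a, which disappears when b tends to a.\<close>

lemma weak_second_derivative_increment_bound:
  fixes f D :: "real \<Rightarrow> real"
  assumes D: "\<And>x. (f has_real_derivative D x) (at x)" and contD: "continuous_on UNIV D"
    and w1: "weak_derivative f f'" and w2: "weak_derivative f' f''"
    and K: "0 \<le> K" "AE x in lborel. \<bar>f'' x\<bar> \<le> K" and [measurable]: "f'' \<in> borel_measurable borel"
    and ab: "a < b" and s: "0 < s"
  shows "\<bar>(f b - f a) - (f (b + s) - f (a + s))\<bar> \<le> K * (b - a) * (b + s - a)"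
proof -
  have [measurable]: "D \<in> borel_measurable borel"
    using contD by (rule borel_measurable_continuous_onI)
  define \<theta> where "\<theta> = (\<lambda>n x. bump a b n x - bump a b n (x - s))"
  have \<theta>_class: "\<theta> n \<in> bump_class" for n
    unfolding \<theta>_def by (rule bump_shift_in_class)
  have [measurable]: "\<theta> n \<in> borel_measurable borel" for n
    by (intro borel_measurable_continuous_onI bump_class_continuous \<theta>_class)
  have \<theta>_0: "\<theta> n x = 0" if "x \<notin> {a..b + s}" for n x
    using that s by (auto simp: \<theta>_def bump_outside)
  have bound: "\<bar>LBINT x. D x * \<theta> n x\<bar> \<le> K * (b - a) * (b + s - a)" for n
  proof -
    obtain \<Psi> where \<Psi>: "\<And>x. (\<Psi> has_real_derivative \<theta> n x) (at x)"
      "\<And>x. 0 \<le> \<Psi> x" "\<And>x. \<Psi> x \<le> b - a" "\<And>x. x \<notin> {a..b + s} \<Longrightarrow> \<Psi> x = 0"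
      using bump_primitive[OF ab s, of n] unfolding \<theta>_def by blast
    have t\<Psi>: "test_function \<Psi>"
      by (rule test_functionI_bump_class[OF \<Psi>(1) \<theta>_class \<Psi>(4)])
    have t\<theta>: "test_function (\<theta> n)"
      by (rule test_functionI_bump_class[OF bump_class_has_derivative[OF \<theta>_class]
            bump_class_deriv[OF \<theta>_class] \<theta>_0])
    have [measurable]: "\<Psi> \<in> borel_measurable borel"
      by (intro borel_measurable_continuous_onI test_function_continuous t\<Psi>)
    have "deriv \<Psi> = \<theta> n" using \<Psi>(1) by (auto intro: DERIV_imp_deriv)
    then have "(LBINT x. f' x * \<theta> n x) = - (LBINT x. f'' x * \<Psi> x)"
      using w2 t\<Psi> by (auto simp: weak_derivative_def)
    \<comment> \<open>Both f' and the classical derivative D are weak derivatives of f, hence have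
      equal integrals against the test function \<theta>.\<close>
    moreover have "(LBINT x. f' x * \<theta> n x) = (LBINT x. D x * \<theta> n x)"
      using w1 C1_imp_weak_derivative[OF D contD] t\<theta> by (auto simp: weak_derivative_def)
    ultimately have "\<bar>LBINT x. D x * \<theta> n x\<bar> = \<bar>LBINT x. f'' x * \<Psi> x\<bar>" by simp
    also have "\<dots> \<le> (LBINT x. \<bar>f'' x * \<Psi> x\<bar>)" by (rule integral_abs_bound)
    also have "\<dots> \<le> (LBINT x. indicator {a..b + s} x * (K * (b - a)))"
    proof (rule integral_mono_AE')
      show "integrable lborel (\<lambda>x. indicat_real {a..b + s} x * (K * (b - a)))"
        by (intro integrable_mult_left integrable_real_indicator) (auto simp: emeasure_lborel_Icc_eq)
      show "AE x in lborel. \<bar>f'' x * \<Psi> x\<bar> \<le> indicat_real {a..b + s} x * (K * (b - a))"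
        using K(2)
      proof eventually_elim
        case (elim x)
        then have "\<bar>f'' x\<bar> * \<bar>\<Psi> x\<bar> \<le> K * (b - a)"
          using \<Psi>(2,3)[of x] by (intro mult_mono) auto
        then show ?case using \<Psi>(4)[of x] by (auto simp: indicator_def abs_mult)
      qed
      show "AE x in lborel. 0 \<le> indicat_real {a..b + s} x * (K * (b - a))"
        using K(1) ab by simp
    qed
    also have "\<dots> = K * (b - a) * (b + s - a)" using ab s by simp
    finally show ?thesis .
  qed
  let ?I = "\<lambda>x. indicator {a<..<b} x - indicator {a<..<b} (x - s) :: real"
  have "(\<lambda>n. LBINT x. D x * \<theta> n x) \<longlonglongrightarrow> (LBINT x. D x * ?I x)"
  proof (rule integral_dominated_convergence[where w = "\<lambda>x. indicator {a..b + s} x * \<bar>D x\<bar>"])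
    show "integrable lborel (\<lambda>x. indicator {a..b + s} x * \<bar>D x\<bar>)"
      using borel_integrable_atLeastAtMost'[of a "b + s" "\<lambda>x. \<bar>D x\<bar>"] continuous_on_subset[OF contD]
      by (simp add: set_integrable_def continuous_on_rabs)
    show "AE x in lborel. (\<lambda>n. D x * \<theta> n x) \<longlonglongrightarrow> D x * ?I x"
      unfolding \<theta>_def by (intro AE_I2 tendsto_intros bump_tendsto)
    show "AE x in lborel. norm (D x * \<theta> n x) \<le> indicator {a..b + s} x * \<bar>D x\<bar>" for n
    proof (intro AE_I2)
      fix x
      have "\<bar>\<theta> n x\<bar> \<le> 1" using bump_bounds[of a b n x] bump_bounds[of a b n "x - s"] by (auto simp: \<theta>_def)
      then show "norm (D x * \<theta> n x) \<le> indicator {a..b + s} x * \<bar>D x\<bar>"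
        using \<theta>_0[of x n] mult_left_le[of "\<bar>\<theta> n x\<bar>" "\<bar>D x\<bar>"] by (cases "x \<in> {a..b+s}") (auto simp: abs_mult)
    qed
  qed measurable
  moreover have "(LBINT x. D x * ?I x) = (f b - f a) - (f (b + s) - f (a + s))"
  proof -
    have int: "integrable lborel (\<lambda>x. indicator {u<..<v} x * D x)" for u v
    proof -
      have "set_integrable lborel {u..v} D"
        by (intro borel_integrable_atLeastAtMost' continuous_on_subset[OF contD]) simp
      then have "set_integrable lborel {u<..<v} D" by (rule set_integrable_subset) auto
      then show ?thesis by (simp add: set_integrable_def)
    qed
    have "indicator {a<..<b} (x - s) = (indicator {a + s<..<b + s} x :: real)" for x
      by (auto simp: indicator_def)
    then have "(LBINT x. D x * ?I x) =
        (LBINT x. indicator {a<..<b} x * D x - indicator {a + s<..<b + s} x * D x)"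
      by (simp add: right_diff_distrib mult.commute)
    also have "\<dots> = (LBINT x. indicator {a<..<b} x * D x) - (LBINT x. indicator {a + s<..<b + s} x * D x)"
      by (intro Bochner_Integration.integral_diff int)
    finally show ?thesis using ab by (simp add: integral_Ioo_FTC[OF _ D contD])
  qed
  ultimately have "(\<lambda>n. \<bar>LBINT x. D x * \<theta> n x\<bar>) \<longlonglongrightarrow> \<bar>(f b - f a) - (f (b + s) - f (a + s))\<bar>"
    by (simp add: tendsto_rabs)
  then show ?thesis by (rule LIMSEQ_le_const2) (use bound in auto)
qed

text \<open>Dividing the bound on the second difference by b - a and letting b decrease to a gives
  \<bar>D (a + s) - D a\<bar> \<le> K s, so D is Lipschitz.\<close>

lemma W2infty_imp_C11:
  assumes "f \<in> W2infty"
  obtains K D B where "C11 K f D" "\<And>x. \<bar>f x\<bar> \<le> B"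
proof -
  obtain f' f'' where f: "f C1_differentiable_on UNIV" "f \<in> Linfty"
    and f'': "f'' \<in> Linfty" "weak_derivative f f'" "weak_derivative f' f''"
    using assms by (auto simp: W2infty_def)
  obtain D where D: "\<And>x. (f has_real_derivative D x) (at x)" and contD: "continuous_on UNIV D"
    using f(1) by (auto simp: C1_differentiable_on_def has_real_derivative_iff_has_vector_derivative)
  have "continuous_on UNIV f"
    using D by (meson DERIV_continuous_on has_field_derivative_at_within)
  then obtain B where B: "\<And>x. \<bar>f x\<bar> \<le> B"
    using continuous_Linfty_bounded f(2) by blast
  obtain K where K: "0 \<le> K" "AE x in lborel. \<bar>f'' x\<bar> \<le> K" "f'' \<in> borel_measurable borel"
    by (rule LinftyE[OF f''(1)])
  have *: "\<bar>D (a + s) - D a\<bar> \<le> K * s" if "0 < s" for a s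
  proof -
    let ?g = "\<lambda>x. f x - f (x + s)"
    have "(?g has_real_derivative D a - D (a + s)) (at a)"
      by (auto intro!: derivative_eq_intros D DERIV_chain2[OF D])
    then have "((\<lambda>b. (?g b - ?g a) / (b - a)) \<longlongrightarrow> D a - D (a + s)) (at a)"
      by (simp add: has_field_derivative_iff)
    then have "((\<lambda>b. (?g b - ?g a) / (b - a)) \<longlongrightarrow> D a - D (a + s)) (at_right a)"
      by (rule filterlim_mono) (auto simp: at_le)
    then have lim: "((\<lambda>b. \<bar>(?g b - ?g a) / (b - a)\<bar>) \<longlongrightarrow> \<bar>D a - D (a + s)\<bar>) (at_right a)"
      by (rule tendsto_rabs)
    have "((\<lambda>b. K * (b + s - a)) \<longlongrightarrow> K * (a + s - a)) (at_right a)"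
      by (intro tendsto_intros)
    moreover have "\<forall>\<^sub>F b in at_right a. \<bar>(?g b - ?g a) / (b - a)\<bar> \<le> K * (b + s - a)"
      using eventually_at_right_less[of a]
    proof eventually_elim
        case (elim b)
        have "?g b - ?g a = (f b - f a) - (f (b + s) - f (a + s))" by simp
        then have "\<bar>?g b - ?g a\<bar> \<le> K * (b - a) * (b + s - a)"
          using weak_second_derivative_increment_bound[OF D contD f''(2,3) K elim that] by (simp only:)
        then show ?case using elim by (simp add: divide_le_eq mult_ac)
    qed
    ultimately have "\<bar>D a - D (a + s)\<bar> \<le> K * (a + s - a)"
      using lim by (intro tendsto_le[of "at_right a"]) auto
    then show ?thesis by simp
  qed
  have "\<bar>D y - D x\<bar> \<le> K * \<bar>y - x\<bar>" for x y
    using *[of "y - x" x] *[of "x - y" y] by (cases x y rule: linorder_cases) (auto simp: abs_minus_commute)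
  then have "C11 K f D" by (intro Lipschitz_derivative_imp_C11 D)
  then show ?thesis using B that by blast
qed

section \<open>Lipschitz functions as primitives of bounded densities\<close>

lemma emeasure_Ioc_eqI:
  fixes M N :: "real measure"
  assumes "\<And>a b. a \<le> b \<Longrightarrow> emeasure M {a<..b} = emeasure N {a<..b}"
    and "\<And>a b. emeasure M {a<..b} \<noteq> \<infinity>"
    and "sets M = sets borel" "sets N = sets borel"
  shows "M = N"
proof (rule measure_eqI_generator_eq[where E = "range (\<lambda>(a, b). {a<..b::real})" and \<Omega> = UNIV and A = "\<lambda>i. {- real i<..real i}"])
  show "Int_stable (range (\<lambda>(a, b). {a<..b::real}))"
    by (auto simp: Int_stable_def Int_greaterThanAtMost)
  show "emeasure M X = emeasure N X" if "X \<in> range (\<lambda>(a, b). {a<..b})" for X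
  proof -
    obtain a b :: real where "X = {a<..b}" using \<open>X \<in> _\<close> by (auto simp: image_iff)
    then show ?thesis using assms(1)[of a b] by (cases "a \<le> b") auto
  qed
  show "sets M = sigma_sets UNIV (range (\<lambda>(a, b). {a<..b}))" "sets N = sigma_sets UNIV (range (\<lambda>(a, b). {a<..b}))"
    using assms(3,4) by (simp_all add: borel_sigma_sets_Ioc)
  show "range (\<lambda>i. {- real i<..real i}) \<subseteq> range (\<lambda>(a, b). {a<..b})" by auto
  show "\<Union> (range (\<lambda>i. {- real i<..real i})) = UNIV"
  proof -
    have "\<exists>i. - real i < x \<and> x \<le> real i" for x
    proof -
      obtain n where "\<bar>x\<bar> < real n" using reals_Archimedean2 by blast
      then show ?thesis by (intro exI[of _ n]) auto
    qed
    then show ?thesis by auto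
  qed
  show "emeasure M {- real i<..real i} \<noteq> \<infinity>" for i by (rule assms(2))
qed auto

text \<open>On half-open intervals the two Stieltjes measures add up to c times the length because G
  + H is linear, and such intervals determine a measure. For this uniqueness argument the sum is
  packaged as a measure of its own.\<close>

lemma interval_measure_add_eq_scaled_lborel:
  fixes G H :: "real \<Rightarrow> real"
  assumes mono: "mono G" "mono H" and cont: "continuous_on UNIV G" "continuous_on UNIV H"
    and sum: "\<And>x. G x + H x = c * x" and c: "0 \<le> c" and A: "A \<in> sets borel"
  shows "emeasure (interval_measure G) A + emeasure (interval_measure H) A = ennreal c * emeasure lborel A"
proof -
  let ?\<mu> = "\<lambda>A. emeasure (interval_measure G) A + emeasure (interval_measure H) A"
  define M where "M = measure_of UNIV (sets borel) ?\<mu>"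
  have sM: "sets M = sets borel"
    unfolding M_def using sets.sigma_sets_eq[of "borel :: real measure"] by simp
  have eM: "emeasure M A = ?\<mu> A" if "A \<in> sets borel" for A
    unfolding M_def
  proof (rule emeasure_measure_of_sigma)
    show "sigma_algebra UNIV (sets (borel :: real measure))"
      using sets.sigma_algebra_axioms[of "borel :: real measure"] by simp
    show "positive (sets borel) ?\<mu>" by (simp add: positive_def)
    show "countably_additive (sets borel) ?\<mu>"
      unfolding countably_additive_def
      by (auto simp: suminf_add[symmetric] suminf_emeasure intro!: suminf_emeasure)
  qed (rule that)
  have cr: "continuous (at_right a) G" "continuous (at_right a) H" for a
    using cont by (auto simp: continuous_on_eq_continuous_at continuous_at_imp_continuous_within)
  have Ioc: "?\<mu> {a<..b} = ennreal (c * (b - a))" if "a \<le> b" for a b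
  proof -
    have "?\<mu> {a<..b} = ennreal (G b - G a) + ennreal (H b - H a)"
      using mono cr by (subst (1 2) emeasure_interval_measure_Ioc[OF that]) (auto dest: monoD)
    also have "\<dots> = ennreal ((G b - G a) + (H b - H a))"
      using mono that by (intro ennreal_plus[symmetric]) (auto dest: monoD)
    also have "(G b - G a) + (H b - H a) = c * (b - a)"
      using sum[of a] sum[of b] by (simp add: algebra_simps)
    finally show ?thesis .
  qed
  have "M = density lborel (\<lambda>_. ennreal c)"
  proof (rule emeasure_Ioc_eqI)
    show "emeasure M {a<..b} = emeasure (density lborel (\<lambda>_. ennreal c)) {a<..b}" if "a \<le> b" for a b
      using Ioc[OF that] that c by (simp add: eM emeasure_density_const ennreal_mult)
    show "emeasure M {a<..b} \<noteq> \<infinity>" for a b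
      using Ioc[of a b] by (cases "a \<le> b") (auto simp: eM)
  qed (auto simp: sM)
  then have "emeasure M A = ennreal c * emeasure lborel A"
    using A by (simp add: emeasure_density_const)
  then show ?thesis by (simp add: eM A)
qed

text \<open>Both L x + D x and L x - D x are increasing, and their Stieltjes measures sum to 2 L
  times Lebesgue measure. Each is therefore absolutely continuous; the two densities are nonnegative
  with sum 2 L, so the first lies in [0, 2 L]. Subtracting L, the density of L x, leaves a density
  for D with values in [-L, L].\<close>

lemma Lipschitz_imp_bounded_density:
  fixes D :: "real \<Rightarrow> real"
  assumes L: "\<And>x y. \<bar>D y - D x\<bar> \<le> L * \<bar>y - x\<bar>"
  obtains g where "g \<in> borel_measurable borel" "AE x in lborel. \<bar>g x\<bar> \<le> L"
    "\<And>a b. a \<le> b \<Longrightarrow> D b - D a = (LINT y:{a..b}|lborel. g y)"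
proof -
  have L0: "0 \<le> L" using L[of 1 0] by simp
  define G where "G x = L * x + D x" for x
  define H where "H x = L * x - D x" for x
  have contD: "continuous_on UNIV D"
    using L0 L by (intro lipschitz_on_continuous_on[of L] lipschitz_onI) (auto simp: dist_real_def)
  have cont: "continuous_on UNIV G" "continuous_on UNIV H"
    unfolding G_def[abs_def] H_def[abs_def] by (intro continuous_intros contD)+
  have mono: "mono G" "mono H"
  proof -
    have "D x - D y \<le> L * (y - x)" "D y - D x \<le> L * (y - x)" if "x \<le> y" for x y
      using L[of y x] that by (auto simp: abs_le_iff)
    then show "mono G" "mono H"
      by (auto simp: mono_def G_def H_def algebra_simps)
  qed
  have sum: "G x + H x = 2 * L * x" for x by (simp add: G_def H_def)
  have add: "emeasure (interval_measure G) A + emeasure (interval_measure H) A = ennreal (2 * L) * emeasure lborel A"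
    if "A \<in> sets borel" for A
    using interval_measure_add_eq_scaled_lborel[OF mono cont sum _ that] L0 by simp
  have ac: "absolutely_continuous lborel (interval_measure G)" "absolutely_continuous lborel (interval_measure H)"
    unfolding absolutely_continuous_def null_sets_def using add by fastforce+
  obtain g where g[measurable]: "g \<in> borel_measurable lborel" and dg: "density lborel g = interval_measure G"
    using sigma_finite_measure.Radon_Nikodym[OF sigma_finite_lborel ac(1)] by auto
  obtain h where h[measurable]: "h \<in> borel_measurable lborel" and dh: "density lborel h = interval_measure H"
    using sigma_finite_measure.Radon_Nikodym[OF sigma_finite_lborel ac(2)] by auto
  have "density lborel (\<lambda>x. g x + h x) = density lborel (\<lambda>_. ennreal (2 * L))"
  proof (rule measure_eqI)
    fix A assume "A \<in> sets (density lborel (\<lambda>x. g x + h x))"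
    then have A: "A \<in> sets borel" by simp
    have "emeasure (density lborel (\<lambda>x. g x + h x)) A = emeasure (density lborel g) A + emeasure (density lborel h) A"
      using A by (simp add: emeasure_density distrib_right nn_integral_add)
    then show "emeasure (density lborel (\<lambda>x. g x + h x)) A = emeasure (density lborel (\<lambda>_. ennreal (2 * L))) A"
      using add[OF A] A by (simp add: dg dh emeasure_density_const)
  qed simp
  then have "AE x in lborel. g x + h x = ennreal (2 * L)"
    by (intro sigma_finite_measure.density_unique[OF sigma_finite_lborel]) auto
  then have gle: "AE x in lborel. g x \<le> ennreal (2 * L)"
    by eventually_elim (metis le_iff_add)
  define k where "k x = enn2real (g x) - L" for x
  have [measurable]: "k \<in> borel_measurable borel"
    unfolding k_def[abs_def] using g by measurable
  have kle: "AE x in lborel. \<bar>k x\<bar> \<le> L"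
    using gle
  proof eventually_elim
    case (elim x)
    then have "enn2real (g x) \<le> 2 * L"
      using L0 by (intro enn2real_leI) auto
    then show ?case using enn2real_nonneg[of "g x"] by (auto simp: k_def abs_le_iff)
  qed
  have "D b - D a = (LINT y:{a..b}|lborel. k y)" if "a \<le> b" for a b
  proof -
    let ?g = "\<lambda>x. indicator {a..b} x * enn2real (g x)"
    have gf: "AE x in lborel. g x < \<infinity>"
      using gle by eventually_elim (auto simp: le_less_trans)
    have "(\<integral>\<^sup>+x. ennreal (?g x) \<partial>lborel) = (\<integral>\<^sup>+x. g x * indicator {a..b} x \<partial>lborel)"
      using gf by (intro nn_integral_cong_AE) (auto simp: indicator_def elim!: eventually_mono)
    also have "\<dots> = emeasure (density lborel g) {a..b}"
      by (simp add: emeasure_density)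
    also have "\<dots> = ennreal (G b - G a)"
      unfolding dg using mono(1) cont(1) that by (intro emeasure_interval_measure_Icc) (auto dest: monoD)
    finally have nn: "(\<integral>\<^sup>+x. ennreal (?g x) \<partial>lborel) = ennreal (G b - G a)" .
    have Gab: "G b - G a \<ge> 0" using mono(1) that by (auto dest: monoD)
    have "has_bochner_integral lborel ?g (G b - G a)"
      by (rule has_bochner_integral_nn_integral) (use nn Gab in auto)
    moreover have "has_bochner_integral lborel (\<lambda>x. indicator {a..b} x * L) ((b - a) * L)"
      using has_bochner_integral_mult_left[OF has_bochner_integral_real_indicator[of "{a..b}" lborel], of L] that
      by simp
    ultimately have "has_bochner_integral lborel (\<lambda>x. ?g x - indicator {a..b} x * L) (G b - G a - (b - a) * L)"
      by (rule has_bochner_integral_diff)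
    then have "(LINT x|lborel. ?g x - indicator {a..b} x * L) = G b - G a - (b - a) * L"
      by (rule has_bochner_integral_integral_eq)
    then show ?thesis
      by (simp add: set_lebesgue_integral_def k_def right_diff_distrib G_def algebra_simps)
  qed
  then show ?thesis using that[of k] kle by simp
qed

lemma bounded_C11_imp_W2infty:
  assumes C: "C11 K f D" and B: "\<And>x. \<bar>f x\<bar> \<le> B"
  shows "f \<in> W2infty"
proof -
  note D = C11_has_derivative[OF C]
  note L = C11_derivative_Lipschitz[OF C]
  have contD: "continuous_on UNIV D"
    using L C11_nonneg[OF C]
    by (intro lipschitz_on_continuous_on[of "2 * K"] lipschitz_onI) (auto simp: dist_real_def)
  have contf: "continuous_on UNIV f"
    using D by (meson DERIV_continuous_on has_field_derivative_at_within)
  obtain g where g: "g \<in> borel_measurable borel" "AE x in lborel. \<bar>g x\<bar> \<le> 2 * K"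
    "\<And>a b. a \<le> b \<Longrightarrow> D b - D a = (LINT y:{a..b}|lborel. g y)"
    using Lipschitz_imp_bounded_density[OF L] by blast
  have int: "set_integrable lborel {a..b} g" for a b
    unfolding set_integrable_def
  proof (rule Bochner_Integration.integrable_bound)
    show "integrable lborel (\<lambda>x. indicat_real {a..b} x * (2 * K))"
      by (intro integrable_mult_left integrable_real_indicator) (auto simp: emeasure_lborel_Icc_eq)
    show "AE x in lborel. norm (indicat_real {a..b} x *\<^sub>R g x) \<le> norm (indicat_real {a..b} x * (2 * K))"
      using g(2) by eventually_elim (auto simp: indicator_def)
  qed (use g(1) in simp)
  have "f C1_differentiable_on UNIV"
    using D contD by (auto simp: C1_differentiable_on_def has_real_derivative_iff_has_vector_derivative[symmetric])
  moreover have "f \<in> Linfty"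
    using B contf by (intro LinftyI[of _ B] borel_measurable_continuous_onI) auto
  moreover have "D \<in> Linfty"
    using C11_derivative_bounded[OF C B] contD by (intro LinftyI[of _ "2 * B + K"] borel_measurable_continuous_onI) auto
  moreover have "g \<in> Linfty" using g by (intro LinftyI)
  moreover have "weak_derivative f D" by (rule C1_imp_weak_derivative[OF D contD])
  moreover have "weak_derivative D g" by (rule primitive_imp_weak_derivative[OF int g(3) contD])
  ultimately show ?thesis by (auto simp: W2infty_def)
qed

section \<open>Increments of Brownian motion\<close>

locale brownian_setup = prob_space M
  for M :: "'a measure" and F :: "real \<Rightarrow> 'a measure" and W :: "real \<Rightarrow> 'a \<Rightarrow> real" +
  assumes filtered: "filtered_prob_space M F"
    and brownian: "brownian_motion M F W"
begin

lemma subalg: "subalgebra M (F t)"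
  using filtered by (auto simp: filtered_prob_space_def)

lemma space_F [simp]: "space (F t) = space M"
  using subalg by (auto simp: subalgebra_def)

lemma measurable_F: "\<xi> \<in> borel_measurable (F t) \<Longrightarrow> \<xi> \<in> borel_measurable M"
  by (rule measurable_from_subalg[OF subalg])

lemma measurable_F_mono: "\<xi> \<in> borel_measurable (F s) \<Longrightarrow> s \<le> t \<Longrightarrow> \<xi> \<in> borel_measurable (F t)"
  using filtered
  by (intro measurable_from_subalg[of "F t" "F s"])
    (auto simp: filtered_prob_space_def filtration_def subalgebra_def)

lemma W_measurable_F: "0 \<le> t \<Longrightarrow> W t \<in> borel_measurable (F t)"
  using brownian by (auto simp: brownian_motion_def)

lemma W_measurable: "0 \<le> t \<Longrightarrow> W t \<in> borel_measurable M"
  by (rule measurable_F[OF W_measurable_F])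

lemma increment_distributed:
  "0 \<le> s \<Longrightarrow> s < t \<Longrightarrow>
    distributed M lborel (\<lambda>\<omega>. W t \<omega> - W s \<omega>) (normal_density 0 (sqrt (t - s)))"
  using brownian by (auto simp: brownian_motion_def)

text \<open>The definition of Brownian motion makes the preimages under the increment independent of
  \<open>F s\<close>. These preimages already form a sigma-algebra, and the one generated by \<xi>
  lies inside \<open>F s\<close>.\<close>

lemma increment_indep_var:
  assumes st: "0 \<le> s" "s < t" and \<xi>: "\<xi> \<in> borel_measurable (F s)"
  shows "indep_var borel \<xi> borel (\<lambda>\<omega>. W t \<omega> - W s \<omega>)"
  unfolding indep_var_eq
proof (intro conjI)
  let ?X = "\<lambda>\<omega>. W t \<omega> - W s \<omega>"
  let ?B = "{?X -` A \<inter> space M |A. A \<in> sets borel}"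
  show "random_variable borel \<xi>" by (rule measurable_F[OF \<xi>])
  show X: "random_variable borel ?X"
    using st by (intro borel_measurable_diff W_measurable) auto
  have ind: "indep_set (sets (F s)) ?B"
    using brownian st by (auto simp: brownian_motion_def)
  have 1: "sigma_sets (space M) {\<xi> -` A \<inter> space M |A. A \<in> sets borel} \<subseteq> sets (F s)"
  proof -
    have "{\<xi> -` A \<inter> space M |A. A \<in> sets borel} \<subseteq> sets (F s)"
      using measurable_sets[OF \<xi>] by auto
    then show ?thesis
      using sets.sigma_sets_subset[of _ "F s"] by simp
  qed
  have 2: "sigma_sets (space M) ?B = ?B"
  proof -
    have "sets (vimage_algebra (space M) ?X borel) = ?B"
      by (simp add: sets_vimage_algebra2)
    then show ?thesis
      using sets.sigma_sets_eq[of "vimage_algebra (space M) ?X borel"] by simp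
  qed
  show "indep_set (sigma_sets (space M) {\<xi> -` A \<inter> space M |A. A \<in> sets borel}) (sigma_sets (space M) ?B)"
    unfolding 2 using 1 unfolding indep_set_def
    by (intro indep_sets_mono_sets[OF ind[unfolded indep_set_def]]) (auto split: bool.splits)
qed

lemma increment_moments:
  assumes "0 \<le> s" "s \<le> t"
  shows "integrable M (\<lambda>\<omega>. W t \<omega> - W s \<omega>)" "expectation (\<lambda>\<omega>. W t \<omega> - W s \<omega>) = 0"
    and "integrable M (\<lambda>\<omega>. (W t \<omega> - W s \<omega>)\<^sup>2)" "expectation (\<lambda>\<omega>. (W t \<omega> - W s \<omega>)\<^sup>2) = t - s"
    and "integrable M (\<lambda>\<omega>. (W t \<omega> - W s \<omega>) ^ 4)" "expectation (\<lambda>\<omega>. (W t \<omega> - W s \<omega>) ^ 4) = 3 * (t - s)\<^sup>2"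
proof -
  have "integrable M (\<lambda>\<omega>. W t \<omega> - W s \<omega>) \<and> expectation (\<lambda>\<omega>. W t \<omega> - W s \<omega>) = 0 \<and>
    integrable M (\<lambda>\<omega>. (W t \<omega> - W s \<omega>)\<^sup>2) \<and> expectation (\<lambda>\<omega>. (W t \<omega> - W s \<omega>)\<^sup>2) = t - s \<and>
    integrable M (\<lambda>\<omega>. (W t \<omega> - W s \<omega>) ^ 4) \<and> expectation (\<lambda>\<omega>. (W t \<omega> - W s \<omega>) ^ 4) = 3 * (t - s)\<^sup>2"
  \<comment> \<open>The normal law is available for s < t only; at s = t the increment vanishes and
    both sides are zero.\<close>
  proof (cases "s = t")
    case False
    then have st: "s < t" using assms by simp
    note d = increment_distributed[OF assms(1) st]
    have pos: "0 < sqrt (t - s)" using st by simp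
    have i: "integrable M (\<lambda>\<omega>. (W t \<omega> - W s \<omega>) ^ k)" for k
      using distributed_integrable[OF d, of "\<lambda>x. x ^ k"] integrable_normal_moment[OF pos, of 0 k] by simp
    have e: "expectation (\<lambda>\<omega>. (W t \<omega> - W s \<omega>) ^ k) = (LBINT x. normal_density 0 (sqrt (t - s)) x * (x - 0) ^ k)" for k
      using distributed_integral[OF d, of "\<lambda>x. x ^ k"] by simp
    have e2: "expectation (\<lambda>\<omega>. (W t \<omega> - W s \<omega>) ^ 2) = t - s"
      unfolding e using integral_normal_moment_even[OF pos, of 0 1] st by (simp add: fact_numeral)
    have e4: "expectation (\<lambda>\<omega>. (W t \<omega> - W s \<omega>) ^ 4) = 3 * (t - s)\<^sup>2"
      unfolding e using integral_normal_moment_even[OF pos, of 0 2] st by (simp add: fact_numeral power2_eq_square)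
    show ?thesis
      using normal_distributed_expectation[OF pos d] i[of 1] i[of 2] i[of 4] e2 e4 by simp
  qed simp
  then show "integrable M (\<lambda>\<omega>. W t \<omega> - W s \<omega>)" "expectation (\<lambda>\<omega>. W t \<omega> - W s \<omega>) = 0"
    and "integrable M (\<lambda>\<omega>. (W t \<omega> - W s \<omega>)\<^sup>2)" "expectation (\<lambda>\<omega>. (W t \<omega> - W s \<omega>)\<^sup>2) = t - s"
    and "integrable M (\<lambda>\<omega>. (W t \<omega> - W s \<omega>) ^ 4)" "expectation (\<lambda>\<omega>. (W t \<omega> - W s \<omega>) ^ 4) = 3 * (t - s)\<^sup>2"
    by blast+
qed

lemma mult_increment:
  assumes st: "0 \<le> s" "s \<le> t" and \<xi>: "\<xi> \<in> borel_measurable (F s)" and int: "integrable M \<xi>"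
  shows "integrable M (\<lambda>\<omega>. \<xi> \<omega> * (W t \<omega> - W s \<omega>))"
    and "expectation (\<lambda>\<omega>. \<xi> \<omega> * (W t \<omega> - W s \<omega>)) = 0"
    and "integrable M (\<lambda>\<omega>. \<xi> \<omega> * (W t \<omega> - W s \<omega>)\<^sup>2)"
    and "expectation (\<lambda>\<omega>. \<xi> \<omega> * (W t \<omega> - W s \<omega>)\<^sup>2) = expectation \<xi> * (t - s)"
proof -
  have "integrable M (\<lambda>\<omega>. \<xi> \<omega> * (W t \<omega> - W s \<omega>)) \<and>
    expectation (\<lambda>\<omega>. \<xi> \<omega> * (W t \<omega> - W s \<omega>)) = 0 \<and>
    integrable M (\<lambda>\<omega>. \<xi> \<omega> * (W t \<omega> - W s \<omega>)\<^sup>2) \<and>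
    expectation (\<lambda>\<omega>. \<xi> \<omega> * (W t \<omega> - W s \<omega>)\<^sup>2) = expectation \<xi> * (t - s)"
  proof (cases "s = t")
    case False
    then have "s < t" using st by simp
    note ind = increment_indep_var[OF st(1) \<open>s < t\<close> \<xi>]
    have ind2: "indep_var borel \<xi> borel (\<lambda>\<omega>. (W t \<omega> - W s \<omega>)\<^sup>2)"
      using indep_var_compose[OF ind, of id borel "\<lambda>x. x\<^sup>2" borel] by (simp add: comp_def)
    show ?thesis
      using increment_moments[OF st] indep_var_integrable[OF ind int] indep_var_integrable[OF ind2 int]
        indep_var_lebesgue_integral[OF ind int] indep_var_lebesgue_integral[OF ind2 int] by simp
  qed simp
  then show "integrable M (\<lambda>\<omega>. \<xi> \<omega> * (W t \<omega> - W s \<omega>))"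
    "expectation (\<lambda>\<omega>. \<xi> \<omega> * (W t \<omega> - W s \<omega>)) = 0"
    "integrable M (\<lambda>\<omega>. \<xi> \<omega> * (W t \<omega> - W s \<omega>)\<^sup>2)"
    "expectation (\<lambda>\<omega>. \<xi> \<omega> * (W t \<omega> - W s \<omega>)\<^sup>2) = expectation \<xi> * (t - s)"
    by blast+
qed

definition bounded_rv :: "real \<Rightarrow> ('a \<Rightarrow> real) \<Rightarrow> bool" where
  "bounded_rv s \<xi> \<longleftrightarrow> \<xi> \<in> borel_measurable (F s) \<and> bounded (\<xi> ` space M)"

lemma bounded_rv_measurable: "bounded_rv s \<xi> \<Longrightarrow> \<xi> \<in> borel_measurable M"
  by (auto simp: bounded_rv_def intro: measurable_F)

lemma bounded_rv_mono: "bounded_rv s \<xi> \<Longrightarrow> s \<le> t \<Longrightarrow> bounded_rv t \<xi>"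
  by (auto simp: bounded_rv_def intro: measurable_F_mono)

lemma bounded_rv_mult: "bounded_rv s \<xi> \<Longrightarrow> bounded_rv s \<eta> \<Longrightarrow> bounded_rv s (\<lambda>\<omega>. \<xi> \<omega> * \<eta> \<omega>)"
proof -
  assume a: "bounded_rv s \<xi>" "bounded_rv s \<eta>"
  obtain B C where BC: "\<And>\<omega>. \<omega> \<in> space M \<Longrightarrow> \<bar>\<xi> \<omega>\<bar> \<le> B" "\<And>\<omega>. \<omega> \<in> space M \<Longrightarrow> \<bar>\<eta> \<omega>\<bar> \<le> C"
    using a unfolding bounded_rv_def bounded_iff by auto
  have "\<bar>\<xi> \<omega> * \<eta> \<omega>\<bar> \<le> \<bar>B\<bar> * \<bar>C\<bar>" if "\<omega> \<in> space M" for \<omega>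
    unfolding abs_mult using BC[OF that] by (intro mult_mono) auto
  then show ?thesis using a unfolding bounded_rv_def bounded_iff by auto
qed

lemma integrable_mult_bounded_rv:
  assumes "bounded_rv s \<xi>" "integrable M X"
  shows "integrable M (\<lambda>\<omega>. \<xi> \<omega> * X \<omega>)"
proof -
  obtain B where B: "\<And>\<omega>. \<omega> \<in> space M \<Longrightarrow> \<bar>\<xi> \<omega>\<bar> \<le> B"
    using assms(1) unfolding bounded_rv_def bounded_iff by auto
  show ?thesis
  proof (rule Bochner_Integration.integrable_bound)
    show "integrable M (\<lambda>\<omega>. B * X \<omega>)" using assms(2) by simp
    show "(\<lambda>\<omega>. \<xi> \<omega> * X \<omega>) \<in> borel_measurable M"
      using assms by (intro borel_measurable_times bounded_rv_measurable borel_measurable_integrable)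
    have "\<bar>\<xi> \<omega>\<bar> \<le> \<bar>B\<bar>" if "\<omega> \<in> space M" for \<omega> using B[OF that] by linarith
    then show "AE \<omega> in M. norm (\<xi> \<omega> * X \<omega>) \<le> norm (B * X \<omega>)"
      by (auto simp: abs_mult intro!: mult_right_mono)
  qed
qed

lemma bounded_rv_integrable: "bounded_rv s \<xi> \<Longrightarrow> integrable M \<xi>"
  using integrable_mult_bounded_rv[of s \<xi> "\<lambda>_. 1"] by simp

text \<open>The longer increment is split at the end e of the shorter one. The piece after e is
  independent of \<open>F e\<close> and centred, so only the square of the increment over (c, e]
  contributes.\<close>

lemma overlapping_increments:
  assumes c: "0 \<le> c" "c \<le> b" "c \<le> d" and \<xi>: "bounded_rv c \<xi>"
  shows "integrable M (\<lambda>\<omega>. \<xi> \<omega> * (W b \<omega> - W c \<omega>) * (W d \<omega> - W c \<omega>)) \<and>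
    expectation (\<lambda>\<omega>. \<xi> \<omega> * (W b \<omega> - W c \<omega>) * (W d \<omega> - W c \<omega>)) = expectation \<xi> * (min b d - c)"
proof -
  have *: "integrable M (\<lambda>\<omega>. \<xi> \<omega> * (W e \<omega> - W c \<omega>) * (W f \<omega> - W c \<omega>)) \<and>
    expectation (\<lambda>\<omega>. \<xi> \<omega> * (W e \<omega> - W c \<omega>) * (W f \<omega> - W c \<omega>)) = expectation \<xi> * (e - c)"
    if ef: "c \<le> e" "e \<le> f" for e f
  proof -
    have e0: "0 \<le> e" using ef c by simp
    note sq = mult_increment(3,4)[OF c(1) ef(1) _ bounded_rv_integrable[OF \<xi>]]
    have m: "(\<lambda>\<omega>. \<xi> \<omega> * (W e \<omega> - W c \<omega>)) \<in> borel_measurable (F e)"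
      using \<xi> ef e0 c(1)
      by (intro borel_measurable_times borel_measurable_diff W_measurable_F measurable_F_mono[of _ c e])
        (auto simp: bounded_rv_def W_measurable_F)
    have i: "integrable M (\<lambda>\<omega>. \<xi> \<omega> * (W e \<omega> - W c \<omega>))"
      using c(1) ef by (intro integrable_mult_bounded_rv[OF \<xi>] increment_moments)
    note cross = mult_increment(1,2)[OF e0 ef(2) m i]
    have "\<xi> \<omega> * (W e \<omega> - W c \<omega>) * (W f \<omega> - W c \<omega>) =
        \<xi> \<omega> * (W e \<omega> - W c \<omega>)\<^sup>2 + \<xi> \<omega> * (W e \<omega> - W c \<omega>) * (W f \<omega> - W e \<omega>)" for \<omega>
      by (simp add: power2_eq_square algebra_simps)
    then show ?thesis using sq cross \<xi> by (simp add: bounded_rv_def)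
  qed
  show ?thesis
  proof (cases "b \<le> d")
    case True
    then show ?thesis using *[of b d] c by (simp add: min_def)
  next
    case False
    then show ?thesis using *[of d b] c by (simp add: min_def mult.assoc mult.commute mult.left_commute)
  qed
qed

text \<open>By symmetry a \<le> c. What (a, b] contributes before c is known at time c, as are both
  coefficients, and is annihilated by the centred increment over (c, d]. Only the overlap remains;
  the maximum with 0 accounts for disjoint intervals.\<close>

lemma increment_product:
  assumes ab: "0 \<le> a" "a \<le> b" and cd: "0 \<le> c" "c \<le> d" and \<xi>: "bounded_rv a \<xi>" and \<eta>: "bounded_rv c \<eta>"
  shows "integrable M (\<lambda>\<omega>. (\<xi> \<omega> * (W b \<omega> - W a \<omega>)) * (\<eta> \<omega> * (W d \<omega> - W c \<omega>))) \<and>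
    expectation (\<lambda>\<omega>. (\<xi> \<omega> * (W b \<omega> - W a \<omega>)) * (\<eta> \<omega> * (W d \<omega> - W c \<omega>))) =
      expectation (\<lambda>\<omega>. \<xi> \<omega> * \<eta> \<omega>) * max 0 (min b d - max a c)"
proof -
  have *: "integrable M (\<lambda>\<omega>. (\<xi> \<omega> * (W b \<omega> - W a \<omega>)) * (\<eta> \<omega> * (W d \<omega> - W c \<omega>))) \<and>
    expectation (\<lambda>\<omega>. (\<xi> \<omega> * (W b \<omega> - W a \<omega>)) * (\<eta> \<omega> * (W d \<omega> - W c \<omega>))) =
      expectation (\<lambda>\<omega>. \<xi> \<omega> * \<eta> \<omega>) * max 0 (min b d - c)"
    if ab: "0 \<le> a" "a \<le> b" and cd: "c \<le> d" and ac: "a \<le> c"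
      and \<xi>: "bounded_rv a \<xi>" and \<eta>: "bounded_rv c \<eta>" for a b c d \<xi> \<eta>
  proof -
    have c0: "0 \<le> c" using ab ac by simp
    have \<xi>\<eta>: "bounded_rv c (\<lambda>\<omega>. \<xi> \<omega> * \<eta> \<omega>)" using \<xi> \<eta> ac by (auto intro: bounded_rv_mult bounded_rv_mono)
    \<comment> \<open>Used with e = b when the intervals are disjoint and with e = c when (a, b] is
      split at c.\<close>
    have cross: "integrable M (\<lambda>\<omega>. (\<xi> \<omega> * \<eta> \<omega> * (W e \<omega> - W a \<omega>)) * (W d \<omega> - W c \<omega>))"
      "expectation (\<lambda>\<omega>. (\<xi> \<omega> * \<eta> \<omega> * (W e \<omega> - W a \<omega>)) * (W d \<omega> - W c \<omega>)) = 0"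
      if e: "a \<le> e" "e \<le> c" for e
    proof -
      have e0: "0 \<le> e" using ab e by simp
      have m: "(\<lambda>\<omega>. \<xi> \<omega> * \<eta> \<omega> * (W e \<omega> - W a \<omega>)) \<in> borel_measurable (F c)"
      proof (rule borel_measurable_times)
        show "(\<lambda>\<omega>. \<xi> \<omega> * \<eta> \<omega>) \<in> borel_measurable (F c)" using \<xi>\<eta> by (simp add: bounded_rv_def)
        show "(\<lambda>\<omega>. W e \<omega> - W a \<omega>) \<in> borel_measurable (F c)"
          using e0 ab e ac by (intro borel_measurable_diff measurable_F_mono[OF W_measurable_F]) auto
      qed
      have i: "integrable M (\<lambda>\<omega>. \<xi> \<omega> * \<eta> \<omega> * (W e \<omega> - W a \<omega>))"
        using ab e by (intro integrable_mult_bounded_rv[OF \<xi>\<eta>] increment_moments)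
      show "integrable M (\<lambda>\<omega>. (\<xi> \<omega> * \<eta> \<omega> * (W e \<omega> - W a \<omega>)) * (W d \<omega> - W c \<omega>))"
        "expectation (\<lambda>\<omega>. (\<xi> \<omega> * \<eta> \<omega> * (W e \<omega> - W a \<omega>)) * (W d \<omega> - W c \<omega>)) = 0"
        by (rule mult_increment(1,2)[OF c0 cd m i])+
    qed
    show ?thesis
    proof (cases "b \<le> c")
      case True
      then show ?thesis using cross[of b] ab by (simp add: mult_ac)
    next
      case False
      then have cb: "c \<le> b" by simp
      have "(\<xi> \<omega> * (W b \<omega> - W a \<omega>)) * (\<eta> \<omega> * (W d \<omega> - W c \<omega>)) =
          \<xi> \<omega> * \<eta> \<omega> * (W b \<omega> - W c \<omega>) * (W d \<omega> - W c \<omega>) +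
          \<xi> \<omega> * \<eta> \<omega> * (W c \<omega> - W a \<omega>) * (W d \<omega> - W c \<omega>)" for \<omega>
        by (simp add: algebra_simps)
      then show ?thesis
        using overlapping_increments[OF c0 cb cd \<xi>\<eta>] cross[of c] ac cb cd by simp
    qed
  qed
  show ?thesis
  proof (cases "a \<le> c")
    case True
    then show ?thesis using *[OF ab cd(2) _ \<xi> \<eta>] by (simp add: max_def)
  next
    case False
    then have ca: "c \<le> a" by simp
    have "max a c = a" "min b d = min d b" using ca by auto
    then show ?thesis using *[OF cd ab(2) ca \<eta> \<xi>] by (simp only: mult.commute)
  qed
qed

end

section \<open>Ito isometry\<close>

lemma sum_list_product:
  fixes x :: "'b \<Rightarrow> real" and y :: "'c \<Rightarrow> real"
  shows "(\<Sum>p\<leftarrow>H. x p) * (\<Sum>q\<leftarrow>G. y q) = (\<Sum>p\<leftarrow>H. \<Sum>q\<leftarrow>G. x p * y q)"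
  by (induction H) (simp_all add: distrib_right sum_list_const_mult)

lemma integral_sum_list:
  fixes f :: "'b \<Rightarrow> 'c \<Rightarrow> real"
  assumes "\<And>p. p \<in> set H \<Longrightarrow> integrable M (f p)"
  shows "integrable M (\<lambda>\<omega>. \<Sum>p\<leftarrow>H. f p \<omega>)"
    and "(LINT \<omega>|M. (\<Sum>p\<leftarrow>H. f p \<omega>)) = (\<Sum>p\<leftarrow>H. (LINT \<omega>|M. f p \<omega>))"
proof -
  have "integrable M (\<lambda>\<omega>. \<Sum>p\<leftarrow>H. f p \<omega>) \<and>
    (LINT \<omega>|M. (\<Sum>p\<leftarrow>H. f p \<omega>)) = (\<Sum>p\<leftarrow>H. (LINT \<omega>|M. f p \<omega>))"
    using assms by (induction H) auto
  then show "integrable M (\<lambda>\<omega>. \<Sum>p\<leftarrow>H. f p \<omega>)"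
    "(LINT \<omega>|M. (\<Sum>p\<leftarrow>H. f p \<omega>)) = (\<Sum>p\<leftarrow>H. (LINT \<omega>|M. f p \<omega>))" by blast+
qed

lemma integral_sum_list2:
  fixes f :: "'b \<Rightarrow> 'b \<Rightarrow> 'c \<Rightarrow> real"
  assumes "\<And>p q. p \<in> set H \<Longrightarrow> q \<in> set H \<Longrightarrow> integrable M (f p q)"
  shows "integrable M (\<lambda>\<omega>. \<Sum>p\<leftarrow>H. \<Sum>q\<leftarrow>H. f p q \<omega>)"
    and "(LINT \<omega>|M. (\<Sum>p\<leftarrow>H. \<Sum>q\<leftarrow>H. f p q \<omega>)) = (\<Sum>p\<leftarrow>H. \<Sum>q\<leftarrow>H. (LINT \<omega>|M. f p q \<omega>))"
proof -
  have *: "integrable M (\<lambda>\<omega>. \<Sum>q\<leftarrow>H. f p q \<omega>)"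
    "(LINT \<omega>|M. (\<Sum>q\<leftarrow>H. f p q \<omega>)) = (\<Sum>q\<leftarrow>H. (LINT \<omega>|M. f p q \<omega>))" if "p \<in> set H" for p
    using integral_sum_list[of H M "f p"] assms that by auto
  show "integrable M (\<lambda>\<omega>. \<Sum>p\<leftarrow>H. \<Sum>q\<leftarrow>H. f p q \<omega>)"
    by (rule integral_sum_list(1)) (rule *(1))
  show "(LINT \<omega>|M. (\<Sum>p\<leftarrow>H. \<Sum>q\<leftarrow>H. f p q \<omega>)) = (\<Sum>p\<leftarrow>H. \<Sum>q\<leftarrow>H. (LINT \<omega>|M. f p q \<omega>))"
    using integral_sum_list(2)[of H M "\<lambda>p \<omega>. \<Sum>q\<leftarrow>H. f p q \<omega>"] * by (simp cong: map_cong)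
qed

text \<open>\<open>term_overlap\<close> is the length of \<open>(a, b] \<inter> (c, d] \<inter> [0, t]\<close>, provided that \<open>a, c \<ge> 0\<close>.\<close>

definition term_integral :: "(real \<Rightarrow> 'a \<Rightarrow> real) \<Rightarrow> real \<Rightarrow> real \<times> real \<times> ('a \<Rightarrow> real) \<Rightarrow> 'a \<Rightarrow> real" where
  "term_integral W t = (\<lambda>(a, b, \<xi>) \<omega>. \<xi> \<omega> * (W (min b t) \<omega> - W (min a t) \<omega>))"

definition term_value :: "real \<times> real \<times> ('a \<Rightarrow> real) \<Rightarrow> real \<Rightarrow> 'a \<Rightarrow> real" where
  "term_value = (\<lambda>(a, b, \<xi>) s \<omega>. \<xi> \<omega> * indicator {a<..b} s)"

definition term_overlap :: "real \<Rightarrow> real \<times> real \<times> ('a \<Rightarrow> real) \<Rightarrow> real \<times> real \<times> ('a \<Rightarrow> real) \<Rightarrow> real" where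
  "term_overlap t = (\<lambda>(a, b, \<xi>) (c, d, \<eta>). max 0 (min (min b d) t - max a c))"

lemma simple_integral_eq: "simple_integral W H t \<omega> = (\<Sum>p\<leftarrow>H. term_integral W t p \<omega>)"
  by (auto simp: simple_integral_def term_integral_def intro!: arg_cong[of _ _ sum_list] map_cong)

lemma simple_value_eq: "simple_value H s \<omega> = (\<Sum>p\<leftarrow>H. term_value p s \<omega>)"
  by (auto simp: simple_value_def term_value_def intro!: arg_cong[of _ _ sum_list] map_cong)

lemma term_value_product_integral:
  assumes "0 \<le> fst p" "0 \<le> fst q"
  shows "integrable lborel (\<lambda>s. indicator {0..t} s * (term_value p s \<omega> * term_value q s \<omega>)) \<and>
    (LBINT s. indicator {0..t} s * (term_value p s \<omega> * term_value q s \<omega>)) =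
      snd (snd p) \<omega> * snd (snd q) \<omega> * term_overlap t p q"
proof -
  obtain a b \<xi> c d \<eta> where pq: "p = (a, b, \<xi>)" "q = (c, d, \<eta>)" by (cases p, cases q) auto
  have eq: "indicator {0..t} s * (term_value p s \<omega> * term_value q s \<omega>) =
      \<xi> \<omega> * \<eta> \<omega> * indicator {max a c<..min (min b d) t} s" for s
    using assms by (auto simp: pq term_value_def indicator_def)
  have m: "measure lborel {max a c<..min (min b d) t} = max 0 (min (min b d) t - max a c)"
    by (cases "max a c \<le> min (min b d) t") auto
  have "integrable lborel (indicat_real {max a c<..min (min b d) t})"
    by (rule integrable_real_indicator) (auto intro!: emeasure_bounded_finite simp flip: infinity_ennreal_def)
  then show ?thesis
    unfolding eq by (simp add: m pq term_overlap_def)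
qed

context brownian_setup
begin

definition good_term :: "real \<times> real \<times> ('a \<Rightarrow> real) \<Rightarrow> bool" where
  "good_term = (\<lambda>(a, b, \<xi>). 0 \<le> a \<and> a \<le> b \<and> bounded_rv a \<xi>)"

lemma simple_process_iff: "simple_process M F H \<longleftrightarrow> (\<forall>p\<in>set H. good_term p)"
  unfolding simple_process_def good_term_def bounded_rv_def by auto

text \<open>If one of the intervals starts after t, truncation at t collapses its increment to zero,
  and the overlap vanishes as well. Otherwise truncation only moves the right ends.\<close>

lemma term_integral_product:
  assumes p: "good_term p" and q: "good_term q" and t: "0 \<le> t"
  shows "integrable M (\<lambda>\<omega>. term_integral W t p \<omega> * term_integral W t q \<omega>) \<and>
    expectation (\<lambda>\<omega>. term_integral W t p \<omega> * term_integral W t q \<omega>) =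
      expectation (\<lambda>\<omega>. snd (snd p) \<omega> * snd (snd q) \<omega>) * term_overlap t p q"
proof -
  obtain a b \<xi> c d \<eta> where pq: "p = (a, b, \<xi>)" "q = (c, d, \<eta>)" by (cases p, cases q) auto
  have ab: "0 \<le> a" "a \<le> b" "bounded_rv a \<xi>" and cd: "0 \<le> c" "c \<le> d" "bounded_rv c \<eta>"
    using p q by (auto simp: pq good_term_def)
  show ?thesis
  proof (cases "a \<le> t \<and> c \<le> t")
    case True
    have 1: "min (min b t) (min d t) = min (min b d) t" "min a t = a" "min c t = c"
      using True by auto
    have "a \<le> min b t" "c \<le> min d t" using True ab cd by auto
    then show ?thesis
      unfolding pq term_integral_def term_overlap_def prod.case fst_conv snd_conv 1(2,3) 1(1)[symmetric]
      by (intro increment_product ab cd)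
  next
    case False
    have 0: "term_integral W t p \<omega> * term_integral W t q \<omega> = 0" for \<omega>
    proof (cases "a \<le> t")
      case True
      then have "min c t = t" "min d t = t" using False cd by auto
      then show ?thesis by (simp add: pq term_integral_def)
    next
      case False
      then have "min a t = t" "min b t = t" using ab by auto
      then show ?thesis by (simp add: pq term_integral_def)
    qed
    have "term_overlap t p q = 0"
      using False by (auto simp: pq term_overlap_def)
    then show ?thesis unfolding 0 by simp
  qed
qed

lemma term_integral_mean:
  assumes p: "good_term p" and t: "0 \<le> t"
  shows "integrable M (term_integral W t p)" "expectation (term_integral W t p) = 0"
proof -
  obtain a b \<xi> where p': "p = (a, b, \<xi>)" by (cases p) auto
  have ab: "0 \<le> a" "a \<le> b" "bounded_rv a \<xi>" using p by (auto simp: p' good_term_def)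
  have "integrable M (term_integral W t p) \<and> expectation (term_integral W t p) = 0"
  proof (cases "a \<le> t")
    case True
    then show ?thesis
      using mult_increment(1,2)[of a "min b t" \<xi>] ab bounded_rv_integrable[OF ab(3)]
      by (simp add: p' term_integral_def bounded_rv_def min_absorb1)
  next
    case False
    then show ?thesis using ab by (simp add: p' term_integral_def)
  qed
  then show "integrable M (term_integral W t p)" "expectation (term_integral W t p) = 0" by auto
qed

lemma simple_integral_mean:
  assumes "simple_process M F H" "0 \<le> t"
  shows "integrable M (simple_integral W H t)" "expectation (simple_integral W H t) = 0"
proof -
  have eq: "simple_integral W H t = (\<lambda>\<omega>. \<Sum>p\<leftarrow>H. term_integral W t p \<omega>)"
    by (auto simp: simple_integral_eq)
  note * = integral_sum_list[of H M "term_integral W t"]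
  have good: "\<And>p. p \<in> set H \<Longrightarrow> good_term p" using assms(1) by (simp add: simple_process_iff)
  show "integrable M (simple_integral W H t)"
    unfolding eq using term_integral_mean good assms(2) by (intro *) auto
  have "expectation (simple_integral W H t) = (\<Sum>p\<leftarrow>H. expectation (term_integral W t p))"
    unfolding eq using term_integral_mean good assms(2) by (intro *) auto
  also have "\<dots> = (\<Sum>p\<leftarrow>H. 0)"
    using term_integral_mean good assms(2) by (intro arg_cong[of _ _ sum_list] map_cong) auto
  finally show "expectation (simple_integral W H t) = 0" by simp
qed

lemma simple_integral_measurable:
  "simple_process M F H \<Longrightarrow> 0 \<le> t \<Longrightarrow> simple_integral W H t \<in> borel_measurable M"
  using simple_integral_mean by blast

text \<open>Both sides expand into the same double sum over pairs of terms: expectation of the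
  product of coefficients, times overlap of the intervals. Keeping the off-diagonal pairs allows
  arbitrary lists instead of disjoint partitions.\<close>

theorem ito_isometry_simple:
  assumes H: "simple_process M F H" and t: "0 \<le> t"
  shows "(\<integral>\<^sup>+\<omega>. ennreal ((simple_integral W H t \<omega>)\<^sup>2) \<partial>M) =
    (\<integral>\<^sup>+\<omega>. (\<integral>\<^sup>+s\<in>{0..t}. ennreal ((simple_value H s \<omega>)\<^sup>2) \<partial>lborel) \<partial>M)"
proof -
  have good: "\<And>p. p \<in> set H \<Longrightarrow> good_term p" using H by (simp add: simple_process_iff)
  have bnd: "bounded_rv (max (fst p) (fst q)) (\<lambda>\<omega>. snd (snd p) \<omega> * snd (snd q) \<omega>)" if "p \<in> set H" "q \<in> set H" for p q
    using good[OF that(1)] good[OF that(2)]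
    by (intro bounded_rv_mult) (auto simp: good_term_def split_beta intro: bounded_rv_mono)
  \<comment> \<open>The time integral of the squared simple process along one path, as a quadratic
    form in the coefficients.\<close>
  define Q where "Q = (\<lambda>\<omega>. \<Sum>p\<leftarrow>H. \<Sum>q\<leftarrow>H. snd (snd p) \<omega> * snd (snd q) \<omega> * term_overlap t p q)"
  have Q: "integrable M Q" "expectation Q =
      (\<Sum>p\<leftarrow>H. \<Sum>q\<leftarrow>H. expectation (\<lambda>\<omega>. snd (snd p) \<omega> * snd (snd q) \<omega>) * term_overlap t p q)"
  proof -
    have i: "integrable M (\<lambda>\<omega>. snd (snd p) \<omega> * snd (snd q) \<omega> * term_overlap t p q)"
      if "p \<in> set H" "q \<in> set H" for p q
      using bounded_rv_integrable[OF bnd[OF that]] by (rule integrable_mult_left)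
    show "integrable M Q" unfolding Q_def by (rule integral_sum_list2(1)[OF i])
    have "expectation Q = (\<Sum>p\<leftarrow>H. \<Sum>q\<leftarrow>H. expectation (\<lambda>\<omega>. snd (snd p) \<omega> * snd (snd q) \<omega> * term_overlap t p q))"
      unfolding Q_def by (rule integral_sum_list2(2)[OF i])
    then show "expectation Q =
      (\<Sum>p\<leftarrow>H. \<Sum>q\<leftarrow>H. expectation (\<lambda>\<omega>. snd (snd p) \<omega> * snd (snd q) \<omega>) * term_overlap t p q)"
      by simp
  qed
  have I: "(simple_integral W H t \<omega>)\<^sup>2 = (\<Sum>p\<leftarrow>H. \<Sum>q\<leftarrow>H. term_integral W t p \<omega> * term_integral W t q \<omega>)" for \<omega>
    by (simp add: simple_integral_eq power2_eq_square sum_list_product)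
  have int: "integrable M (\<lambda>\<omega>. (simple_integral W H t \<omega>)\<^sup>2)"
    unfolding I using term_integral_product good t by (intro integral_sum_list2) auto
  have "expectation (\<lambda>\<omega>. (simple_integral W H t \<omega>)\<^sup>2) =
      (\<Sum>p\<leftarrow>H. \<Sum>q\<leftarrow>H. expectation (\<lambda>\<omega>. term_integral W t p \<omega> * term_integral W t q \<omega>))"
    unfolding I using term_integral_product good t by (intro integral_sum_list2) auto
  also have "\<dots> = expectation Q"
    unfolding Q(2) using term_integral_product good t
    by (intro arg_cong[of _ _ sum_list] map_cong refl) auto
  finally have E: "expectation (\<lambda>\<omega>. (simple_integral W H t \<omega>)\<^sup>2) = expectation Q" .
  have inner: "(\<integral>\<^sup>+s\<in>{0..t}. ennreal ((simple_value H s \<omega>)\<^sup>2) \<partial>lborel) = ennreal (Q \<omega>) \<and> 0 \<le> Q \<omega>" for \<omega>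
  proof -
    have V: "indicator {0..t} s * (simple_value H s \<omega>)\<^sup>2 =
        (\<Sum>p\<leftarrow>H. \<Sum>q\<leftarrow>H. indicator {0..t} s * (term_value p s \<omega> * term_value q s \<omega>))" for s
      by (simp add: simple_value_eq power2_eq_square sum_list_product sum_list_const_mult)
    have g: "0 \<le> fst p" if "p \<in> set H" for p using good[OF that] by (auto simp: good_term_def)
    note tv = term_value_product_integral[OF g g, of _ _ t \<omega>]
    have iV: "integrable lborel (\<lambda>s. indicator {0..t} s * (simple_value H s \<omega>)\<^sup>2)"
      unfolding V using tv by (intro integral_sum_list2) auto
    have "(LBINT s. indicator {0..t} s * (simple_value H s \<omega>)\<^sup>2) =
        (\<Sum>p\<leftarrow>H. \<Sum>q\<leftarrow>H. (LBINT s. indicator {0..t} s * (term_value p s \<omega> * term_value q s \<omega>)))"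
      unfolding V using tv by (intro integral_sum_list2) auto
    also have "\<dots> = Q \<omega>"
      unfolding Q_def using tv by (intro arg_cong[of _ _ sum_list] map_cong refl) auto
    finally have eQ: "(LBINT s. indicator {0..t} s * (simple_value H s \<omega>)\<^sup>2) = Q \<omega>" .
    have "(\<integral>\<^sup>+s\<in>{0..t}. ennreal ((simple_value H s \<omega>)\<^sup>2) \<partial>lborel) =
        (\<integral>\<^sup>+s. ennreal (indicator {0..t} s * (simple_value H s \<omega>)\<^sup>2) \<partial>lborel)"
      by (intro nn_integral_cong) (auto simp: indicator_def)
    also have "\<dots> = ennreal (Q \<omega>)"
      unfolding eQ[symmetric] by (rule nn_integral_eq_integral[OF iV]) auto
    finally show ?thesis
      unfolding eQ[symmetric] by (auto intro: integral_nonneg_AE)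
  qed
  have "(\<integral>\<^sup>+\<omega>. ennreal ((simple_integral W H t \<omega>)\<^sup>2) \<partial>M) = ennreal (expectation Q)"
    unfolding E[symmetric] by (rule nn_integral_eq_integral[OF int]) auto
  also have "\<dots> = (\<integral>\<^sup>+\<omega>. ennreal (Q \<omega>) \<partial>M)"
    by (rule nn_integral_eq_integral[symmetric, OF Q(1)]) (use inner in auto)
  finally show ?thesis using inner by simp
qed

end

section \<open>Squared L^2 distances of random variables and processes\<close>

text \<open>Kept squared and extended-valued, so that it is meaningful for every pair of measurable
  functions. The price is a factor 2 in the triangle inequality.\<close>

definition rv_dist :: "'a measure \<Rightarrow> ('a \<Rightarrow> real) \<Rightarrow> ('a \<Rightarrow> real) \<Rightarrow> ennreal" where
  "rv_dist M X Y = (\<integral>\<^sup>+\<omega>. ennreal ((X \<omega> - Y \<omega>)\<^sup>2) \<partial>M)"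

definition process_dist :: "'a measure \<Rightarrow> real \<Rightarrow> (real \<Rightarrow> 'a \<Rightarrow> real) \<Rightarrow> (real \<Rightarrow> 'a \<Rightarrow> real) \<Rightarrow> ennreal" where
  "process_dist M t u v = (\<integral>\<^sup>+\<omega>. (\<integral>\<^sup>+s\<in>{0..t}. ennreal ((u s \<omega> - v s \<omega>)\<^sup>2) \<partial>lborel) \<partial>M)"

lemma ennreal_square_triangle:
  "ennreal ((x - z)\<^sup>2) \<le> 2 * ennreal ((x - y)\<^sup>2) + 2 * ennreal ((y - z)\<^sup>2)"
proof -
  have "(x - z)\<^sup>2 \<le> 2 * (x - y)\<^sup>2 + 2 * (y - z)\<^sup>2"
    using zero_le_power2[of "(x - y) - (y - z)"] by (simp add: power2_eq_square algebra_simps)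
  then have "ennreal ((x - z)\<^sup>2) \<le> ennreal (2 * (x - y)\<^sup>2 + 2 * (y - z)\<^sup>2)"
    by (rule ennreal_leI)
  also have "\<dots> = 2 * ennreal ((x - y)\<^sup>2) + 2 * ennreal ((y - z)\<^sup>2)"
    by (simp add: ennreal_plus ennreal_mult)
  finally show ?thesis .
qed

lemma rv_dist_commute: "rv_dist M X Y = rv_dist M Y X"
  by (simp add: rv_dist_def power2_commute)

lemma process_dist_commute: "process_dist M t u v = process_dist M t v u"
  by (simp add: process_dist_def power2_commute)

lemma rv_dist_triangle:
  assumes [measurable]: "X \<in> borel_measurable M" "Y \<in> borel_measurable M" "Z \<in> borel_measurable M"
  shows "rv_dist M X Z \<le> 2 * rv_dist M X Y + 2 * rv_dist M Y Z"
proof -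
  have "rv_dist M X Z \<le> (\<integral>\<^sup>+\<omega>. 2 * ennreal ((X \<omega> - Y \<omega>)\<^sup>2) + 2 * ennreal ((Y \<omega> - Z \<omega>)\<^sup>2) \<partial>M)"
    unfolding rv_dist_def by (intro nn_integral_mono ennreal_square_triangle)
  also have "\<dots> = 2 * rv_dist M X Y + 2 * rv_dist M Y Z"
    unfolding rv_dist_def by (simp add: nn_integral_add nn_integral_cmult)
  finally show ?thesis .
qed

definition jointly_measurable :: "'a measure \<Rightarrow> (real \<Rightarrow> 'a \<Rightarrow> real) \<Rightarrow> bool" where
  "jointly_measurable M u \<longleftrightarrow> (\<lambda>(s, \<omega>). u s \<omega>) \<in> borel_measurable (lborel \<Otimes>\<^sub>M M)"

lemma jointly_measurable_swap:
  assumes "jointly_measurable M u"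
  shows "(\<lambda>(\<omega>, s). u s \<omega>) \<in> borel_measurable (M \<Otimes>\<^sub>M lborel)"
proof -
  have "(\<lambda>p. (\<lambda>(s, \<omega>). u s \<omega>) (snd p, fst p)) \<in> borel_measurable (M \<Otimes>\<^sub>M lborel)"
    using assms unfolding jointly_measurable_def by measurable
  then show ?thesis by (simp add: split_beta)
qed

lemma square_diff_measurable:
  assumes u: "jointly_measurable M u" and v: "jointly_measurable M v"
  shows "(\<lambda>(\<omega>, s). ennreal ((u s \<omega> - v s \<omega>)\<^sup>2)) \<in> borel_measurable (M \<Otimes>\<^sub>M lborel)"
proof -
  note [measurable] = jointly_measurable_swap[OF u] jointly_measurable_swap[OF v]
  have "(\<lambda>p. ennreal (((\<lambda>(\<omega>, s). u s \<omega>) p - (\<lambda>(\<omega>, s). v s \<omega>) p)\<^sup>2)) \<in> borel_measurable (M \<Otimes>\<^sub>M lborel)"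
    by measurable
  then show ?thesis by (simp add: split_beta)
qed

lemma process_dist_triangle:
  assumes u: "jointly_measurable M u" and v: "jointly_measurable M v" and w: "jointly_measurable M w"
  shows "process_dist M t u w \<le> 2 * process_dist M t u v + 2 * process_dist M t v w"
proof -
  note m = square_diff_measurable[OF u v] square_diff_measurable[OF v w]
  note [measurable] = m
  let ?f = "\<lambda>\<omega> s. ennreal ((u s \<omega> - v s \<omega>)\<^sup>2) * indicator {0..t} s"
  let ?g = "\<lambda>\<omega> s. ennreal ((v s \<omega> - w s \<omega>)\<^sup>2) * indicator {0..t} s"
  have mf: "(\<lambda>(\<omega>, s). ?f \<omega> s) \<in> borel_measurable (M \<Otimes>\<^sub>M lborel)" by measurable
  have mg: "(\<lambda>(\<omega>, s). ?g \<omega> s) \<in> borel_measurable (M \<Otimes>\<^sub>M lborel)" by measurable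
  have sf: "?f \<omega> \<in> borel_measurable lborel" if "\<omega> \<in> space M" for \<omega>
    using measurable_compose_Pair1[OF that mf] by simp
  have sg: "?g \<omega> \<in> borel_measurable lborel" if "\<omega> \<in> space M" for \<omega>
    using measurable_compose_Pair1[OF that mg] by simp
  have "process_dist M t u w \<le> (\<integral>\<^sup>+\<omega>. (\<integral>\<^sup>+s. 2 * ?f \<omega> s + 2 * ?g \<omega> s \<partial>lborel) \<partial>M)"
    unfolding process_dist_def
    by (intro nn_integral_mono) (auto simp: indicator_def intro: ennreal_square_triangle)
  also have "\<dots> = (\<integral>\<^sup>+\<omega>. 2 * (\<integral>\<^sup>+s. ?f \<omega> s \<partial>lborel) + 2 * (\<integral>\<^sup>+s. ?g \<omega> s \<partial>lborel) \<partial>M)"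
    using sf sg by (intro nn_integral_cong) (simp add: nn_integral_add nn_integral_cmult)
  also have "\<dots> = 2 * process_dist M t u v + 2 * process_dist M t v w"
    unfolding process_dist_def
    using lborel.borel_measurable_nn_integral[OF mf] lborel.borel_measurable_nn_integral[OF mg]
    by (simp add: nn_integral_add nn_integral_cmult)
  finally show ?thesis .
qed

lemma process_dist_cong:
  assumes "\<And>s \<omega>. s \<in> {0..t} \<Longrightarrow> \<omega> \<in> space M \<Longrightarrow> v s \<omega> = v' s \<omega>"
  shows "process_dist M t u v = process_dist M t u v'"
  unfolding process_dist_def using assms
  by (intro nn_integral_cong) (auto simp: indicator_def)

lemma (in prob_space) process_dist_bounded:
  assumes "\<And>s \<omega>. s \<in> {0..t} \<Longrightarrow> \<omega> \<in> space M \<Longrightarrow> \<bar>u s \<omega> - v s \<omega>\<bar> \<le> C" and t: "0 \<le> t"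
  shows "process_dist M t u v \<le> ennreal (C\<^sup>2 * t)"
proof -
  have "process_dist M t u v \<le> (\<integral>\<^sup>+\<omega>. (\<integral>\<^sup>+s. ennreal (C\<^sup>2) * indicator {0..t} s \<partial>lborel) \<partial>M)"
    unfolding process_dist_def
  proof (intro nn_integral_mono)
    fix s \<omega> assume "\<omega> \<in> space M"
    show "ennreal ((u s \<omega> - v s \<omega>)\<^sup>2) * indicator {0..t} s \<le> ennreal (C\<^sup>2) * indicator {0..t} s"
    proof (cases "s \<in> {0..t}")
      case True
      then have "(u s \<omega> - v s \<omega>)\<^sup>2 \<le> C\<^sup>2"
        using assms(1)[OF True \<open>\<omega> \<in> space M\<close>] power_mono[of "\<bar>u s \<omega> - v s \<omega>\<bar>" C 2] by simp
      then show ?thesis by (intro mult_right_mono ennreal_leI) auto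
    qed simp
  qed
  also have "\<dots> = ennreal (C\<^sup>2 * t)"
    using t emeasure_space_1 by (simp add: nn_integral_cmult ennreal_mult)
  finally show ?thesis .
qed

text \<open>This is nonnegativity of the variance of \<bar>X - Y\<bar>. If the squared difference is
  not integrable, the right-hand side is infinite.\<close>

lemma (in prob_space) square_expectation_le_rv_dist:
  assumes "integrable M X" "integrable M Y"
  shows "ennreal ((expectation (\<lambda>\<omega>. \<bar>X \<omega> - Y \<omega>\<bar>))\<^sup>2) \<le> rv_dist M X Y"
proof (cases "integrable M (\<lambda>\<omega>. (X \<omega> - Y \<omega>)\<^sup>2)")
  case True
  let ?Z = "\<lambda>\<omega>. \<bar>X \<omega> - Y \<omega>\<bar>"
  have "0 \<le> variance ?Z" by (rule variance_positive)
  also have "variance ?Z = expectation (\<lambda>\<omega>. (?Z \<omega>)\<^sup>2) - (expectation ?Z)\<^sup>2"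
    using assms True by (intro variance_eq) auto
  finally have "(expectation ?Z)\<^sup>2 \<le> expectation (\<lambda>\<omega>. (X \<omega> - Y \<omega>)\<^sup>2)" by simp
  then have "ennreal ((expectation ?Z)\<^sup>2) \<le> ennreal (expectation (\<lambda>\<omega>. (X \<omega> - Y \<omega>)\<^sup>2))"
    by (rule ennreal_leI)
  also have "\<dots> = rv_dist M X Y"
    unfolding rv_dist_def by (rule nn_integral_eq_integral[symmetric, OF True]) auto
  finally show ?thesis .
next
  case False
  have "rv_dist M X Y = \<infinity>"
  proof (rule ccontr)
    assume "rv_dist M X Y \<noteq> \<infinity>"
    then have "integrable M (\<lambda>\<omega>. (X \<omega> - Y \<omega>)\<^sup>2)"
      using assms by (intro integrableI_nonneg) (auto simp: rv_dist_def top.not_eq_extremum)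
    with False show False ..
  qed
  then show ?thesis by simp
qed

text \<open>Since \<bar>z\<bar> \<le> 1 + z^2 and the total mass is finite, square integrability of
  X - Y implies its integrability.\<close>

lemma (in prob_space) rv_dist_finite_imp_integrable:
  assumes [measurable]: "X \<in> borel_measurable M" "Y \<in> borel_measurable M"
    and Y: "integrable M Y" and fin: "rv_dist M X Y < \<infinity>"
  shows "integrable M X"
proof -
  have sq: "integrable M (\<lambda>\<omega>. (X \<omega> - Y \<omega>)\<^sup>2)"
    using fin by (intro integrableI_nonneg) (auto simp: rv_dist_def)
  have "integrable M (\<lambda>\<omega>. X \<omega> - Y \<omega>)"
  proof (rule Bochner_Integration.integrable_bound[OF Bochner_Integration.integrable_add[OF integrable_const[of 1] sq]])
    have "\<bar>z\<bar> \<le> \<bar>1 + z\<^sup>2\<bar>" for z :: real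
    proof (cases "\<bar>z\<bar> \<le> 1")
      case False
      then have "\<bar>z\<bar> * 1 \<le> \<bar>z\<bar> * \<bar>z\<bar>" by (intro mult_left_mono) auto
      then show ?thesis by (simp add: power2_eq_square)
    qed (smt (verit) zero_le_power2)
    then show "AE \<omega> in M. norm (X \<omega> - Y \<omega>) \<le> norm (1 + (X \<omega> - Y \<omega>)\<^sup>2)" by simp
  qed measurable
  then have "integrable M (\<lambda>\<omega>. (X \<omega> - Y \<omega>) + Y \<omega>)" using Y by (rule Bochner_Integration.integrable_add)
  then show ?thesis by simp
qed

section \<open>Ito integrals as limits of simple integrals\<close>

context brownian_setup
begin

lemma jointly_measurable_simple_value:
  assumes "simple_process M F H"
  shows "jointly_measurable M (simple_value H)"
proof -
  have "(\<lambda>(s, \<omega>). \<Sum>p\<leftarrow>H. term_value p s \<omega>) \<in> borel_measurable (lborel \<Otimes>\<^sub>M M)"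
    using assms unfolding simple_process_iff
  proof (induction H)
    case (Cons p H)
    obtain a b \<xi> where p: "p = (a, b, \<xi>)" by (cases p) auto
    have [measurable]: "\<xi> \<in> borel_measurable M"
      using Cons.prems by (auto simp: p good_term_def intro: bounded_rv_measurable)
    have "(\<lambda>(s, \<omega>). term_value p s \<omega>) \<in> borel_measurable (lborel \<Otimes>\<^sub>M M)"
      unfolding p term_value_def by simp measurable
    moreover have "(\<lambda>(s, \<omega>). \<Sum>p\<leftarrow>H. term_value p s \<omega>) \<in> borel_measurable (lborel \<Otimes>\<^sub>M M)"
      using Cons by simp
    ultimately have "(\<lambda>z. (\<lambda>(s, \<omega>). term_value p s \<omega>) z + (\<lambda>(s, \<omega>). \<Sum>p\<leftarrow>H. term_value p s \<omega>) z)
        \<in> borel_measurable (lborel \<Otimes>\<^sub>M M)"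
      by (rule borel_measurable_add)
    then show ?case by (simp add: split_beta)
  qed simp
  then show ?thesis by (simp add: jointly_measurable_def simple_value_eq)
qed

text \<open>Lists with overlapping intervals make differences easy: append the second list with
  negated coefficients and apply the isometry to the result.\<close>

lemma ito_isometry_diff:
  assumes H: "simple_process M F H" and G: "simple_process M F G" and t: "0 \<le> t"
  shows "rv_dist M (simple_integral W H t) (simple_integral W G t) =
    process_dist M t (simple_value H) (simple_value G)"
proof -
  let ?neg = "map (\<lambda>(a, b, \<xi>). (a, b, \<lambda>\<omega>. - \<xi> \<omega>)) :: 'a simple_process \<Rightarrow> 'a simple_process"
  have neg: "simple_process M F (?neg G)"
    using G by (fastforce simp: simple_process_def bounded_iff)
  have HG: "simple_process M F (H @ ?neg G)"
    using H neg by (auto simp: simple_process_iff)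
  have "simple_integral W (?neg G) t \<omega> = - simple_integral W G t \<omega>" for \<omega>
    unfolding simple_integral_def by (induction G) auto
  then have I: "simple_integral W (H @ ?neg G) t \<omega> = simple_integral W H t \<omega> - simple_integral W G t \<omega>" for \<omega>
    by (simp add: simple_integral_def)
  have "simple_value (?neg G) s \<omega> = - simple_value G s \<omega>" for s \<omega>
    unfolding simple_value_def by (induction G) auto
  then have V: "simple_value (H @ ?neg G) s \<omega> = simple_value H s \<omega> - simple_value G s \<omega>" for s \<omega>
    by (simp add: simple_value_def)
  show ?thesis
    using ito_isometry_simple[OF HG t] by (simp add: rv_dist_def process_dist_def I V)
qed

lemma simple_process_const: "0 \<le> t \<Longrightarrow> simple_process M F [(0, t, \<lambda>_. c)]"
  by (auto simp: simple_process_def bounded_iff)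

lemma simple_process_Nil: "simple_process M F []"
  by (simp add: simple_process_def)

text \<open>Freezing the time outside \<open>[0, t]\<close> makes a progressively measurable process jointly
  measurable on the whole line without changing it on \<open>[0, t]\<close>.\<close>

definition clamp_process :: "real \<Rightarrow> (real \<Rightarrow> 'a \<Rightarrow> real) \<Rightarrow> real \<Rightarrow> 'a \<Rightarrow> real" where
  "clamp_process t \<sigma> s = \<sigma> (max 0 (min t s))"

lemma clamp_process_measurable_F:
  assumes "progressively_measurable F \<sigma>" "0 \<le> t"
  shows "(\<lambda>(s, \<omega>). clamp_process t \<sigma> s \<omega>) \<in> borel_measurable (borel \<Otimes>\<^sub>M F t)"
proof -
  have "(\<lambda>(s, \<omega>). \<sigma> s \<omega>) \<in> borel_measurable (restrict_space borel {0..t} \<Otimes>\<^sub>M F t)"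
    using assms by (auto simp: progressively_measurable_def)
  moreover have "(\<lambda>(s, \<omega>). (max 0 (min t s), \<omega>)) \<in> borel \<Otimes>\<^sub>M F t \<rightarrow>\<^sub>M restrict_space borel {0..t} \<Otimes>\<^sub>M F t"
  proof -
    have "(\<lambda>s. max 0 (min t s)) \<in> borel \<rightarrow>\<^sub>M restrict_space borel {0..t}"
      using assms(2) by (intro measurable_restrict_space2) auto
    then show ?thesis by measurable
  qed
  ultimately have "(\<lambda>p. (\<lambda>(s, \<omega>). \<sigma> s \<omega>) ((\<lambda>(s, \<omega>). (max 0 (min t s), \<omega>)) p)) \<in> borel_measurable (borel \<Otimes>\<^sub>M F t)"
    by (rule measurable_compose[rotated])
  then show ?thesis by (simp add: clamp_process_def split_beta)
qed

lemma jointly_measurable_clamp_process: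
  assumes "progressively_measurable F \<sigma>" "0 \<le> t"
  shows "jointly_measurable M (clamp_process t \<sigma>)"
  unfolding jointly_measurable_def
proof -
  have "id \<in> lborel \<Otimes>\<^sub>M M \<rightarrow>\<^sub>M borel \<Otimes>\<^sub>M F t"
  proof -
    have "(\<lambda>x. x) \<in> M \<rightarrow>\<^sub>M F t"
      using subalg[of t] by (auto simp: measurable_def subalgebra_def)
    then have "(\<lambda>(s, \<omega>). (s, \<omega>)) \<in> lborel \<Otimes>\<^sub>M M \<rightarrow>\<^sub>M borel \<Otimes>\<^sub>M F t"
      by measurable
    then show ?thesis by (simp add: id_def split_beta)
  qed
  from measurable_compose[OF this clamp_process_measurable_F[OF assms]]
  show "(\<lambda>(s, \<omega>). clamp_process t \<sigma> s \<omega>) \<in> borel_measurable (lborel \<Otimes>\<^sub>M M)"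
    by simp
qed

lemma process_dist_clamp:
  assumes "0 \<le> t"
  shows "process_dist M t u (clamp_process t \<sigma>) = process_dist M t u \<sigma>"
  by (rule process_dist_cong) (simp add: clamp_process_def)

lemma process_dist_triangle_simple:
  assumes \<sigma>: "progressively_measurable F \<sigma>" and t: "0 \<le> t"
    and H: "simple_process M F H" and G: "simple_process M F G"
  shows "process_dist M t (simple_value H) (simple_value G) \<le>
    2 * process_dist M t (simple_value H) \<sigma> + 2 * process_dist M t (simple_value G) \<sigma>"
  using process_dist_triangle[OF jointly_measurable_simple_value[OF H]
      jointly_measurable_clamp_process[OF \<sigma> t] jointly_measurable_simple_value[OF G], of t] t
  by (simp add: process_dist_clamp process_dist_commute[of M t "clamp_process t \<sigma>"])

lemma is_ito_integral_iff:
  "is_ito_integral M F W \<sigma> t X \<longleftrightarrow> X \<in> borel_measurable M \<and>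
     (\<exists>H. (\<forall>n. simple_process M F (H n)) \<and>
        (\<lambda>n. process_dist M t (simple_value (H n)) \<sigma>) \<longlonglongrightarrow> 0 \<and>
        (\<lambda>n. rv_dist M (simple_integral W (H n) t) X) \<longlonglongrightarrow> 0)"
  by (simp add: is_ito_integral_def process_dist_def rv_dist_def)

text \<open>The source of what is known about the integrals beyond their mean: a suitable G is
  inserted and the right-hand side computed. The comparison passes through the simple processes
  defining X and uses the triangle inequality twice, once for integrals and once, after the
  isometry, for integrands; the two factors 2 give the 4.\<close>

lemma ito_integral_dist_simple:
  assumes X: "is_ito_integral M F W \<sigma> t X" and \<sigma>: "progressively_measurable F \<sigma>" and t: "0 \<le> t"
    and G: "simple_process M F G"
  shows "rv_dist M X (simple_integral W G t) \<le> 4 * process_dist M t (simple_value G) \<sigma>"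
proof -
  have mX: "X \<in> borel_measurable M" using X by (simp add: is_ito_integral_def)
  obtain H where H: "\<And>n. simple_process M F (H n)"
    and H1: "(\<lambda>n. process_dist M t (simple_value (H n)) \<sigma>) \<longlonglongrightarrow> 0"
    and H2: "(\<lambda>n. rv_dist M (simple_integral W (H n) t) X) \<longlonglongrightarrow> 0"
    using X unfolding is_ito_integral_iff by blast
  let ?d = "process_dist M t (simple_value G) \<sigma>"
  have le: "rv_dist M X (simple_integral W G t) \<le>
      2 * rv_dist M (simple_integral W (H n) t) X + 2 * (2 * process_dist M t (simple_value (H n)) \<sigma> + 2 * ?d)" for n
  proof -
    have "rv_dist M X (simple_integral W G t) \<le>
        2 * rv_dist M X (simple_integral W (H n) t) + 2 * rv_dist M (simple_integral W (H n) t) (simple_integral W G t)"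
      using simple_integral_measurable[OF H t] simple_integral_measurable[OF G t] mX
      by (intro rv_dist_triangle)
    also have "\<dots> \<le> 2 * rv_dist M (simple_integral W (H n) t) X + 2 * (2 * process_dist M t (simple_value (H n)) \<sigma> + 2 * ?d)"
      unfolding ito_isometry_diff[OF H G t] rv_dist_commute[of M X]
      by (intro add_left_mono mult_left_mono process_dist_triangle_simple \<sigma> t H G) simp
    finally show ?thesis .
  qed
  have "(\<lambda>n. 2 * rv_dist M (simple_integral W (H n) t) X + 2 * (2 * process_dist M t (simple_value (H n)) \<sigma> + 2 * ?d))
      \<longlonglongrightarrow> 2 * 0 + 2 * (2 * 0 + 2 * ?d)"
    by (intro tendsto_add tendsto_const ennreal_tendsto_cmult H1 H2) auto
  then have "rv_dist M X (simple_integral W G t) \<le> 2 * 0 + 2 * (2 * 0 + 2 * ?d)"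
    by (rule LIMSEQ_le_const) (use le in auto)
  also have "\<dots> = 4 * ?d" by (simp flip: mult.assoc)
  finally show ?thesis .
qed

lemma ito_integral_second_moment:
  assumes X: "is_ito_integral M F W \<sigma> t X" and \<sigma>: "progressively_measurable F \<sigma>" and t: "0 \<le> t"
    and C: "\<And>s \<omega>. s \<in> {0..t} \<Longrightarrow> \<omega> \<in> space M \<Longrightarrow> \<bar>\<sigma> s \<omega>\<bar> \<le> C"
  shows "integrable M (\<lambda>\<omega>. (X \<omega>)\<^sup>2)" "expectation (\<lambda>\<omega>. (X \<omega>)\<^sup>2) \<le> 4 * C\<^sup>2 * t"
proof -
  have mX: "X \<in> borel_measurable M" using X by (simp add: is_ito_integral_def)
  \<comment> \<open>The empty list represents the zero process, so the comparison estimates X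
    itself.\<close>
  have "simple_value ([] :: 'a simple_process) = (\<lambda>s \<omega>. 0)" "simple_integral W [] t = (\<lambda>\<omega>. 0)"
    by (auto simp: fun_eq_iff simple_value_def simple_integral_def)
  then have "rv_dist M X (\<lambda>\<omega>. 0) \<le> 4 * process_dist M t (\<lambda>s \<omega>. 0) \<sigma>"
    using ito_integral_dist_simple[OF X \<sigma> t simple_process_Nil] by simp
  also have "\<dots> \<le> 4 * ennreal (C\<^sup>2 * t)"
    using C t by (intro mult_left_mono process_dist_bounded) auto
  also have "\<dots> = ennreal (4 * C\<^sup>2 * t)" by (simp add: ennreal_mult' mult.assoc flip: ennreal_numeral)
  finally have le: "(\<integral>\<^sup>+\<omega>. ennreal ((X \<omega>)\<^sup>2) \<partial>M) \<le> ennreal (4 * C\<^sup>2 * t)"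
    by (simp add: rv_dist_def)
  show int: "integrable M (\<lambda>\<omega>. (X \<omega>)\<^sup>2)"
    using mX le by (intro integrableI_nonneg) (auto simp: le_less_trans)
  then show "expectation (\<lambda>\<omega>. (X \<omega>)\<^sup>2) \<le> 4 * C\<^sup>2 * t"
    using le t nn_integral_eq_integral[OF int] by (simp add: ennreal_le_iff)
qed

text \<open>Simple integrals are centred, and means pass to L^2-limits. A single index at which the
  distance is below 1 already makes X integrable.\<close>

lemma ito_integral_mean:
  assumes X: "is_ito_integral M F W \<sigma> t X" and t: "0 \<le> t"
  shows "integrable M X" "expectation X = 0"
proof -
  have mX: "X \<in> borel_measurable M" using X by (simp add: is_ito_integral_def)
  obtain H where H: "\<And>n. simple_process M F (H n)"
    and H2: "(\<lambda>n. rv_dist M (simple_integral W (H n) t) X) \<longlonglongrightarrow> 0"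
    using X unfolding is_ito_integral_iff by blast
  note I = simple_integral_mean[OF H t]
  have "\<forall>\<^sub>F n in sequentially. rv_dist M (simple_integral W (H n) t) X < 1"
    using H2 by (rule order_tendstoD) simp
  then obtain n where "rv_dist M (simple_integral W (H n) t) X < 1"
    by (auto simp: eventually_sequentially)
  then have "rv_dist M (simple_integral W (H n) t) X < \<infinity>"
    by (rule less_trans) simp
  then show int: "integrable M X"
    using rv_dist_finite_imp_integrable[OF mX borel_measurable_integrable[OF I(1)[of n]] I(1)[of n]]
    by (simp add: rv_dist_commute)
  have "ennreal ((expectation X)\<^sup>2) \<le> rv_dist M (simple_integral W (H n) t) X" for n
  proof -
    have "\<bar>expectation X\<bar> = \<bar>expectation (\<lambda>\<omega>. simple_integral W (H n) t \<omega> - X \<omega>)\<bar>"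
      using I[of n] int by simp
    also have "\<dots> \<le> expectation (\<lambda>\<omega>. \<bar>simple_integral W (H n) t \<omega> - X \<omega>\<bar>)"
      by (rule integral_abs_bound)
    finally have "(expectation X)\<^sup>2 \<le> (expectation (\<lambda>\<omega>. \<bar>simple_integral W (H n) t \<omega> - X \<omega>\<bar>))\<^sup>2"
      using power_mono[of "\<bar>expectation X\<bar>" _ 2] by simp
    then have "ennreal ((expectation X)\<^sup>2) \<le> ennreal ((expectation (\<lambda>\<omega>. \<bar>simple_integral W (H n) t \<omega> - X \<omega>\<bar>))\<^sup>2)"
      by (rule ennreal_leI)
    also have "\<dots> \<le> rv_dist M (simple_integral W (H n) t) X"
      by (rule square_expectation_le_rv_dist[OF I(1) int])
    finally show ?thesis .
  qed
  then have "ennreal ((expectation X)\<^sup>2) \<le> 0"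
    by (intro LIMSEQ_le_const[OF H2]) auto
  then show "expectation X = 0" by (simp add: ennreal_eq_0_iff)
qed

text \<open>A single term on (0, t] represents the constant integrand except at time 0, a null set,
  so the distance to its integral is zero. \<open>W 0\<close> stays in the formula because it
  vanishes only almost surely; the right-hand side is then an honest increment.\<close>

lemma ito_integral_const:
  assumes X: "is_ito_integral M F W (\<lambda>_ _. c) t X" and t: "0 \<le> t"
  shows "AE \<omega> in M. X \<omega> = c * (W t \<omega> - W 0 \<omega>)"
proof -
  let ?G = "[(0, t, \<lambda>_. c)] :: 'a simple_process"
  note G = simple_process_const[OF t, of c]
  have [measurable]: "X \<in> borel_measurable M" using X by (simp add: is_ito_integral_def)
  note [measurable] = simple_integral_measurable[OF G t]
  have \<sigma>: "progressively_measurable F (\<lambda>_ _. c)"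
    by (simp add: progressively_measurable_def)
  have "(\<integral>\<^sup>+s\<in>{0..t}. ennreal ((simple_value ?G s \<omega> - c)\<^sup>2) \<partial>lborel) = 0" for \<omega>
  proof -
    have "AE s in lborel. ennreal ((simple_value ?G s \<omega> - c)\<^sup>2) * indicator {0..t} s = 0"
      using AE_lborel_singleton[of "0::real"]
      by eventually_elim (auto simp: simple_value_def indicator_def)
    then have "(\<integral>\<^sup>+s\<in>{0..t}. ennreal ((simple_value ?G s \<omega> - c)\<^sup>2) \<partial>lborel) = (\<integral>\<^sup>+s. 0 \<partial>(lborel :: real measure))"
      by (intro nn_integral_cong_AE) auto
    then show ?thesis by simp
  qed
  then have "process_dist M t (simple_value ?G) (\<lambda>_ _. c) = 0"
    by (simp add: process_dist_def)
  then have "rv_dist M X (simple_integral W ?G t) = 0"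
    using ito_integral_dist_simple[OF X \<sigma> t G] by simp
  then have "AE \<omega> in M. ennreal ((X \<omega> - simple_integral W ?G t \<omega>)\<^sup>2) = 0"
    unfolding rv_dist_def by (subst (asm) nn_integral_0_iff_AE) auto
  then show ?thesis
    by eventually_elim (use t in \<open>auto simp: simple_integral_def\<close>)
qed

end

section \<open>Existence of the limit by completeness of L^2\<close>

context brownian_setup
begin

text \<open>By the isometry the simple integrals are Cauchy in L^2, hence in L^1, so a subsequence
  converges almost surely. Fatou's lemma shows that its pointwise limit is also its
  L^2-limit.\<close>

lemma ito_integral_exists_of_approximation:
  assumes \<sigma>: "progressively_measurable F \<sigma>" and t: "0 \<le> t"
    and H: "\<And>n. simple_process M F (H n)"
    and lim: "(\<lambda>n. process_dist M t (simple_value (H n)) \<sigma>) \<longlonglongrightarrow> 0"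
  shows "\<exists>X. is_ito_integral M F W \<sigma> t X"
proof -
  define I where "I n = simple_integral W (H n) t" for n
  have iI: "integrable M (I n)" for n
    unfolding I_def by (rule simple_integral_mean[OF H t])
  then have [measurable]: "I n \<in> borel_measurable M" for n by auto
  have small: "\<exists>N. \<forall>i\<ge>N. \<forall>j\<ge>N. rv_dist M (I i) (I j) \<le> e" if "0 < e" for e :: ennreal
  proof -
    have e4: "0 < e / 4" using that by (simp add: ennreal_zero_less_divide)
    have "\<forall>\<^sub>F n in sequentially. process_dist M t (simple_value (H n)) \<sigma> < e / 4"
      using lim e4 by (rule order_tendstoD)
    then obtain N where N: "\<And>n. n \<ge> N \<Longrightarrow> process_dist M t (simple_value (H n)) \<sigma> < e / 4"
      by (auto simp: eventually_sequentially)
    have "rv_dist M (I i) (I j) \<le> e" if "i \<ge> N" "j \<ge> N" for i j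
    proof -
      have "rv_dist M (I i) (I j) \<le>
          2 * process_dist M t (simple_value (H i)) \<sigma> + 2 * process_dist M t (simple_value (H j)) \<sigma>"
        unfolding I_def ito_isometry_diff[OF H H t] by (rule process_dist_triangle_simple[OF \<sigma> t H H])
      also have "\<dots> \<le> 2 * (e / 4) + 2 * (e / 4)"
        using N that by (intro add_mono mult_left_mono) (auto simp: less_imp_le)
      also have "\<dots> = 4 * (e / 4)" by (simp flip: distrib_right)
      also have "\<dots> = e" by (simp add: ennreal_times_divide ennreal_mult_divide_eq mult.commute)
      finally show ?thesis .
    qed
    then show ?thesis by blast
  qed
  have L1: "\<exists>N. \<forall>i\<ge>N. \<forall>j\<ge>N. LINT x|M. norm (I i x - I j x) < e" if "0 < e" for e :: real
  proof -
    obtain N where N: "\<And>i j. i \<ge> N \<Longrightarrow> j \<ge> N \<Longrightarrow> rv_dist M (I i) (I j) \<le> ennreal ((e / 2)\<^sup>2)"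
      using small[of "ennreal ((e / 2)\<^sup>2)"] \<open>0 < e\<close> by auto
    have "LINT x|M. norm (I i x - I j x) < e" if "i \<ge> N" "j \<ge> N" for i j
    proof -
      have "ennreal ((expectation (\<lambda>\<omega>. \<bar>I i \<omega> - I j \<omega>\<bar>))\<^sup>2) \<le> ennreal ((e / 2)\<^sup>2)"
        using square_expectation_le_rv_dist[OF iI iI] N[OF that] by (rule order_trans)
      then have "(expectation (\<lambda>\<omega>. \<bar>I i \<omega> - I j \<omega>\<bar>))\<^sup>2 \<le> (e / 2)\<^sup>2"
        by (simp add: ennreal_le_iff)
      then have "expectation (\<lambda>\<omega>. \<bar>I i \<omega> - I j \<omega>\<bar>) \<le> e / 2"
        by (rule power2_le_imp_le) (use \<open>0 < e\<close> in simp)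
      then show ?thesis using \<open>0 < e\<close> by simp
    qed
    then show ?thesis by blast
  qed
  obtain r where r: "strict_mono r" and ae: "AE x in M. Cauchy (\<lambda>i. I (r i) x)"
    using cauchy_L1_AE_cauchy_subseq[OF iI L1] by blast
  define X where "X \<omega> = lim (\<lambda>i. I (r i) \<omega>)" for \<omega>
  have mX[measurable]: "X \<in> borel_measurable M"
    unfolding X_def[abs_def] by measurable
  have conv: "AE \<omega> in M. (\<lambda>i. I (r i) \<omega>) \<longlonglongrightarrow> X \<omega>"
    using ae by eventually_elim (simp add: X_def convergent_LIMSEQ_iff[symmetric] Cauchy_convergent)
  have close: "\<exists>N. \<forall>n\<ge>N. rv_dist M (I (r n)) X \<le> e" if "0 < e" for e :: ennreal
  proof -
    obtain N where N: "\<And>i j. i \<ge> N \<Longrightarrow> j \<ge> N \<Longrightarrow> rv_dist M (I i) (I j) \<le> e"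
      using small[OF \<open>0 < e\<close>] by blast
    have rge: "r n \<ge> N" if "n \<ge> N" for n
      using seq_suble[OF r, of n] that by simp
    have "rv_dist M (I (r n)) X \<le> e" if "n \<ge> N" for n
    proof -
      have "rv_dist M (I (r n)) X = (\<integral>\<^sup>+\<omega>. liminf (\<lambda>m. ennreal ((I (r n) \<omega> - I (r m) \<omega>)\<^sup>2)) \<partial>M)"
        unfolding rv_dist_def
      proof (rule nn_integral_cong_AE)
        show "AE \<omega> in M. ennreal ((I (r n) \<omega> - X \<omega>)\<^sup>2) = liminf (\<lambda>m. ennreal ((I (r n) \<omega> - I (r m) \<omega>)\<^sup>2))"
          using conv
        proof eventually_elim
          case (elim \<omega>)
          then have "(\<lambda>m. ennreal ((I (r n) \<omega> - I (r m) \<omega>)\<^sup>2)) \<longlonglongrightarrow> ennreal ((I (r n) \<omega> - X \<omega>)\<^sup>2)"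
            by (intro tendsto_ennrealI tendsto_intros)
          then show ?case by (intro lim_imp_Liminf[symmetric]) auto
        qed
      qed
      also have "\<dots> \<le> liminf (\<lambda>m. rv_dist M (I (r n)) (I (r m)))"
        unfolding rv_dist_def by (rule nn_integral_liminf) measurable
      also have "\<dots> \<le> liminf (\<lambda>m. e)"
        using N[OF rge[OF that] rge]
        by (intro Liminf_mono) (auto simp: eventually_sequentially)
      also have "\<dots> = e" by (simp add: Liminf_const)
      finally show ?thesis .
    qed
    then show ?thesis by blast
  qed
  have "(\<lambda>n. rv_dist M (I (r n)) X) \<longlonglongrightarrow> 0"
  proof (rule order_tendstoI)
    fix e :: ennreal assume "0 < e"
    then obtain d where d: "0 < d" "d < e" using dense by blast
    then obtain N where "\<And>n. n \<ge> N \<Longrightarrow> rv_dist M (I (r n)) X \<le> d" using close by blast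
    then show "\<forall>\<^sub>F n in sequentially. rv_dist M (I (r n)) X < e"
      using d(2) by (auto simp: eventually_sequentially intro!: exI[of _ N] intro: le_less_trans)
  qed simp
  \<comment> \<open>The definition asks for some approximating sequence, so the subsequence may
    serve as one.\<close>
  moreover have "(\<lambda>n. process_dist M t (simple_value (H (r n))) \<sigma>) \<longlonglongrightarrow> 0"
    using LIMSEQ_subseq_LIMSEQ[OF lim r] by (simp add: comp_def)
  ultimately have "is_ito_integral M F W \<sigma> t X"
    unfolding is_ito_integral_iff I_def using mX H by (intro conjI exI[of _ "\<lambda>n. H (r n)"]) auto
  then show ?thesis by blast
qed

end

text \<open>A measurable function is an almost everywhere limit of continuous ones. Truncation at -C
  and C preserves continuity and, as \<bar>g\<bar> \<le> C, the limit; it also provides the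
  dominating constant.\<close>

lemma bounded_approximated_by_continuous_L1:
  fixes g :: "real \<Rightarrow> real"
  assumes [measurable]: "g \<in> borel_measurable borel" and C: "\<And>x. \<bar>g x\<bar> \<le> C" and e: "0 < e"
  obtains c where "continuous_on UNIV c" "\<And>x. \<bar>c x\<bar> \<le> C"
    "(LBINT x. indicator {a..b} x * \<bar>g x - c x\<bar>) < e"
proof -
  have "g \<in> borel_measurable lebesgue"
    by (intro measurable_completion) simp
  then have "g measurable_on UNIV"
    using measurable_on_iff_borel_measurable[of UNIV g] by (simp add: lebesgue_on_UNIV_eq)
  then obtain N f where N: "negligible N" and cont: "\<And>n. continuous_on UNIV (f n)"
    and f: "\<And>x. x \<notin> N \<Longrightarrow> (\<lambda>n. f n x) \<longlonglongrightarrow> g x"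
    unfolding measurable_on_def by auto
  have C0: "0 \<le> C" using C[of 0] by linarith
  define c where "c n x = max (- C) (min C (f n x))" for n x
  have contc: "continuous_on UNIV (c n)" for n
    unfolding c_def[abs_def] by (intro continuous_intros cont)
  have [measurable]: "c n \<in> borel_measurable borel" for n
    by (intro borel_measurable_continuous_onI contc)
  have cC: "\<bar>c n x\<bar> \<le> C" for n x using C0 by (auto simp: c_def)
  have "AE x in lebesgue. x \<notin> N"
    using N by (intro AE_not_in) (simp add: negligible_iff_null_sets)
  then have "AE x in lborel. x \<notin> N" by (simp add: AE_completion_iff)
  then have "AE x in lborel. (\<lambda>n. indicator {a..b} x * \<bar>g x - c n x\<bar>) \<longlonglongrightarrow> 0"
  proof eventually_elim
    case (elim x)
    have "(\<lambda>n. c n x) \<longlonglongrightarrow> max (- C) (min C (g x))"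
      unfolding c_def by (intro tendsto_intros f elim)
    also have "max (- C) (min C (g x)) = g x" using C[of x] by (auto simp: max_def min_def abs_le_iff)
    finally have "(\<lambda>n. indicator {a..b} x * \<bar>g x - c n x\<bar>) \<longlonglongrightarrow> indicator {a..b} x * \<bar>g x - g x\<bar>"
      by (intro tendsto_intros)
    then show ?case by simp
  qed
  then have "(\<lambda>n. LBINT x. indicator {a..b} x * \<bar>g x - c n x\<bar>) \<longlonglongrightarrow> (LBINT x::real. 0)"
  proof (intro integral_dominated_convergence[where w = "\<lambda>x. indicator {a..b} x * (2 * C)"])
    show "integrable lborel (\<lambda>x. indicator {a..b} x * (2 * C))"
      by (intro integrable_mult_left integrable_real_indicator) (auto simp: emeasure_lborel_Icc_eq)
    show "AE x in lborel. norm (indicator {a..b} x * \<bar>g x - c n x\<bar>) \<le> indicator {a..b} x * (2 * C)" for n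
    proof (intro AE_I2)
      fix x
      have "\<bar>g x - c n x\<bar> \<le> 2 * C" using C[of x] cC[of n x] by linarith
      then show "norm (indicator {a..b} x * \<bar>g x - c n x\<bar>) \<le> indicator {a..b} x * (2 * C)"
        by (auto simp: indicator_def)
    qed
  qed (auto simp del: integral_zero)
  then have "\<forall>\<^sub>F n in sequentially. (LBINT x. indicator {a..b} x * \<bar>g x - c n x\<bar>) < e"
    using e by (intro order_tendstoD(2)) auto
  then obtain n where "(LBINT x. indicator {a..b} x * \<bar>g x - c n x\<bar>) < e"
    by (auto simp: eventually_sequentially)
  then show ?thesis using that[OF contc cC] by blast
qed

section \<open>Approximation by simple processes\<close>

text \<open>For k = 0 the block (-h, 0] lies in negative time, where a clamped process holds its
  value at time 0.\<close>

definition block_mean :: "real \<Rightarrow> (real \<Rightarrow> real) \<Rightarrow> nat \<Rightarrow> real" where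
  "block_mean h u k = (LBINT r. indicator {(real k - 1) * h<..real k * h} r * u r) / h"

text \<open>On the block \<open>(k h, (k + 1) h]\<close> this is the mean of \<open>u\<close> over the preceding block, which
  makes the approximation of a progressively measurable process adapted.\<close>

definition block_average :: "real \<Rightarrow> nat \<Rightarrow> (real \<Rightarrow> real) \<Rightarrow> real \<Rightarrow> real" where
  "block_average h n u s = (\<Sum>k<n. block_mean h u k * indicator {real k * h<..(real k + 1) * h} s)"

lemma sum_indicator_blocks:
  fixes x :: "nat \<Rightarrow> real"
  assumes "\<And>k. x k \<le> x (Suc k)"
  shows "(\<Sum>k<n. indicator {x k<..x (Suc k)} s :: real) = indicator {x 0<..x n} s"
proof (induction n)
  case (Suc n)
  have "x 0 \<le> x n" using assms lift_Suc_mono_le[of x 0 n] by simp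
  then show ?case using Suc assms[of n] by (auto simp: indicator_def)
qed simp

lemma sum_indicator_blocks_scaled:
  assumes "0 \<le> h"
  shows "(\<Sum>k<n. indicator {real k * h<..(real k + 1) * h} s :: real) = indicator {0<..real n * h} s"
    and "(\<Sum>k<n. indicator {(real k - 1) * h<..real k * h} s :: real) = indicator {- h<..(real n - 1) * h} s"
proof -
  have "(\<Sum>k<n. indicator {real k * h<..real (Suc k) * h} s :: real) = indicator {real 0 * h<..real n * h} s"
    using assms by (intro sum_indicator_blocks) (simp add: mult_right_mono)
  then show "(\<Sum>k<n. indicator {real k * h<..(real k + 1) * h} s :: real) = indicator {0<..real n * h} s"
    by (simp add: add.commute)
  have "(\<Sum>k<n. indicator {(real k - 1) * h<..(real (Suc k) - 1) * h} s :: real) =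
      indicator {(real 0 - 1) * h<..(real n - 1) * h} s"
    using assms by (intro sum_indicator_blocks) (simp add: mult_right_mono)
  then show "(\<Sum>k<n. indicator {(real k - 1) * h<..real k * h} s :: real) = indicator {- h<..(real n - 1) * h} s"
    by simp
qed

lemma bounded_integrable_Ioc:
  fixes u :: "real \<Rightarrow> real"
  assumes [measurable]: "u \<in> borel_measurable borel" and C: "\<And>x. \<bar>u x\<bar> \<le> C"
    and A: "A \<in> sets borel" "bounded A"
  shows "integrable lborel (\<lambda>x. indicator A x * u x)"
proof (rule Bochner_Integration.integrable_bound)
  show "integrable lborel (\<lambda>x. indicator A x * C)"
    using A emeasure_bounded_finite[OF A(2)] by (intro integrable_mult_left integrable_real_indicator) auto
  have "\<bar>u x\<bar> \<le> \<bar>C\<bar>" for x using C[of x] by linarith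
  then show "AE x in lborel. norm (indicator A x * u x) \<le> norm (indicator A x * C)"
    by (auto simp: indicator_def)
qed (use A in measurable)

context
  fixes h C :: real and u :: "real \<Rightarrow> real"
  assumes h: "0 < h" and u[measurable]: "u \<in> borel_measurable borel" and C: "\<And>x. \<bar>u x\<bar> \<le> C"
begin

text \<open>An average stays as close to m as all averaged values do. The centre is left free: m = 0
  gives boundedness, m = c s gives the approximation of continuous functions.\<close>

lemma block_mean_deviation:
  assumes "\<And>r. r \<in> {(real k - 1) * h<..real k * h} \<Longrightarrow> \<bar>u r - m\<bar> \<le> e"
  shows "\<bar>block_mean h u k - m\<bar> \<le> e"
proof -
  let ?J = "indicator {(real k - 1) * h<..real k * h} :: real \<Rightarrow> real"
  have len: "measure lborel {(real k - 1) * h<..real k * h} = h"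
    using h by (subst measure_lborel_Ioc) (auto simp: algebra_simps)
  have iJ: "integrable lborel (\<lambda>r. ?J r * c)" for c
    using bounded_integrable_Ioc[of "\<lambda>_. c" "\<bar>c\<bar>" "{(real k - 1) * h<..real k * h}"] by simp
  have LJ: "(LBINT r. ?J r * c) = h * c" for c
    using len by simp
  have iu: "integrable lborel (\<lambda>r. ?J r * u r)"
    by (rule bounded_integrable_Ioc[OF u C]) auto
  have "\<bar>LBINT r. ?J r * u r - ?J r * m\<bar> \<le> (LBINT r. \<bar>?J r * u r - ?J r * m\<bar>)"
    by (rule integral_abs_bound)
  also have "\<dots> \<le> (LBINT r. ?J r * e)"
    using assms by (intro integral_mono integrable_abs Bochner_Integration.integrable_diff iu iJ)
      (auto simp: indicator_def)
  finally have "\<bar>(LBINT r. ?J r * u r) - h * m\<bar> \<le> h * e"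
    by (simp only: Bochner_Integration.integral_diff[OF iu iJ] LJ)
  then have "\<bar>(LBINT r. ?J r * u r) - h * m\<bar> / h \<le> e"
    using h by (simp add: divide_le_eq mult.commute)
  moreover have "\<bar>(LBINT r. ?J r * u r) - h * m\<bar> / h = \<bar>((LBINT r. ?J r * u r) - h * m) / h\<bar>"
    using h by simp
  moreover have "((LBINT r. ?J r * u r) - h * m) / h = block_mean h u k - m"
    using h by (simp add: block_mean_def diff_divide_distrib)
  ultimately show ?thesis by simp
qed

lemma block_mean_bounded: "\<bar>block_mean h u k\<bar> \<le> C"
  using block_mean_deviation[of k 0 C] C by simp

text \<open>The block indicators sum to 1 on (0, n h], so m can be subtracted inside the
  sum.\<close>

lemma block_average_deviation:
  assumes s: "0 < s" "s \<le> real n * h"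
    and e: "\<And>k. k < n \<Longrightarrow> s \<in> {real k * h<..(real k + 1) * h} \<Longrightarrow> \<bar>block_mean h u k - m\<bar> \<le> e"
  shows "\<bar>block_average h n u s - m\<bar> \<le> e"
proof -
  let ?I = "\<lambda>k. indicator {real k * h<..(real k + 1) * h} s :: real"
  have one: "(\<Sum>k<n. ?I k) = 1"
    using sum_indicator_blocks_scaled(1)[where h = h and n = n and s = s] h s by simp
  have "block_average h n u s - m = (\<Sum>k<n. block_mean h u k * ?I k) - m * (\<Sum>k<n. ?I k)"
    by (simp add: block_average_def one)
  then have "block_average h n u s - m = (\<Sum>k<n. (block_mean h u k - m) * ?I k)"
    by (simp add: sum_distrib_left sum_subtractf left_diff_distrib)
  then have "\<bar>block_average h n u s - m\<bar> \<le> (\<Sum>k<n. \<bar>(block_mean h u k - m) * ?I k\<bar>)"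
    by (simp only: sum_abs)
  also have "\<dots> \<le> (\<Sum>k<n. e * ?I k)"
    using e by (intro sum_mono) (auto simp: indicator_def)
  also have "\<dots> = e" by (simp add: one flip: sum_distrib_left)
  finally show ?thesis .
qed

lemma block_average_outside: "s \<notin> {0<..real n * h} \<Longrightarrow> block_average h n u s = 0"
proof -
  assume s: "s \<notin> {0<..real n * h}"
  have "indicator {real k * h<..(real k + 1) * h} s = (0::real)" if "k < n" for k
  proof -
    have "(real k + 1) * h \<le> real n * h" using h that by (intro mult_right_mono) auto
    moreover have "0 \<le> real k * h" using h by simp
    ultimately show ?thesis using s by (auto simp: indicator_def)
  qed
  then show ?thesis by (simp add: block_average_def)
qed

lemma block_average_bounded: "\<bar>block_average h n u s\<bar> \<le> C"
proof (cases "s \<in> {0<..real n * h}")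
  case True
  then show ?thesis
    using block_average_deviation[of s n 0 C] block_mean_bounded by simp
next
  case False
  then show ?thesis using C[of 0] by (simp add: block_average_outside)
qed

lemma block_average_measurable: "block_average h n u \<in> borel_measurable borel"
  unfolding block_average_def[abs_def] by measurable

text \<open>Each block contributes at most the integral of \<bar>u\<bar> over its predecessor, and
  the predecessors are disjoint. This stability reduces convergence for measurable functions to the
  continuous case.\<close>

lemma block_average_L1_contraction:
  "(LBINT s. indicator {0..real n * h} s * \<bar>block_average h n u s\<bar>) \<le>
    (LBINT s. indicator {- (real n * h)..real n * h} s * \<bar>u s\<bar>)"
proof (cases "n = 0")
  case False
  let ?I = "\<lambda>k s. indicator {real k * h<..(real k + 1) * h} s :: real"
  let ?J = "\<lambda>k s. indicator {(real k - 1) * h<..real k * h} s :: real"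
  have iI: "integrable lborel (\<lambda>s. c * ?I k s)" for c k
    using bounded_integrable_Ioc[of "\<lambda>_. c" "\<bar>c\<bar>" "{real k * h<..(real k + 1) * h}"]
    by (simp add: mult.commute)
  have LI: "(LBINT s. c * ?I k s) = c * h" for c k
    using h by (simp add: measure_lborel_Ioc algebra_simps)
  have abs_u: "(\<lambda>x. \<bar>u x\<bar>) \<in> borel_measurable borel" "\<bar>\<bar>u x\<bar>\<bar> \<le> C" for x using C by auto
  have iJ: "integrable lborel (\<lambda>s. ?J k s * u s)" "integrable lborel (\<lambda>s. ?J k s * \<bar>u s\<bar>)" for k
    by (rule bounded_integrable_Ioc[OF u C] bounded_integrable_Ioc[OF abs_u], auto)+
  have iA: "integrable lborel (\<lambda>s. indicator {- (real n * h)..real n * h} s * \<bar>u s\<bar>)"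
    by (rule bounded_integrable_Ioc[OF abs_u]) auto
  have iB: "integrable lborel (\<lambda>s. indicator {0..real n * h} s * \<bar>block_average h n u s\<bar>)"
    by (rule bounded_integrable_Ioc[of _ C]) (use block_average_bounded block_average_measurable in auto)
  have "(LBINT s. indicator {0..real n * h} s * \<bar>block_average h n u s\<bar>) \<le>
      (LBINT s. (\<Sum>k<n. \<bar>block_mean h u k\<bar> * ?I k s))"
  proof (intro integral_mono iB Bochner_Integration.integrable_sum iI)
    fix s
    have "\<bar>block_average h n u s\<bar> \<le> (\<Sum>k<n. \<bar>block_mean h u k * ?I k s\<bar>)"
      unfolding block_average_def by (rule sum_abs)
    also have "\<dots> = (\<Sum>k<n. \<bar>block_mean h u k\<bar> * ?I k s)" by (simp add: abs_mult)
    finally show "indicator {0..real n * h} s * \<bar>block_average h n u s\<bar> \<le> (\<Sum>k<n. \<bar>block_mean h u k\<bar> * ?I k s)"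
      by (auto simp: indicator_def[of "{0..real n * h}"] intro: sum_nonneg)
  qed
  also have "\<dots> = (\<Sum>k<n. \<bar>block_mean h u k\<bar> * h)"
    using iI by (simp only: Bochner_Integration.integral_sum LI)
  also have "\<dots> = (\<Sum>k<n. \<bar>LBINT r. ?J k r * u r\<bar>)"
    using h by (simp add: block_mean_def)
  also have "\<dots> \<le> (\<Sum>k<n. LBINT r. ?J k r * \<bar>u r\<bar>)"
  proof (intro sum_mono)
    fix k
    have "\<bar>LBINT r. ?J k r * u r\<bar> \<le> (LBINT r. \<bar>?J k r * u r\<bar>)" by (rule integral_abs_bound)
    then show "\<bar>LBINT r. ?J k r * u r\<bar> \<le> (LBINT r. ?J k r * \<bar>u r\<bar>)" by (simp add: abs_mult)
  qed
  also have "\<dots> = (LBINT r. (\<Sum>k<n. ?J k r * \<bar>u r\<bar>))"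
    using iJ by (intro Bochner_Integration.integral_sum[symmetric]) auto
  also have "\<dots> \<le> (LBINT s. indicator {- (real n * h)..real n * h} s * \<bar>u s\<bar>)"
  proof (intro integral_mono iA Bochner_Integration.integrable_sum iJ)
    fix r
    \<comment> \<open>For n \<ge> 1 the preceding blocks, which reach back to -h, fit into the
      symmetric interval.\<close>
    have "1 * h \<le> real n * h" using False h by (intro mult_right_mono) auto
    then have "r \<in> {- (real n * h)..real n * h}" if "r \<in> {- h<..(real n - 1) * h}"
      using h that unfolding left_diff_distrib greaterThanAtMost_iff atLeastAtMost_iff by linarith
    then have "indicator {- h<..(real n - 1) * h} r \<le> (indicator {- (real n * h)..real n * h} r :: real)"
      by (simp add: indicator_def del: greaterThanAtMost_iff atLeastAtMost_iff)
    then show "(\<Sum>k<n. ?J k r * \<bar>u r\<bar>) \<le> indicator {- (real n * h)..real n * h} r * \<bar>u r\<bar>"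
      using sum_indicator_blocks_scaled(2)[where h = h and n = n and s = r] h
      by (simp add: mult_right_mono flip: sum_distrib_right)
  qed
  finally show ?thesis .
qed (simp add: block_average_def)

end

lemma block_average_diff:
  assumes h: "0 < h" and u: "u \<in> borel_measurable borel" "\<And>x. \<bar>u x\<bar> \<le> C"
    and v: "v \<in> borel_measurable borel" "\<And>x. \<bar>v x\<bar> \<le> D"
  shows "block_average h n (\<lambda>x. u x - v x) s = block_average h n u s - block_average h n v s"
proof -
  have "block_mean h (\<lambda>x. u x - v x) k = block_mean h u k - block_mean h v k" for k
  proof -
    let ?J = "indicator {(real k - 1) * h<..real k * h} :: real \<Rightarrow> real"
    have "(LBINT r. ?J r * (u r - v r)) = (LBINT r. ?J r * u r) - (LBINT r. ?J r * v r)"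
      unfolding right_diff_distrib
      by (intro Bochner_Integration.integral_diff bounded_integrable_Ioc[OF u] bounded_integrable_Ioc[OF v]) auto
    then show ?thesis by (simp add: block_mean_def diff_divide_distrib)
  qed
  then show ?thesis by (simp add: block_average_def left_diff_distrib sum_subtractf)
qed

lemma block_average_continuous:
  assumes h: "0 < h" and c: "continuous_on UNIV c" "\<And>x. \<bar>c x\<bar> \<le> C"
    and e: "\<And>x y. x \<in> {- (real n * h)..real n * h} \<Longrightarrow> y \<in> {- (real n * h)..real n * h} \<Longrightarrow>
      \<bar>x - y\<bar> \<le> 2 * h \<Longrightarrow> \<bar>c x - c y\<bar> \<le> e"
    and s: "0 < s" "s \<le> real n * h"
  shows "\<bar>block_average h n c s - c s\<bar> \<le> e"
proof -
  have m: "c \<in> borel_measurable borel" using c(1) by (rule borel_measurable_continuous_onI)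
  show ?thesis
  proof (rule block_average_deviation[OF h m c(2) s])
    fix k assume k: "k < n" "s \<in> {real k * h<..(real k + 1) * h}"
    show "\<bar>block_mean h c k - c s\<bar> \<le> e"
    proof (rule block_mean_deviation[OF h m c(2)])
      fix r assume r: "r \<in> {(real k - 1) * h<..real k * h}"
      have kn: "(real k + 1) * h \<le> real n * h" using k h by (intro mult_right_mono) auto
      moreover have "0 \<le> real k * h" using h by simp
      ultimately have "1 * h \<le> real n * h" by (simp add: algebra_simps)
      show "\<bar>c r - c s\<bar> \<le> e"
      proof (rule e)
        show "r \<in> {- (real n * h)..real n * h}" "s \<in> {- (real n * h)..real n * h}"
          using r k(2) kn \<open>0 \<le> real k * h\<close> \<open>1 * h \<le> real n * h\<close> h
          unfolding left_diff_distrib distrib_right greaterThanAtMost_iff atLeastAtMost_iff by linarith+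
        \<comment> \<open>r and s lie in adjacent blocks, each of length h.\<close>
        show "\<bar>r - s\<bar> \<le> 2 * h" using r k(2) by (auto simp: algebra_simps abs_le_iff)
      qed
    qed
  qed
qed

text \<open>With A the averaging and c continuous and L^1-close to g on [-t, t], split A g - g into
  A (g - c), A c - c and c - g. The first is controlled by the contraction, the second by uniform
  continuity of c, the third by the choice of c.\<close>

lemma block_average_tendsto_L1:
  assumes t: "0 < t" and g[measurable]: "g \<in> borel_measurable borel" and C: "\<And>x. \<bar>g x\<bar> \<le> C"
  shows "(\<lambda>n. LBINT s. indicator {0..t} s * \<bar>block_average (t / Suc n) (Suc n) g s - g s\<bar>) \<longlonglongrightarrow> 0"
proof (rule LIMSEQ_I)
  fix e :: real assume e: "0 < e"
  \<comment> \<open>The three errors are at most d, d t and d; their sum stays below 3 d (t + 1) =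
    e.\<close>
  define d where "d = e / (3 * (t + 1))"
  have d: "0 < d" using e t by (simp add: d_def)
  have d_e: "d + d * t + d < e"
  proof -
    have "0 < d + 2 * (d * t)" using d t by (intro add_pos_pos) auto
    then have "d + d * t + d < d * (3 * (t + 1))" by (simp add: algebra_simps)
    also have "\<dots> = e" using t by (simp add: d_def)
    finally show ?thesis .
  qed
  obtain c where c: "continuous_on UNIV c" "\<And>x. \<bar>c x\<bar> \<le> C"
    and close: "(LBINT x. indicator {- t..t} x * \<bar>g x - c x\<bar>) < d"
    using bounded_approximated_by_continuous_L1[OF g C d] by blast
  have mc[measurable]: "c \<in> borel_measurable borel" using c(1) by (rule borel_measurable_continuous_onI)
  have "uniformly_continuous_on {- t..t} c"
    using c(1) by (intro compact_uniformly_continuous continuous_on_subset[OF c(1)]) auto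
  then obtain \<delta> where \<delta>: "0 < \<delta>"
    and unif: "\<And>x y. x \<in> {- t..t} \<Longrightarrow> y \<in> {- t..t} \<Longrightarrow> \<bar>x - y\<bar> < \<delta> \<Longrightarrow> \<bar>c x - c y\<bar> < d"
    using d unfolding uniformly_continuous_on_def dist_real_def by metis
  obtain N where N: "2 * t / \<delta> < real N" using reals_Archimedean2 by blast
  have "norm ((LBINT s. indicator {0..t} s * \<bar>block_average (t / Suc n) (Suc n) g s - g s\<bar>) - 0) < e"
    if n: "n \<ge> N" for n
  proof -
    define h where "h = t / Suc n"
    have h: "0 < h" and nh: "real (Suc n) * h = t" using t by (auto simp: h_def)
    have "2 * t / \<delta> < real (Suc n)" using N n by simp
    then have h2: "2 * h < \<delta>" using \<delta> by (simp add: h_def field_simps)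
    let ?A = "block_average h (Suc n)"
    have diff: "\<bar>g x - c x\<bar> \<le> 2 * C" for x using C[of x] c(2)[of x] by linarith
    have mdiff: "(\<lambda>x. g x - c x) \<in> borel_measurable borel" by measurable
    have [measurable]: "?A g \<in> borel_measurable borel" "?A (\<lambda>x. g x - c x) \<in> borel_measurable borel"
      by (rule block_average_measurable[OF h g C] block_average_measurable[OF h mdiff diff])+
    have le: "\<bar>?A g s - g s\<bar> \<le> \<bar>?A (\<lambda>x. g x - c x) s\<bar> + d + \<bar>g s - c s\<bar>" if s: "s \<in> {0<..t}" for s
    proof -
      have "\<bar>?A c s - c s\<bar> \<le> d"
      proof (rule block_average_continuous[OF h c])
        fix x y assume "x \<in> {- (real (Suc n) * h)..real (Suc n) * h}" "y \<in> {- (real (Suc n) * h)..real (Suc n) * h}"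
          "\<bar>x - y\<bar> \<le> 2 * h"
        then show "\<bar>c x - c y\<bar> \<le> d" using unif[of x y] h2 unfolding nh by simp
      qed (use s in \<open>simp_all only: nh greaterThanAtMost_iff\<close>)
      then show ?thesis
        using block_average_diff[OF h g C mc c(2), of "Suc n" s] by linarith
    qed
    have i1: "integrable lborel (\<lambda>s. indicator {0..t} s * \<bar>?A g s - g s\<bar>)"
    proof (rule bounded_integrable_Ioc[where C = "2 * C"])
      show "\<bar>\<bar>?A g s - g s\<bar>\<bar> \<le> 2 * C" for s
        using block_average_bounded[OF h g C, of "Suc n" s] C[of s] by linarith
    qed auto
    have i2: "integrable lborel (\<lambda>s. indicator {0..t} s * \<bar>?A (\<lambda>x. g x - c x) s\<bar>)"
      by (rule bounded_integrable_Ioc[where C = "2 * C"])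
        (use block_average_bounded[OF h mdiff diff] in auto)
    have i3: "integrable lborel (\<lambda>s. indicator {0..t} s * d)"
      by (rule bounded_integrable_Ioc[where C = d]) (use d in auto)
    have i4: "integrable lborel (\<lambda>s. indicator {- t..t} s * \<bar>g s - c s\<bar>)"
      by (rule bounded_integrable_Ioc[where C = "2 * C"]) (use diff in auto)
    have "(LBINT s. indicator {0..t} s * \<bar>?A g s - g s\<bar>) \<le>
        (LBINT s. indicator {0..t} s * \<bar>?A (\<lambda>x. g x - c x) s\<bar> + indicator {0..t} s * d + indicator {- t..t} s * \<bar>g s - c s\<bar>)"
    proof (rule integral_mono_AE)
      \<comment> \<open>Time 0 belongs to no left-open block, so the pointwise estimate is available
        on (0, t] only.\<close>
      show "AE s in lborel. indicator {0..t} s * \<bar>?A g s - g s\<bar> \<le>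
          indicator {0..t} s * \<bar>?A (\<lambda>x. g x - c x) s\<bar> + indicator {0..t} s * d + indicator {- t..t} s * \<bar>g s - c s\<bar>"
        using AE_lborel_singleton[of "0::real"]
      proof eventually_elim
        case (elim s)
        show ?case
        proof (cases "s \<in> {0<..t}")
          case True
          then show ?thesis using le[OF True] t by simp
        next
          case False
          then have "s \<notin> {0..t}" using elim by auto
          then show ?thesis by simp
        qed
      qed
    qed (intro i1 i2 i3 i4 Bochner_Integration.integrable_add)+
    also have "\<dots> = (LBINT s. indicator {0..t} s * \<bar>?A (\<lambda>x. g x - c x) s\<bar>) + (LBINT s. indicator {0..t} s * d) +
        (LBINT s. indicator {- t..t} s * \<bar>g s - c s\<bar>)"
      by (simp only: Bochner_Integration.integral_add i2 i3 i4 Bochner_Integration.integrable_add)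
    also have "\<dots> \<le> d + d * t + d"
    proof (intro add_mono)
      show "(LBINT s. indicator {0..t} s * \<bar>?A (\<lambda>x. g x - c x) s\<bar>) \<le> d"
        using block_average_L1_contraction[OF h mdiff diff, of "Suc n"] close unfolding nh by linarith
      show "(LBINT s. indicator {0..t} s * d) \<le> d * t" using t by simp
      show "(LBINT s. indicator {- t..t} s * \<bar>g s - c s\<bar>) \<le> d" using close by simp
    qed
    finally have "(LBINT s. indicator {0..t} s * \<bar>?A g s - g s\<bar>) < e" using d_e by linarith
    moreover have "0 \<le> (LBINT s. indicator {0..t} s * \<bar>?A g s - g s\<bar>)"
      by (intro integral_nonneg_AE) auto
    ultimately show ?thesis by (simp only: h_def[symmetric] diff_0_right real_norm_def abs_of_nonneg)
  qed
  then show "\<exists>N. \<forall>n\<ge>N. norm ((LBINT s. indicator {0..t} s * \<bar>block_average (t / Suc n) (Suc n) g s - g s\<bar>) - 0) < e"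
    by blast
qed

section \<open>Adapted step approximations of bounded controls\<close>

context brownian_setup
begin

definition average_process :: "real \<Rightarrow> (real \<Rightarrow> 'a \<Rightarrow> real) \<Rightarrow> nat \<Rightarrow> 'a simple_process" where
  "average_process t \<sigma> n = map (\<lambda>k. (real k * (t / n), (real k + 1) * (t / n),
      \<lambda>\<omega>. block_mean (t / n) (\<lambda>s. clamp_process t \<sigma> s \<omega>) k)) [0..<n]"

lemma simple_value_average_process:
  "simple_value (average_process t \<sigma> n) s \<omega> = block_average (t / n) n (\<lambda>s. clamp_process t \<sigma> s \<omega>) s"
  by (simp add: simple_value_def average_process_def block_average_def comp_def
      interv_sum_list_conv_sum_set_nat atLeast0LessThan)

context
  fixes t C :: real and \<sigma> :: "real \<Rightarrow> 'a \<Rightarrow> real"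
  assumes t: "0 < t" and \<sigma>: "progressively_measurable F \<sigma>"
    and C: "\<And>s \<omega>. 0 \<le> s \<Longrightarrow> \<omega> \<in> space M \<Longrightarrow> \<bar>\<sigma> s \<omega>\<bar> \<le> C"
begin

lemma clamp_process_bounded: "\<omega> \<in> space M \<Longrightarrow> \<bar>clamp_process t \<sigma> s \<omega>\<bar> \<le> C"
  unfolding clamp_process_def by (rule C) auto

lemma clamp_process_section_measurable:
  "\<omega> \<in> space M \<Longrightarrow> (\<lambda>s. clamp_process t \<sigma> s \<omega>) \<in> borel_measurable borel"
proof -
  assume "\<omega> \<in> space M"
  then have "(\<lambda>s. (s, \<omega>)) \<in> borel \<rightarrow>\<^sub>M borel \<Otimes>\<^sub>M F t" by (intro measurable_Pair) auto
  from measurable_compose[OF this clamp_process_measurable_F[OF \<sigma>]] show ?thesis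
    using t by simp
qed

text \<open>On the block before T = k h, clamping at T and clamping at t agree. The mean can thus be
  computed from the process clamped at T, which is jointly measurable with respect to
  \<open>F T\<close>, and Fubini makes the mean \<open>F T\<close>-measurable.\<close>

lemma simple_process_average_process:
  assumes n: "0 < n"
  shows "simple_process M F (average_process t \<sigma> n)"
proof -
  define h where "h = t / n"
  have h: "0 < h" using t n by (simp add: h_def)
  have "(\<lambda>\<omega>. block_mean h (\<lambda>s. clamp_process t \<sigma> s \<omega>) k) \<in> borel_measurable (F (real k * h))"
    if k: "k < n" for k
  proof -
    let ?T = "real k * h"
    have T: "0 \<le> ?T" "?T \<le> t"
    proof -
      have "?T \<le> real n * h" using h k by (intro mult_right_mono) auto
      then show "?T \<le> t" using n by (simp add: h_def)
    qed (use h in simp)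
    have "(\<lambda>p. (\<lambda>(s, \<omega>). clamp_process ?T \<sigma> s \<omega>) (snd p, fst p)) \<in> borel_measurable (F ?T \<Otimes>\<^sub>M lborel)"
    proof (rule measurable_compose[OF _ clamp_process_measurable_F[OF \<sigma> T(1)]])
      show "(\<lambda>p. (snd p, fst p)) \<in> F ?T \<Otimes>\<^sub>M lborel \<rightarrow>\<^sub>M borel \<Otimes>\<^sub>M F ?T"
        by measurable
    qed
    then have "(\<lambda>(\<omega>, s). indicator {(real k - 1) * h<..?T} s * clamp_process ?T \<sigma> s \<omega>)
        \<in> borel_measurable (F ?T \<Otimes>\<^sub>M lborel)"
      by (simp add: split_beta)
    then have "(\<lambda>\<omega>. LBINT s. indicator {(real k - 1) * h<..?T} s * clamp_process ?T \<sigma> s \<omega>)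
        \<in> borel_measurable (F ?T)"
      by (rule lborel.borel_measurable_lebesgue_integral)
    moreover have "indicator {(real k - 1) * h<..?T} s * clamp_process ?T \<sigma> s \<omega> =
        indicator {(real k - 1) * h<..?T} s * clamp_process t \<sigma> s \<omega>" for s \<omega>
      using T by (auto simp: indicator_def clamp_process_def)
    ultimately show ?thesis
      unfolding block_mean_def by simp
  qed
  moreover have "\<bar>block_mean h (\<lambda>s. clamp_process t \<sigma> s \<omega>) k\<bar> \<le> C" if "\<omega> \<in> space M" for \<omega> k
    using block_mean_bounded[OF h clamp_process_section_measurable[OF that] clamp_process_bounded[OF that]] .
  ultimately show ?thesis
    using h unfolding simple_process_def average_process_def h_def[symmetric]
    by (auto simp: bounded_iff intro!: mult_right_mono)
qed

text \<open>Path by path the averages converge in L^1, and since the differences are bounded by 2 C,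
  their squares are at most 2 C times their absolute values. Dominated convergence then handles the
  expectation.\<close>

lemma average_process_tendsto:
  "(\<lambda>n. process_dist M t (simple_value (average_process t \<sigma> (Suc n))) \<sigma>) \<longlonglongrightarrow> 0"
proof -
  let ?g = "\<lambda>\<omega> s. clamp_process t \<sigma> s \<omega>"
  let ?A = "\<lambda>n \<omega> s. block_average (t / Suc n) (Suc n) (?g \<omega>) s"
  let ?D = "\<lambda>n \<omega>. \<integral>\<^sup>+s\<in>{0..t}. ennreal ((?A n \<omega> s - ?g \<omega> s)\<^sup>2) \<partial>lborel"
  have eq: "process_dist M t (simple_value (average_process t \<sigma> (Suc n))) \<sigma> = (\<integral>\<^sup>+\<omega>. ?D n \<omega> \<partial>M)" for n
    using process_dist_clamp[of t "simple_value (average_process t \<sigma> (Suc n))" \<sigma>] t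
    by (simp add: process_dist_def simple_value_average_process)
  have h: "0 < t / real (Suc n)" for n using t by simp
  have bound: "\<bar>?A n \<omega> s - ?g \<omega> s\<bar> \<le> 2 * C" if \<omega>: "\<omega> \<in> space M" for n \<omega> s
    using block_average_bounded[OF h clamp_process_section_measurable[OF \<omega>] clamp_process_bounded[OF \<omega>], of n "Suc n" s]
      clamp_process_bounded[OF \<omega>, of s] by linarith
  have L1: "?D n \<omega> \<le> ennreal (2 * C * (LBINT s. indicator {0..t} s * \<bar>?A n \<omega> s - ?g \<omega> s\<bar>))"
    if \<omega>: "\<omega> \<in> space M" for n \<omega>
  proof -
    have m[measurable]: "?A n \<omega> \<in> borel_measurable borel" "?g \<omega> \<in> borel_measurable borel"
      using block_average_measurable[OF h clamp_process_section_measurable[OF \<omega>] clamp_process_bounded[OF \<omega>]]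
        clamp_process_section_measurable[OF \<omega>] by auto
    have i: "integrable lborel (\<lambda>s. indicator {0..t} s * \<bar>?A n \<omega> s - ?g \<omega> s\<bar>)"
    proof (rule bounded_integrable_Ioc[where C = "2 * C"])
      show "(\<lambda>s. \<bar>?A n \<omega> s - ?g \<omega> s\<bar>) \<in> borel_measurable borel" by measurable
      show "\<bar>\<bar>?A n \<omega> s - ?g \<omega> s\<bar>\<bar> \<le> 2 * C" for s unfolding abs_idempotent by (rule bound[OF \<omega>])
    qed auto
    have "?D n \<omega> \<le> (\<integral>\<^sup>+s. ennreal (2 * C * (indicator {0..t} s * \<bar>?A n \<omega> s - ?g \<omega> s\<bar>)) \<partial>lborel)"
    proof (intro nn_integral_mono)
      fix s
      have "(?A n \<omega> s - ?g \<omega> s)\<^sup>2 = \<bar>?A n \<omega> s - ?g \<omega> s\<bar> * \<bar>?A n \<omega> s - ?g \<omega> s\<bar>"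
        by (simp add: power2_eq_square)
      also have "\<dots> \<le> 2 * C * \<bar>?A n \<omega> s - ?g \<omega> s\<bar>"
        by (intro mult_right_mono bound \<omega>) simp
      finally show "ennreal ((?A n \<omega> s - ?g \<omega> s)\<^sup>2) * indicator {0..t} s \<le>
          ennreal (2 * C * (indicator {0..t} s * \<bar>?A n \<omega> s - ?g \<omega> s\<bar>))"
        by (simp add: indicator_def ennreal_leI)
    qed
    also have "\<dots> = ennreal (LBINT s. 2 * C * (indicator {0..t} s * \<bar>?A n \<omega> s - ?g \<omega> s\<bar>))"
    proof (rule nn_integral_eq_integral)
      have "0 \<le> 2 * C" using bound[OF \<omega>, of 0 0] by linarith
      then show "AE s in lborel. 0 \<le> 2 * C * (indicator {0..t} s * \<bar>?A n \<omega> s - ?g \<omega> s\<bar>)" by simp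
    qed (rule integrable_mult_right[OF i])
    finally show ?thesis by simp
  qed
  have "(\<lambda>n. \<integral>\<^sup>+\<omega>. ?D n \<omega> \<partial>M) \<longlonglongrightarrow> (\<integral>\<^sup>+\<omega>. 0 \<partial>M)"
  proof (rule nn_integral_dominated_convergence[where w = "\<lambda>_. ennreal ((2 * C)\<^sup>2 * t)"])
    show "?D n \<in> borel_measurable M" for n
    proof -
      have "(\<lambda>(\<omega>, s). ennreal ((simple_value (average_process t \<sigma> (Suc n)) s \<omega> - ?g \<omega> s)\<^sup>2))
          \<in> borel_measurable (M \<Otimes>\<^sub>M lborel)"
        using t by (intro square_diff_measurable jointly_measurable_simple_value simple_process_average_process
            jointly_measurable_clamp_process \<sigma>) auto
      then have "(\<lambda>(\<omega>, s). ennreal ((simple_value (average_process t \<sigma> (Suc n)) s \<omega> - ?g \<omega> s)\<^sup>2) * indicator {0..t} s)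
          \<in> borel_measurable (M \<Otimes>\<^sub>M lborel)"
        by (simp add: split_beta)
      from lborel.borel_measurable_nn_integral[OF this] show ?thesis
        by (simp only: simple_value_average_process)
    qed
    show "AE \<omega> in M. ?D n \<omega> \<le> ennreal ((2 * C)\<^sup>2 * t)" for n
    proof (intro AE_I2)
      fix \<omega> assume \<omega>: "\<omega> \<in> space M"
      have "?D n \<omega> \<le> (\<integral>\<^sup>+s. ennreal ((2 * C)\<^sup>2) * indicator {0..t} s \<partial>lborel)"
      proof (intro nn_integral_mono mult_right_mono ennreal_leI)
        show "(?A n \<omega> s - ?g \<omega> s)\<^sup>2 \<le> (2 * C)\<^sup>2" for s
          using power_mono[OF bound[OF \<omega>, of n s], of 2] by simp
      qed simp
      also have "\<dots> = ennreal ((2 * C)\<^sup>2 * t)"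
        using t by (simp add: nn_integral_cmult ennreal_mult)
      finally show "?D n \<omega> \<le> ennreal ((2 * C)\<^sup>2 * t)" .
    qed
    show "(\<integral>\<^sup>+\<omega>. ennreal ((2 * C)\<^sup>2 * t) \<partial>M) < \<infinity>"
      by (simp add: emeasure_space_1)
    show "AE \<omega> in M. (\<lambda>n. ?D n \<omega>) \<longlonglongrightarrow> 0"
    proof (intro AE_I2)
      fix \<omega> assume \<omega>: "\<omega> \<in> space M"
      have "(\<lambda>n. 2 * C * (LBINT s. indicator {0..t} s * \<bar>?A n \<omega> s - ?g \<omega> s\<bar>)) \<longlonglongrightarrow> 2 * C * 0"
        by (intro tendsto_mult_left block_average_tendsto_L1[OF t clamp_process_section_measurable[OF \<omega>] clamp_process_bounded[OF \<omega>]])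
      then have "(\<lambda>n. ennreal (2 * C * (LBINT s. indicator {0..t} s * \<bar>?A n \<omega> s - ?g \<omega> s\<bar>))) \<longlonglongrightarrow> ennreal (2 * C * 0)"
        by (rule tendsto_ennrealI)
      then have lim: "(\<lambda>n. ennreal (2 * C * (LBINT s. indicator {0..t} s * \<bar>?A n \<omega> s - ?g \<omega> s\<bar>))) \<longlonglongrightarrow> 0"
        unfolding mult_zero_right ennreal_0 .
      show "(\<lambda>n. ?D n \<omega>) \<longlonglongrightarrow> 0"
      proof (rule tendsto_sandwich[OF _ _ tendsto_const lim])
        show "\<forall>\<^sub>F n in sequentially. 0 \<le> ?D n \<omega>" by (intro always_eventually allI zero_le)
        show "\<forall>\<^sub>F n in sequentially. ?D n \<omega> \<le> ennreal (2 * C * (LBINT s. indicator {0..t} s * \<bar>?A n \<omega> s - ?g \<omega> s\<bar>))"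
          by (intro always_eventually allI L1 \<omega>)
      qed
    qed
  qed auto
  then show ?thesis unfolding eq by simp
qed

theorem ito_integral_exists: "\<exists>X. is_ito_integral M F W \<sigma> t X"
  using t by (intro ito_integral_exists_of_approximation[OF \<sigma> _ _ average_process_tendsto] simple_process_average_process) auto

end

end

section \<open>The symmetric Lipschitz set\<close>

lemma lipschitz_set_iff:
  "f \<in> lipschitz_set S \<longleftrightarrow>
    f \<in> BUC \<and> (\<exists>h0>0. \<exists>C\<ge>0. \<forall>h\<in>{0<..h0}. \<forall>x. \<bar>S h f x - f x\<bar> \<le> C * h)"
proof -
  have "(SUP h\<in>{0<..h0}. sup_norm (\<lambda>x. (S h f x - f x) / h)) < \<infinity> \<longleftrightarrow>
      (\<exists>C\<ge>0. \<forall>h\<in>{0<..h0}. \<forall>x. \<bar>S h f x - f x\<bar> \<le> C * h)" (is "?s < \<infinity> \<longleftrightarrow> ?R") for h0 :: real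
  proof
    assume fin: "?s < \<infinity>"
    show ?R
    proof (intro exI[of _ "enn2real ?s"] conjI ballI allI)
      fix h x assume h: "h \<in> {0<..h0}"
      have "ennreal \<bar>(S h f x - f x) / h\<bar> \<le> sup_norm (\<lambda>x. (S h f x - f x) / h)"
        unfolding sup_norm_def by (rule SUP_upper) simp
      also have "\<dots> \<le> ?s" using h by (rule SUP_upper)
      also have "?s = ennreal (enn2real ?s)" using fin by simp
      finally have "\<bar>(S h f x - f x) / h\<bar> \<le> enn2real ?s" by (simp add: ennreal_le_iff)
      then show "\<bar>S h f x - f x\<bar> \<le> enn2real ?s * h" using h by (simp add: divide_le_eq)
    qed simp
  next
    assume ?R
    then obtain C where C: "0 \<le> C" "\<And>h x. h \<in> {0<..h0} \<Longrightarrow> \<bar>S h f x - f x\<bar> \<le> C * h" by blast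
    have "?s \<le> ennreal C"
      unfolding sup_norm_def
    proof (intro SUP_least ennreal_leI)
      fix h x assume h: "h \<in> {0<..h0}"
      show "\<bar>(S h f x - f x) / h\<bar> \<le> C" using C(2)[OF h, of x] h by (simp add: divide_le_eq)
    qed
    then show "?s < \<infinity>" by (rule le_less_trans) simp
  qed
  then show ?thesis by (auto simp: lipschitz_set_def)
qed

lemma BUC_D:
  assumes "f \<in> BUC"
  obtains B where "continuous_on UNIV f" "\<And>x. \<bar>f x\<bar> \<le> B"
  using assms by (auto simp: BUC_def bounded_iff intro: uniformly_continuous_imp_continuous)

lemma uminus_BUC: "f \<in> BUC \<Longrightarrow> (\<lambda>x. - f x) \<in> BUC"
  by (auto simp: BUC_def bounded_iff intro: uniformly_continuous_on_minus)

lemma C11_uminus: "C11 K f D \<Longrightarrow> C11 K (\<lambda>x. - f x) (\<lambda>x. - D x)"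
  unfolding C11_def by (simp add: abs_le_iff algebra_simps)

section \<open>Expectations under admissible controls and the semigroup\<close>

context brownian_setup
begin

lemma admissible_bound:
  assumes "\<sigma> \<in> admissible_controls M F \<sigma>l \<sigma>u" "0 \<le> \<sigma>l" "0 \<le> s" "\<omega> \<in> space M"
  shows "\<bar>\<sigma> s \<omega>\<bar> \<le> \<sigma>u"
proof -
  have "\<sigma> s \<omega> \<in> {\<sigma>l..\<sigma>u}" using assms by (simp add: admissible_controls_def)
  then show ?thesis using assms(2) by simp
qed

text \<open>Existence for bounded progressively measurable integrands turns the choice in
  \<open>ito_integral\<close> into an actual Ito integral.\<close>

lemma ito_integral_correct:
  assumes "\<sigma> \<in> admissible_controls M F \<sigma>l \<sigma>u" "0 \<le> \<sigma>l" "0 < t"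
  shows "is_ito_integral M F W \<sigma> t (ito_integral M F W \<sigma> t)"
proof -
  have "\<exists>X. is_ito_integral M F W \<sigma> t X"
    using assms(1,3) admissible_bound[OF assms(1,2)]
    by (intro ito_integral_exists[where C = \<sigma>u]) (auto simp: admissible_controls_def)
  then show ?thesis unfolding ito_integral_def by (rule someI_ex)
qed

lemma const_admissible: "\<sigma>l \<le> c \<Longrightarrow> c \<le> \<sigma>u \<Longrightarrow> (\<lambda>_ _. c) \<in> admissible_controls M F \<sigma>l \<sigma>u"
  by (auto simp: admissible_controls_def progressively_measurable_def)

lemma integrable_bounded_continuous:
  fixes f :: "real \<Rightarrow> real"
  assumes "continuous_on UNIV f" "\<And>x. \<bar>f x\<bar> \<le> B" and X: "X \<in> borel_measurable M"
  shows "integrable M (\<lambda>\<omega>. f (x + X \<omega>))"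
proof (rule integrable_const_bound[where B = B])
  have "f \<in> borel_measurable borel" using assms(1) by (rule borel_measurable_continuous_onI)
  then show "(\<lambda>\<omega>. f (x + X \<omega>)) \<in> borel_measurable M"
    by (rule measurable_compose[rotated]) (use X in measurable)
qed (use assms(2) in auto)

text \<open>A supremum of reals carries information only for sets bounded above. The bound covers
  every process, since a function that is not integrable has integral 0.\<close>

lemma G_semigroup_bdd_above:
  fixes f :: "real \<Rightarrow> real"
  assumes "\<And>x. \<bar>f x\<bar> \<le> B"
  shows "bdd_above ((\<lambda>\<sigma>. LINT \<omega>|M. f (x + ito_integral M F W \<sigma> t \<omega>)) ` A)"
proof (rule bdd_aboveI2)
  fix \<sigma>
  have "\<bar>LINT \<omega>|M. f (x + ito_integral M F W \<sigma> t \<omega>)\<bar> \<le> (LINT \<omega>|M. \<bar>f (x + ito_integral M F W \<sigma> t \<omega>)\<bar>)"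
    by (rule integral_abs_bound)
  also have "\<dots> \<le> (LINT \<omega>|M. B)"
  proof (rule integral_mono_AE')
    show "AE \<omega> in M. 0 \<le> B" using assms[of 0] by simp
  qed (use assms in auto)
  finally show "(LINT \<omega>|M. f (x + ito_integral M F W \<sigma> t \<omega>)) \<le> B" by (simp add: prob_space)
qed

lemma C11_ito_expectation:
  assumes C: "C11 K f D" and B: "\<And>x. \<bar>f x\<bar> \<le> B"
    and \<sigma>: "\<sigma> \<in> admissible_controls M F \<sigma>l \<sigma>u" "0 \<le> \<sigma>l" and t: "0 < t"
  shows "\<bar>(LINT \<omega>|M. f (x + ito_integral M F W \<sigma> t \<omega>)) - f x\<bar> \<le> 4 * K * \<sigma>u\<^sup>2 * t"
proof -
  let ?X = "ito_integral M F W \<sigma> t"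
  have X: "is_ito_integral M F W \<sigma> t ?X" by (rule ito_integral_correct[OF \<sigma> t])
  have mX: "?X \<in> borel_measurable M" using X by (simp add: is_ito_integral_def)
  have p: "progressively_measurable F \<sigma>" using \<sigma> by (simp add: admissible_controls_def)
  have t0: "0 \<le> t" using t by simp
  note mean = ito_integral_mean[OF X t0]
  have "\<bar>\<sigma> s \<omega>\<bar> \<le> \<sigma>u" if "s \<in> {0..t}" "\<omega> \<in> space M" for s \<omega>
    using that by (intro admissible_bound[OF \<sigma>]) auto
  note sq = ito_integral_second_moment[OF X p t0 this]
  have cont: "continuous_on UNIV f"
    using C11_has_derivative[OF C] by (meson DERIV_continuous_on has_field_derivative_at_within)
  have intf: "integrable M (\<lambda>\<omega>. f (x + ?X \<omega>))" by (rule integrable_bounded_continuous[OF cont B mX])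
  have "(LINT \<omega>|M. f (x + ?X \<omega>)) - f x = (LINT \<omega>|M. f (x + ?X \<omega>) - f x - D x * ?X \<omega>)"
    using intf mean by (simp add: prob_space)
  then have "\<bar>(LINT \<omega>|M. f (x + ?X \<omega>)) - f x\<bar> = \<bar>LINT \<omega>|M. f (x + ?X \<omega>) - f x - D x * ?X \<omega>\<bar>"
    by (rule arg_cong)
  also have "\<dots> \<le> (LINT \<omega>|M. \<bar>f (x + ?X \<omega>) - f x - D x * ?X \<omega>\<bar>)"
    by (rule integral_abs_bound)
  also have "\<dots> \<le> (LINT \<omega>|M. K * (?X \<omega>)\<^sup>2)"
  proof (intro integral_mono integrable_abs Bochner_Integration.integrable_diff intf integrable_mult_right mean sq integrable_const)
    fix \<omega>
    show "\<bar>f (x + ?X \<omega>) - f x - D x * ?X \<omega>\<bar> \<le> K * (?X \<omega>)\<^sup>2"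
      using C[unfolded C11_def, rule_format, of "x + ?X \<omega>" x] by simp
  qed
  also have "\<dots> = K * expectation (\<lambda>\<omega>. (?X \<omega>)\<^sup>2)" by simp
  also have "\<dots> \<le> K * (4 * \<sigma>u\<^sup>2 * t)" by (intro mult_left_mono sq C11_nonneg[OF C])
  finally show ?thesis by (simp add: mult_ac)
qed

lemma C11_imp_lipschitz_set:
  assumes C: "C11 K f D" and B: "\<And>x. \<bar>f x\<bar> \<le> B" and \<sigma>: "0 \<le> \<sigma>l" "\<sigma>l \<le> \<sigma>u"
  shows "f \<in> lipschitz_set (G_semigroup M F W \<sigma>l \<sigma>u)"
  unfolding lipschitz_set_iff
proof (intro conjI exI ballI allI)
  show "f \<in> BUC" by (rule bounded_C11_imp_BUC[OF C B])
  \<comment> \<open>The estimate holds for all positive times, so the value 1 for the threshold is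
    arbitrary.\<close>
  show "(0::real) < 1" by simp
  show "0 \<le> 4 * K * \<sigma>u\<^sup>2" using C11_nonneg[OF C] by simp
  fix h x :: real assume "h \<in> {0<..1}"
  then have h: "0 < h" by simp
  let ?A = "admissible_controls M F \<sigma>l \<sigma>u"
  let ?E = "\<lambda>\<sigma>. LINT \<omega>|M. f (x + ito_integral M F W \<sigma> h \<omega>)"
  have E: "\<bar>?E s - f x\<bar> \<le> 4 * K * \<sigma>u\<^sup>2 * h" if "s \<in> ?A" for s
    by (rule C11_ito_expectation[OF C B that \<sigma>(1) h])
  have ne: "(\<lambda>_ _. \<sigma>u) \<in> ?A" using \<sigma> by (intro const_admissible) auto
  have "(SUP s\<in>?A. ?E s) \<le> f x + 4 * K * \<sigma>u\<^sup>2 * h"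
    using ne E by (intro cSUP_least) (auto simp: abs_le_iff algebra_simps)
  moreover have "f x - 4 * K * \<sigma>u\<^sup>2 * h \<le> (SUP s\<in>?A. ?E s)"
    using E[OF ne] by (intro cSUP_upper2[OF G_semigroup_bdd_above[OF B] ne]) (simp add: abs_le_iff)
  ultimately show "\<bar>G_semigroup M F W \<sigma>l \<sigma>u h f x - f x\<bar> \<le> 4 * K * \<sigma>u\<^sup>2 * h"
    unfolding G_semigroup_def by (simp add: abs_le_iff)
qed

lemma G_semigroup_ge_heat:
  assumes f: "f \<in> BUC" and \<sigma>: "0 \<le> \<sigma>l" "\<sigma>l \<le> \<sigma>u" and t: "0 < t"
  shows "(LINT \<omega>|M. f (x + \<sigma>u * (W t \<omega> - W 0 \<omega>))) \<le> G_semigroup M F W \<sigma>l \<sigma>u t f x"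
proof -
  obtain B where cont: "continuous_on UNIV f" and B: "\<And>x. \<bar>f x\<bar> \<le> B" using BUC_D[OF f] by blast
  have [measurable]: "f \<in> borel_measurable borel" using cont by (rule borel_measurable_continuous_onI)
  let ?s = "\<lambda>(_::real) (_::'a). \<sigma>u"
  have adm: "?s \<in> admissible_controls M F \<sigma>l \<sigma>u" using \<sigma> by (intro const_admissible) auto
  have X: "is_ito_integral M F W ?s t (ito_integral M F W ?s t)"
    by (rule ito_integral_correct[OF adm \<sigma>(1) t])
  then have [measurable]: "ito_integral M F W ?s t \<in> borel_measurable M" by (simp add: is_ito_integral_def)
  have [measurable]: "W t \<in> borel_measurable M" "W 0 \<in> borel_measurable M" using t by (auto intro: W_measurable)
  have "AE \<omega> in M. ito_integral M F W ?s t \<omega> = \<sigma>u * (W t \<omega> - W 0 \<omega>)"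
    using t by (intro ito_integral_const X) simp
  then have "AE \<omega> in M. f (x + \<sigma>u * (W t \<omega> - W 0 \<omega>)) = f (x + ito_integral M F W ?s t \<omega>)"
    by eventually_elim simp
  then have "(LINT \<omega>|M. f (x + \<sigma>u * (W t \<omega> - W 0 \<omega>))) = (LINT \<omega>|M. f (x + ito_integral M F W ?s t \<omega>))"
    by (intro integral_cong_AE) auto
  also have "\<dots> \<le> G_semigroup M F W \<sigma>l \<sigma>u t f x"
    unfolding G_semigroup_def by (rule cSUP_upper[OF adm G_semigroup_bdd_above[OF B]])
  finally show ?thesis .
qed

text \<open>Where \<open>f\<close> is touched from above by a sharply concave quartic polynomial, the heat flow
  would have to decrease \<open>f\<close> faster than at rate \<open>C\<close>.\<close>

lemma heat_lower_bound_imp_semiconvex: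
  assumes f: "f \<in> BUC" and v: "0 < v" and h0: "0 < h0" and C: "0 \<le> C"
    and lower: "\<And>h x. 0 < h \<Longrightarrow> h \<le> h0 \<Longrightarrow> f x - C * h \<le> (LINT \<omega>|M. f (x + v * (W h \<omega> - W 0 \<omega>)))"
  shows "convex_on UNIV (\<lambda>x. f x + (2 * (C + 1) / v\<^sup>2) / 2 * x\<^sup>2)"
proof (rule ccontr)
  \<comment> \<open>Chosen so that K v^2 / 2 = C + 1: the parabola forces a decrease at a rate
    exceeding the permitted C by 1.\<close>
  define K where "K = 2 * (C + 1) / v\<^sup>2"
  obtain B where cont: "continuous_on UNIV f" and B: "\<And>x. \<bar>f x\<bar> \<le> B" using BUC_D[OF f] by blast
  assume "\<not> ?thesis"
  then have nc: "\<not> convex_on UNIV (\<lambda>x. f x + K / 2 * x\<^sup>2)" unfolding K_def .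
  have K: "0 \<le> K" using C v by (simp add: K_def)
  obtain x0 p A where A: "0 \<le> A"
    and touch: "\<And>y. f (x0 + y) \<le> f x0 + p * y - K / 2 * y\<^sup>2 + A * y ^ 4"
    by (rule not_semiconvex_touching[OF cont B K nc]) (rule that)
  have Kv: "K / 2 * v\<^sup>2 = C + 1" using v by (simp add: K_def)
  \<comment> \<open>The quartic term has expectation q h^2, as the fourth moment of the increment is
    3 h^2.\<close>
  define q where "q = 3 * A * v ^ 4"
  have q: "0 \<le> q" using A by (simp add: q_def)
  \<comment> \<open>Small enough that q h < 1, so that the error q h^2 cannot make up for the
    surplus decrease h.\<close>
  define h where "h = min h0 (1 / (q + 1))"
  have h: "0 < h" "h \<le> h0" using h0 q by (auto simp: h_def)
  let ?\<Delta> = "\<lambda>\<omega>. W h \<omega> - W 0 \<omega>"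
  have [measurable]: "W h \<in> borel_measurable M" "W 0 \<in> borel_measurable M" using h by (auto intro: W_measurable)
  note m = increment_moments[OF order_refl less_imp_le[OF h(1)]]
  have "f x0 - C * h \<le> (LINT \<omega>|M. f (x0 + v * ?\<Delta> \<omega>))" by (rule lower[OF h])
  also have "\<dots> \<le> (LINT \<omega>|M. f x0 + p * v * ?\<Delta> \<omega> - K / 2 * v\<^sup>2 * (?\<Delta> \<omega>)\<^sup>2 + A * v ^ 4 * ?\<Delta> \<omega> ^ 4)"
  proof (rule integral_mono)
    show "integrable M (\<lambda>\<omega>. f x0 + p * v * ?\<Delta> \<omega> - K / 2 * v\<^sup>2 * (?\<Delta> \<omega>)\<^sup>2 + A * v ^ 4 * ?\<Delta> \<omega> ^ 4)"
      by (rule Bochner_Integration.integrable_add Bochner_Integration.integrable_diff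
          integrable_mult_right integrable_const m(1,3,5))+
    show "integrable M (\<lambda>\<omega>. f (x0 + v * ?\<Delta> \<omega>))"
      by (rule integrable_bounded_continuous[OF cont B]) measurable
    show "f (x0 + v * ?\<Delta> \<omega>) \<le> f x0 + p * v * ?\<Delta> \<omega> - K / 2 * v\<^sup>2 * (?\<Delta> \<omega>)\<^sup>2 + A * v ^ 4 * ?\<Delta> \<omega> ^ 4" for \<omega>
      using touch[of "v * ?\<Delta> \<omega>"] by (simp only: power_mult_distrib mult.assoc)
  qed
  also have "\<dots> = f x0 - K / 2 * v\<^sup>2 * h + q * h\<^sup>2"
  proof -
    have i: "integrable M (\<lambda>\<omega>. p * v * ?\<Delta> \<omega>)" "integrable M (\<lambda>\<omega>. K / 2 * v\<^sup>2 * (?\<Delta> \<omega>)\<^sup>2)"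
      "integrable M (\<lambda>\<omega>. A * v ^ 4 * ?\<Delta> \<omega> ^ 4)"
      by (rule integrable_mult_right m(1,3,5))+
    note i1 = Bochner_Integration.integrable_add[OF integrable_const[of "f x0"] i(1)]
    note i2 = Bochner_Integration.integrable_diff[OF i1 i(2)]
    have "(LINT \<omega>|M. f x0 + p * v * ?\<Delta> \<omega> - K / 2 * v\<^sup>2 * (?\<Delta> \<omega>)\<^sup>2 + A * v ^ 4 * ?\<Delta> \<omega> ^ 4) =
        f x0 + (LINT \<omega>|M. p * v * ?\<Delta> \<omega>) - (LINT \<omega>|M. K / 2 * v\<^sup>2 * (?\<Delta> \<omega>)\<^sup>2) + (LINT \<omega>|M. A * v ^ 4 * ?\<Delta> \<omega> ^ 4)"
      unfolding Bochner_Integration.integral_add[OF i2 i(3)] Bochner_Integration.integral_diff[OF i1 i(2)]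
        Bochner_Integration.integral_add[OF integrable_const i(1)]
      by (simp add: prob_space)
    also have "\<dots> = f x0 - K / 2 * v\<^sup>2 * h + q * h\<^sup>2"
      unfolding integral_mult_right_zero m(2,4,6) by (simp add: q_def)
    finally show ?thesis .
  qed
  also have "\<dots> = f x0 - C * h - h + q * h\<^sup>2" unfolding Kv by (simp add: algebra_simps)
  finally have "h \<le> q * h * h" by (simp add: power2_eq_square)
  then have "1 \<le> q * h" using h(1) by simp
  also have "q * h \<le> q * (1 / (q + 1))" using q by (intro mult_left_mono) (auto simp: h_def)
  also have "\<dots> < 1" using q by simp
  finally show False by simp
qed

lemma sym_lipschitz_set_imp_W2infty:
  assumes f: "f \<in> sym_lipschitz_set (G_semigroup M F W \<sigma>l \<sigma>u)"
    and \<sigma>: "0 \<le> \<sigma>l" "\<sigma>l \<le> \<sigma>u" "0 < \<sigma>u"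
  shows "f \<in> W2infty"
proof -
  let ?S = "G_semigroup M F W \<sigma>l \<sigma>u"
  have fB: "f \<in> BUC" using f by (simp add: sym_lipschitz_set_def)
  obtain B where cont: "continuous_on UNIV f" and B: "\<And>x. \<bar>f x\<bar> \<le> B" using BUC_D[OF fB] by blast
  obtain h1 C1 where 1: "0 < h1" "0 \<le> C1" "\<And>h x. h \<in> {0<..h1} \<Longrightarrow> \<bar>?S h f x - f x\<bar> \<le> C1 * h"
    using f by (auto simp: sym_lipschitz_set_def lipschitz_set_iff)
  obtain h2 C2 where 2: "0 < h2" "0 \<le> C2"
    "\<And>h x. h \<in> {0<..h2} \<Longrightarrow> \<bar>?S h (\<lambda>x. - f x) x - - f x\<bar> \<le> C2 * h"
    using f by (auto simp: sym_lipschitz_set_def lipschitz_set_iff)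
  define C where "C = max C1 C2"
  define h0 where "h0 = min h1 h2"
  have C: "0 \<le> C" "C1 \<le> C" "C2 \<le> C" and h0: "0 < h0" using 1 2 by (auto simp: C_def h0_def)
  let ?E = "\<lambda>h x. LINT \<omega>|M. f (x + \<sigma>u * (W h \<omega> - W 0 \<omega>))"
  have bounds: "f x - C * h \<le> ?E h x" "- f x - C * h \<le> - ?E h x" if h: "0 < h" "h \<le> h0" for h x
  proof -
    have "C1 * h \<le> C * h" "C2 * h \<le> C * h" using C h by (auto intro: mult_right_mono)
    moreover have "?E h x \<le> ?S h f x" by (rule G_semigroup_ge_heat[OF fB \<sigma>(1,2) h(1)])
    moreover have "- ?E h x \<le> ?S h (\<lambda>x. - f x) x"
      using G_semigroup_ge_heat[OF uminus_BUC[OF fB] \<sigma>(1,2) h(1)] by simp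
    moreover have "\<bar>?S h f x - f x\<bar> \<le> C1 * h" "\<bar>?S h (\<lambda>x. - f x) x - - f x\<bar> \<le> C2 * h"
      using 1(3)[of h x] 2(3)[of h x] h by (auto simp: h0_def)
    ultimately show "f x - C * h \<le> ?E h x" "- f x - C * h \<le> - ?E h x" by linarith+
  qed
  have "convex_on UNIV (\<lambda>x. f x + (2 * (C + 1) / \<sigma>u\<^sup>2) / 2 * x\<^sup>2)"
    by (rule heat_lower_bound_imp_semiconvex[OF fB \<sigma>(3) h0 C(1) bounds(1)])
  moreover have "convex_on UNIV (\<lambda>x. - f x + (2 * (C + 1) / \<sigma>u\<^sup>2) / 2 * x\<^sup>2)"
  proof (rule heat_lower_bound_imp_semiconvex[OF uminus_BUC[OF fB] \<sigma>(3) h0 C(1)])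
    show "- f x - C * h \<le> (LINT \<omega>|M. - f (x + \<sigma>u * (W h \<omega> - W 0 \<omega>)))" if "0 < h" "h \<le> h0" for h x
      using bounds(2)[OF that, of x] by simp
  qed
  ultimately obtain D where "C11 (2 * (C + 1) / \<sigma>u\<^sup>2 / 2) f D"
    using semiconvex_semiconcave_imp_C11 by blast
  then show ?thesis using B by (rule bounded_C11_imp_W2infty)
qed

lemma W2infty_imp_sym_lipschitz_set:
  assumes f: "f \<in> W2infty" and \<sigma>: "0 \<le> \<sigma>l" "\<sigma>l \<le> \<sigma>u"
  shows "f \<in> sym_lipschitz_set (G_semigroup M F W \<sigma>l \<sigma>u)"
proof -
  obtain K D B where C: "C11 K f D" and B: "\<And>x. \<bar>f x\<bar> \<le> B" using W2infty_imp_C11[OF f] by metis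
  have "f \<in> lipschitz_set (G_semigroup M F W \<sigma>l \<sigma>u)"
    by (rule C11_imp_lipschitz_set[OF C B \<sigma>])
  moreover have "(\<lambda>x. - f x) \<in> lipschitz_set (G_semigroup M F W \<sigma>l \<sigma>u)"
    using B by (intro C11_imp_lipschitz_set[OF C11_uminus[OF C] _ \<sigma>, of B]) simp
  ultimately show ?thesis
    using bounded_C11_imp_BUC[OF C B] by (simp add: sym_lipschitz_set_def)
qed

end

theorem lemma5p5:
  fixes M :: "'a measure" and F :: "real \<Rightarrow> 'a measure" and W :: "real \<Rightarrow> 'a \<Rightarrow> real"
    and \<sigma>l \<sigma>u :: real
  assumes "filtered_prob_space M F"
    and "brownian_motion M F W"
    and "0 \<le> \<sigma>l" and "\<sigma>l \<le> \<sigma>u"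
    and nondegenerate: "0 < \<sigma>u"
  shows "sym_lipschitz_set (G_semigroup M F W \<sigma>l \<sigma>u) = W2infty"
proof -
  interpret brownian_setup M F W
    using assms(1,2) by (auto simp: brownian_setup_def brownian_setup_axioms_def filtered_prob_space_def)
  show ?thesis
    using assms sym_lipschitz_set_imp_W2infty W2infty_imp_sym_lipschitz_set by blast
qed

end
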